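(* Let $\mathbf D=\mathbf D(k,\pi_\bullet)$ be a generalized divided power algebra over a noetherian commutative ring $k$. The following are equivalent: (a) every finitely presented $\mathbf D$-module (graded or ungraded) is torsion-free; (b) every maximal ideal of $k$ contains $\pi_n$ for infinitely many $n$.
   Context: $\pi$-sequences. A $\pi$-sequence in $k$ is a sequence $(\pi_n)_{n\ge2}$ in $k$, with $\pi_1=0$. For integers $j\ge1$ and $n,m\ge0$ put $\epsilon_j(n,m)=\lfloor (n+m)/j\rfloor-\lfloor n/j\rfloor-\lfloor m/j\rfloor$, and $C(n,m)=\prod_{j\ge2}\pi_j^{\epsilon_j(n-m,m)}$. The sequence is admissible if, whenever $(\pi_n,\pi_m)\ne k$, $n\mid m$ or $m\mid n$. GDPAs. $\mathbf D(k,\pi_\bullet)$ is the graded $k$-algebra free on basis $x^{[i]}$ ($\deg x^{[i]}=i$) with $x^{[n-m]}x^{[m]}=C(n,m)x^{[n]}$. A GDPA is such an algebra with $\pi_\bullet$ admissible. Torsion. An element $m$ of a $\mathbf D$-module $M$ is torsion if $x^{[n]}m=0$ for all sufficiently large $n$. The module $M$ is torsion-free if its only torsion element is $0$, and torsion if all its elements are torsion. *)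

theory Defs
  imports Main
begin

definition cr_ideal :: "'k::comm_ring_1 set \<Rightarrow> bool" where
  "cr_ideal I \<longleftrightarrow> 0 \<in> I \<and> (\<forall>x\<in>I. \<forall>y\<in>I. x + y \<in> I) \<and> (\<forall>r. \<forall>x\<in>I. r * x \<in> I)"

definition noetherian :: "'k::comm_ring_1 itself \<Rightarrow> bool" where
  "noetherian _ \<longleftrightarrow> (\<forall>I::'k set. cr_ideal I \<longrightarrow>
      (\<exists>S. finite S \<and> S \<subseteq> I \<and> (\<forall>J. cr_ideal J \<and> S \<subseteq> J \<longrightarrow> I \<subseteq> J)))"

definition maximal_ideal :: "'k::comm_ring_1 set \<Rightarrow> bool" where
  "maximal_ideal M \<longleftrightarrow> cr_ideal M \<and> M \<noteq> UNIV \<and>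
     (\<forall>J. cr_ideal J \<and> M \<subseteq> J \<longrightarrow> J = M \<or> J = UNIV)"

definition eps :: "nat \<Rightarrow> nat \<Rightarrow> nat \<Rightarrow> nat" where
  "eps j n m = (n + m) div j - n div j - m div j"

text \<open>C(n,m) = prod over j \<ge> 2 of pi_j ^ eps_j(n-m,m); the factors with j > n are 1
  since eps_j(n-m,m) = 0 there, so the product is over {2..n}.\<close>
definition Cnm :: "(nat \<Rightarrow> 'k::comm_ring_1) \<Rightarrow> nat \<Rightarrow> nat \<Rightarrow> 'k" where
  "Cnm \<pi> n m = (\<Prod>j\<in>{2..n}. \<pi> j ^ eps j (n - m) m)"

definition admissible :: "(nat \<Rightarrow> 'k::comm_ring_1) \<Rightarrow> bool" where
  "admissible \<pi> \<longleftrightarrow> (\<forall>n\<ge>2. \<forall>m\<ge>2.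
      \<not> (\<exists>a b. a * \<pi> n + b * \<pi> m = 1) \<longrightarrow> n dvd m \<or> m dvd n)"

section \<open>The algebra D(k,pi): elements are finitely supported coefficient
  functions (f i = coefficient of x^[i])\<close>

definition Delem :: "(nat \<Rightarrow> 'k::zero) \<Rightarrow> bool" where
  "Delem f \<longleftrightarrow> finite {i. f i \<noteq> 0}"

text \<open>Product, determined by x^[n-m] x^[m] = C(n,m) x^[n].\<close>
definition Dmult :: "(nat \<Rightarrow> 'k::comm_ring_1) \<Rightarrow> (nat \<Rightarrow> 'k) \<Rightarrow> (nat \<Rightarrow> 'k) \<Rightarrow> nat \<Rightarrow> 'k" where
  "Dmult \<pi> f g n = (\<Sum>m\<le>n. Cnm \<pi> n m * f (n - m) * g m)"

definition xdp :: "nat \<Rightarrow> nat \<Rightarrow> 'k::zero_neq_one" where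
  "xdp i = (\<lambda>j. if j = i then 1 else 0)"

definition homogeneous :: "(nat \<Rightarrow> 'k::zero) \<Rightarrow> int \<Rightarrow> bool" where
  "homogeneous f d \<longleftrightarrow> (\<forall>s. int s \<noteq> d \<longrightarrow> f s = 0)"

section \<open>Finitely presented modules M = D^r / (image of an r x s matrix A over D)\<close>

text \<open>Vectors in D^r are functions v with v i \<in> D for i < r (entries i \<ge> r ignored).
  v lies in the image of A (the submodule spanned by the s columns of A).\<close>
definition in_image :: "(nat \<Rightarrow> 'k::comm_ring_1) \<Rightarrow> nat \<Rightarrow> nat \<Rightarrow>
    (nat \<Rightarrow> nat \<Rightarrow> nat \<Rightarrow> 'k) \<Rightarrow> (nat \<Rightarrow> nat \<Rightarrow> 'k) \<Rightarrow> bool" where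
  "in_image \<pi> r s A v \<longleftrightarrow> (\<exists>c. (\<forall>j<s. Delem (c j)) \<and>
      (\<forall>i<r. v i = (\<lambda>t. \<Sum>j<s. Dmult \<pi> (A i j) (c j) t)))"

definition Dvec :: "nat \<Rightarrow> (nat \<Rightarrow> nat \<Rightarrow> 'k::zero) \<Rightarrow> bool" where
  "Dvec r v \<longleftrightarrow> (\<forall>i<r. Delem (v i))"

definition Dmatrix :: "nat \<Rightarrow> nat \<Rightarrow> (nat \<Rightarrow> nat \<Rightarrow> nat \<Rightarrow> 'k::zero) \<Rightarrow> bool" where
  "Dmatrix r s A \<longleftrightarrow> (\<forall>i<r. \<forall>j<s. Delem (A i j))"

definition fp_torsion :: "(nat \<Rightarrow> 'k::comm_ring_1) \<Rightarrow> nat \<Rightarrow> nat \<Rightarrow>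
    (nat \<Rightarrow> nat \<Rightarrow> nat \<Rightarrow> 'k) \<Rightarrow> (nat \<Rightarrow> nat \<Rightarrow> 'k) \<Rightarrow> bool" where
  "fp_torsion \<pi> r s A v \<longleftrightarrow> (\<exists>N0. \<forall>N\<ge>N0. in_image \<pi> r s A (\<lambda>i. Dmult \<pi> (xdp N) (v i)))"

definition fp_torsion_free :: "(nat \<Rightarrow> 'k::comm_ring_1) \<Rightarrow> nat \<Rightarrow> nat \<Rightarrow>
    (nat \<Rightarrow> nat \<Rightarrow> nat \<Rightarrow> 'k) \<Rightarrow> bool" where
  "fp_torsion_free \<pi> r s A \<longleftrightarrow>
     (\<forall>v. Dvec r v \<and> fp_torsion \<pi> r s A v \<longrightarrow> in_image \<pi> r s A v)"

end

theory Submission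
  imports Defs "HOL.Modules" "HOL-Library.Function_Algebras" "HOL-Library.Infinite_Set"
begin

text \<open>
  If a maximal ideal M contains only finitely many parameters, let N be the largest index with
  \<pi>(N) in M. By admissibility the other such indices divide N, so C(n,N) is a unit modulo M for
  all n \<ge> N, and D/(M, x^[N]) is a nonzero torsion module.

  Conversely, localize at a maximal ideal M and rescale the basis so that \<pi>(j) = 1 unless j lies in
  the infinite divisibility chain P of indices with \<pi>(j) in M. Coherence of D/I and
  torsion-freeness of its finitely presented modules are proved simultaneously by noetherian
  induction on the ideal I of k:

  \<^item> if a b lies in I but a and b do not, both properties for I follow from those for I + (a) and (I : a);

  \<^item> if I is prime and contains \<pi>(Q) for infinitely many Q in P, then D/I is free over a truncated part
  of degrees below Q, and everything reduces to finitely generated k-modules;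

  \<^item> if I is prime and contains only finitely many, with largest index Q, then D is free over the span
  of the x^[jQ], which modulo I becomes a polynomial ring in one variable over the fraction field.
  Kernels are then direct summands up to a scalar \<alpha> outside I, and Krull's intersection theorem
  shows that a torsion element is killed by such an \<alpha>; both properties descend from I + (\<alpha>).
\<close>

section \<open>Structure constants\<close>

text \<open>In general D is not noetherian, so a submodule such as (Z : a) need not be finitely
  generated when Z is. The passage from I to I + (a) and (I : a) meets such submodules, which is why
  coherence has to travel through the same induction. For the same reason Krull's theorem is applied
  over k, to the coefficients in degrees below some Q in P. Its input is a computation with carries.
  Let v and the generators of Z have degree below Q, and let N be an element of P with N \<ge> Q.
  The coefficients of x^[N] v in degrees N, ..., N + Q - 1 are those of v, whereas an element of Z
  has there the low coefficients of some element of Z, up to multiples of the product of all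
  \<pi>(l) with l in P and Q \<le> l \<le> N. As N grows, these products lie in ever higher powers
  of M; so v agrees with an element of Z in all degrees below Q, up to a scalar outside M. The
  difference is x^[j] w up to a scalar, with j as large as desired, and over the fraction field of
  k/I a single exponent kills all the torsion. For this j, x^[j] w lies in Z up to a scalar outside
  I.\<close>

definition cc :: "(nat \<Rightarrow> 'k::comm_ring_1) \<Rightarrow> nat \<Rightarrow> nat \<Rightarrow> 'k" where
  "cc \<pi> a b = Cnm \<pi> (a + b) b"

lemma div_add_eps: "(a + b) div j = a div j + b div j + eps j a b"
  using div_add1_eq[of a b j] by (simp add: eps_def)

text \<open>Two residues modulo j add up to less than 2 * j, so \<open>eps j a b\<close> is the
  carry, 0 or 1, of their addition.\<close>

lemma eps_mod: "j > 0 \<Longrightarrow> eps j a b = (if a mod j + b mod j < j then 0 else 1)"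
proof -
  assume j: "j > 0"
  have "eps j a b = (a mod j + b mod j) div j"
    using div_add1_eq[of a b j] by (simp add: eps_def)
  moreover have "a mod j + b mod j < 2 * j"
    using mod_less_divisor[OF j, of a] mod_less_divisor[OF j, of b] by linarith
  ultimately show ?thesis
    using j by (simp add: div_nat_eqI)
qed

lemma eps_commute: "eps j a b = eps j b a"
  by (simp add: eps_def add.commute)

lemma eps_cocycle: "eps j a b + eps j (a + b) c = eps j b c + eps j a (b + c)"
  using div_add_eps[of a b j] div_add_eps[of "a + b" c j] div_add_eps[of b c j]
    div_add_eps[of a "b + c" j] by (simp add: add.assoc)

lemma cc_eq_prod: "cc \<pi> a b = (\<Prod>j\<in>{2..a + b}. \<pi> j ^ eps j a b)"
  by (simp add: cc_def Cnm_def)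

text \<open>A common upper bound lets structure constants with different sums a + b be multiplied
  factor by factor.\<close>

lemma cc_eq_prod_le:
  assumes "a + b \<le> N"
  shows "cc \<pi> a b = (\<Prod>j\<in>{2..N}. \<pi> j ^ eps j a b)"
  unfolding cc_eq_prod
  by (rule prod.mono_neutral_left) (use assms in \<open>auto simp: eps_def\<close>)

lemma cc_commute: "cc \<pi> a b = cc \<pi> b a"
  by (simp add: cc_eq_prod eps_commute[of _ a b] add.commute[of a b])

text \<open>This is the associativity of x^[a] x^[b] = \<open>cc \<pi> a b\<close> x^[a+b]. It holds
  because \<open>eps j\<close> is the coboundary of the function n div j.\<close>

lemma cc_cocycle: "cc \<pi> a b * cc \<pi> (a + b) c = cc \<pi> b c * cc \<pi> a (b + c)"
proof -
  let ?N = "a + b + c"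
  have "cc \<pi> a b * cc \<pi> (a + b) c = (\<Prod>j\<in>{2..?N}. \<pi> j ^ (eps j a b + eps j (a + b) c))"
    by (simp add: cc_eq_prod_le[of _ _ ?N] power_add prod.distrib)
  also have "\<dots> = cc \<pi> b c * cc \<pi> a (b + c)"
    by (simp add: eps_cocycle cc_eq_prod_le[of _ _ ?N] power_add prod.distrib)
  finally show ?thesis .
qed

lemma cc_0 [simp]: "cc \<pi> 0 b = 1" "cc \<pi> a 0 = 1"
  by (simp_all add: cc_eq_prod eps_def)

section \<open>Free modules over the algebra\<close>

text \<open>The entry v i n of a vector is the coefficient of x^[n] in its i-th component, and X \<pi> n is
  multiplication by x^[n].\<close>

type_synonym 'k vec = "nat \<Rightarrow> nat \<Rightarrow> 'k"

definition sm :: "'k::comm_ring_1 \<Rightarrow> 'k vec \<Rightarrow> 'k vec" where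
  "sm c v = (\<lambda>i n. c * v i n)"

lemma sm_apply: "sm c v i n = c * v i n"
  by (simp add: sm_def)

text \<open>Induction rules leave function-valued terms eta-expanded, where the pointwise rules
  would rewrite under the abstraction and hide sums and scalar multiples of vectors.\<close>

declare plus_fun_apply [simp del] zero_fun_apply [simp del] minus_apply [simp del]
  uminus_apply [simp del]

lemmas vec_apply = plus_fun_apply zero_fun_apply minus_apply uminus_apply sm_apply

interpretation V: module sm
  by unfold_locales (auto simp: fun_eq_iff vec_apply algebra_simps)

definition X :: "(nat \<Rightarrow> 'k::comm_ring_1) \<Rightarrow> nat \<Rightarrow> 'k vec \<Rightarrow> 'k vec" where
  "X \<pi> n v = (\<lambda>i m. if n \<le> m then cc \<pi> n (m - n) * v i (m - n) else 0)"

lemma X_apply: "X \<pi> n v i m = (if n \<le> m then cc \<pi> n (m - n) * v i (m - n) else 0)"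
  by (simp add: X_def)

lemma X_add_apply [simp]: "X \<pi> n v i (n + m) = cc \<pi> n m * v i m"
  by (simp add: X_def)

lemma X_0 [simp]: "X \<pi> 0 v = v"
  by (simp add: X_def)

lemma X_add: "X \<pi> n (v + w) = X \<pi> n v + X \<pi> n w"
  by (auto simp: X_def fun_eq_iff vec_apply algebra_simps)

lemma X_diff: "X \<pi> n (v - w) = X \<pi> n v - X \<pi> n w"
  by (auto simp: X_def fun_eq_iff vec_apply algebra_simps)

lemma X_zero [simp]: "X \<pi> n 0 = 0"
  by (auto simp: X_def fun_eq_iff vec_apply)

lemma X_sm: "X \<pi> n (sm c v) = sm c (X \<pi> n v)"
  by (auto simp: X_def fun_eq_iff vec_apply algebra_simps)

lemma X_X: "X \<pi> a (X \<pi> b v) = sm (cc \<pi> a b) (X \<pi> (a + b) v)"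
proof (intro ext)
  fix i m
  show "X \<pi> a (X \<pi> b v) i m = sm (cc \<pi> a b) (X \<pi> (a + b) v) i m"
  proof (cases "a + b \<le> m")
    case True
    then obtain c where m: "m = a + b + c" by (auto simp: le_iff_add)
    have 1: "a + b + c - a = b + c" "a + b + c - (a + b) = c" "b + c - b = c" by simp_all
    have "X \<pi> a (X \<pi> b v) i m = cc \<pi> b c * cc \<pi> a (b + c) * v i c"
      unfolding m X_apply 1 by simp
    also have "\<dots> = cc \<pi> a b * cc \<pi> (a + b) c * v i c"
      by (simp add: cc_cocycle)
    finally show ?thesis
      unfolding m sm_apply X_apply 1 by (simp add: mult.assoc)
  next
    case False
    then show ?thesis by (auto simp: X_apply vec_apply)
  qed
qed

lemma X_commute: "X \<pi> a (X \<pi> b v) = X \<pi> b (X \<pi> a v)"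
  by (simp add: X_X cc_commute[of \<pi> a b] add.commute[of a b])

lemma sum_vec_apply: "sum f A i n = (\<Sum>a\<in>A. f a i n)" for f :: "'a \<Rightarrow> 'k::comm_ring_1 vec"
  by (induction A rule: infinite_finite_induct) (auto simp: vec_apply)

text \<open>The free module D^r. Rows from r on are forced to vanish so that equality of functions
  is equality in D^r, and one degree bound serves all rows.\<close>

definition F :: "nat \<Rightarrow> 'k::comm_ring_1 vec set" where
  "F r = {v. (\<forall>i\<ge>r. \<forall>n. v i n = 0) \<and> (\<exists>B. \<forall>i. \<forall>n\<ge>B. v i n = 0)}"

lemma F_bound:
  assumes "v \<in> F r"
  obtains B where "\<And>i n. n \<ge> B \<Longrightarrow> v i n = 0"
  using assms by (auto simp: F_def)

lemma F_out: "v \<in> F r \<Longrightarrow> r \<le> i \<Longrightarrow> v i n = 0"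
  by (auto simp: F_def)

lemma FI: "(\<And>i n. r \<le> i \<Longrightarrow> v i n = 0) \<Longrightarrow> (\<And>i n. n \<ge> B \<Longrightarrow> v i n = 0) \<Longrightarrow> v \<in> F r"
  by (auto simp: F_def)

lemma finite_F_bound:
  assumes "finite G" "G \<subseteq> F r"
  obtains B where "\<And>g i n. g \<in> G \<Longrightarrow> n \<ge> B \<Longrightarrow> g i n = 0"
proof -
  have "\<exists>B. \<forall>g\<in>G. \<forall>i. \<forall>n\<ge>B. g i n = 0"
    using assms
  proof (induction G)
    case (insert g G)
    then obtain B where B: "\<forall>g\<in>G. \<forall>i. \<forall>n\<ge>B. g i n = 0" by auto
    obtain C where C: "\<And>i n. n \<ge> C \<Longrightarrow> g i n = 0" using insert.prems F_bound by blast
    show ?case by (rule exI[of _ "max B C"]) (use B C in auto)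
  qed auto
  then show ?thesis using that by blast
qed

definition subm :: "(nat \<Rightarrow> 'k::comm_ring_1) \<Rightarrow> 'k vec set \<Rightarrow> bool" where
  "subm \<pi> Z \<longleftrightarrow> V.subspace Z \<and> (\<forall>n. \<forall>z\<in>Z. X \<pi> n z \<in> Z)"

lemma submI:
  assumes "0 \<in> Z" "\<And>a b. a \<in> Z \<Longrightarrow> b \<in> Z \<Longrightarrow> a + b \<in> Z" "\<And>c a. a \<in> Z \<Longrightarrow> sm c a \<in> Z"
    "\<And>n a. a \<in> Z \<Longrightarrow> X \<pi> n a \<in> Z"
  shows "subm \<pi> Z"
  using assms by (auto simp: subm_def V.subspace_def)

lemma
  assumes "subm \<pi> Z"
  shows subm_0: "0 \<in> Z"
    and subm_add: "\<And>a b. a \<in> Z \<Longrightarrow> b \<in> Z \<Longrightarrow> a + b \<in> Z"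
    and subm_sm: "\<And>c a. a \<in> Z \<Longrightarrow> sm c a \<in> Z"
    and subm_X: "\<And>n a. a \<in> Z \<Longrightarrow> X \<pi> n a \<in> Z"
    and subm_diff: "\<And>a b. a \<in> Z \<Longrightarrow> b \<in> Z \<Longrightarrow> a - b \<in> Z"
    and subm_subspace: "V.subspace Z"
  using assms V.subspace_diff by (auto simp: subm_def V.subspace_def)

lemma subm_F: "subm \<pi> (F r)"
proof (rule submI)
  fix a b :: "'a vec" assume "a \<in> F r" "b \<in> F r"
  moreover from this obtain A B where "\<And>i n. n \<ge> A \<Longrightarrow> a i n = 0" "\<And>i n. n \<ge> B \<Longrightarrow> b i n = 0"
    using F_bound by metis
  ultimately show "a + b \<in> F r" by (intro FI[where B = "max A B"]) (auto simp: F_out vec_apply)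
next
  fix n and a :: "'a vec" assume a: "a \<in> F r"
  then obtain A where "\<And>i n. n \<ge> A \<Longrightarrow> a i n = 0" using F_bound by metis
  then show "X \<pi> n a \<in> F r" using a by (intro FI[where B = "A + n"]) (auto simp: F_out X_apply)
next
  fix c and a :: "'a vec" assume a: "a \<in> F r"
  then obtain A where "\<And>i n. n \<ge> A \<Longrightarrow> a i n = 0" using F_bound by metis
  then show "sm c a \<in> F r" using a by (intro FI[where B = A]) (auto simp: F_out vec_apply)
qed (auto simp: F_def vec_apply)

lemmas F_0 = subm_0[OF subm_F] and F_add = subm_add[OF subm_F] and F_sm = subm_sm[OF subm_F]
  and F_X = subm_X[OF subm_F] and F_diff = subm_diff[OF subm_F]

text \<open>The k-span of the shifts is already a D-submodule, because a product of two basis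
  elements of D is a scalar multiple of a third.\<close>

definition dspan :: "(nat \<Rightarrow> 'k::comm_ring_1) \<Rightarrow> 'k vec set \<Rightarrow> 'k vec set" where
  "dspan \<pi> G = V.span {X \<pi> n g |n g. g \<in> G}"

lemma dspan_base: "g \<in> G \<Longrightarrow> X \<pi> n g \<in> dspan \<pi> G"
  unfolding dspan_def by (rule V.span_base) auto

lemma dspan_inc: "g \<in> G \<Longrightarrow> g \<in> dspan \<pi> G"
  using dspan_base[of g G \<pi> 0] by simp

lemma dspan_induct [consumes 1, case_names zero base add]:
  assumes "z \<in> dspan \<pi> G" "P 0" "\<And>n g. g \<in> G \<Longrightarrow> P (X \<pi> n g)"
    "\<And>c a b. P a \<Longrightarrow> P b \<Longrightarrow> P (sm c a + b)"
  shows "P z"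
  using assms(1) unfolding dspan_def
proof (induction rule: V.span_induct_alt)
  case base
  show ?case by (rule assms(2))
next
  case (step c a b)
  then obtain n g where "a = X \<pi> n g" "g \<in> G" by blast
  then show ?case using assms(4)[OF assms(3) step(2)] by blast
qed

lemma subm_dspan: "subm \<pi> (dspan \<pi> G)"
proof (rule submI)
  show "0 \<in> dspan \<pi> G" unfolding dspan_def by (rule V.span_zero)
  show "a + b \<in> dspan \<pi> G" if "a \<in> dspan \<pi> G" "b \<in> dspan \<pi> G" for a b
    using that unfolding dspan_def by (rule V.span_add)
  show sc: "sm c a \<in> dspan \<pi> G" if "a \<in> dspan \<pi> G" for a c
    using that unfolding dspan_def by (rule V.span_scale)
  show "X \<pi> n a \<in> dspan \<pi> G" if "a \<in> dspan \<pi> G" for a n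
    using that
  proof (induction rule: dspan_induct)
    case zero
    show "X \<pi> n 0 \<in> dspan \<pi> G" by (simp add: dspan_def V.span_zero)
  next
    case (base m g)
    then show "X \<pi> n (X \<pi> m g) \<in> dspan \<pi> G" by (simp add: X_X sc dspan_base)
  next
    case (add c a b)
    then show "X \<pi> n (sm c a + b) \<in> dspan \<pi> G" unfolding X_add X_sm using sc
      by (auto simp: dspan_def intro: V.span_add)
  qed
qed

lemma dspan_least: "subm \<pi> Z \<Longrightarrow> G \<subseteq> Z \<Longrightarrow> dspan \<pi> G \<subseteq> Z"
  unfolding dspan_def by (rule V.span_minimal) (auto simp: subm_def)

lemma dspan_mono: "G \<subseteq> H \<Longrightarrow> dspan \<pi> G \<subseteq> dspan \<pi> H"
  by (rule dspan_least[OF subm_dspan]) (auto intro: dspan_inc)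

definition msum :: "'k::comm_ring_1 vec set \<Rightarrow> 'k vec set \<Rightarrow> 'k vec set" where
  "msum A B = {a + b |a b. a \<in> A \<and> b \<in> B}"

lemma subm_msum:
  assumes "subm \<pi> A" "subm \<pi> B" shows "subm \<pi> (msum A B)"
proof (rule submI)
  show "0 \<in> msum A B" unfolding msum_def using subm_0[OF assms(1)] subm_0[OF assms(2)] add_0
    by (metis (mono_tags, lifting) mem_Collect_eq)
  show "a + b \<in> msum A B" if "a \<in> msum A B" "b \<in> msum A B" for a b
  proof -
    from that obtain p q p' q' where "a = p + q" "b = p' + q'" "p \<in> A" "q \<in> B" "p' \<in> A" "q' \<in> B"
      by (auto simp: msum_def)
    then have "a + b = (p + p') + (q + q')" "p + p' \<in> A" "q + q' \<in> B"
      using assms by (auto simp: algebra_simps subm_add)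
    then show ?thesis by (auto simp: msum_def)
  qed
  show "sm c a \<in> msum A B" if "a \<in> msum A B" for a c
    using that assms by (force simp: msum_def V.scale_right_distrib intro: subm_sm)
  show "X \<pi> n a \<in> msum A B" if "a \<in> msum A B" for a n
    using that assms by (force simp: msum_def X_add intro: subm_X)
qed

lemma msum_left: "subm \<pi> B \<Longrightarrow> a \<in> A \<Longrightarrow> a \<in> msum A B"
  unfolding msum_def using subm_0[of \<pi> B] add_0_right by (metis (mono_tags, lifting) mem_Collect_eq)

lemma msum_right: "subm \<pi> A \<Longrightarrow> b \<in> B \<Longrightarrow> b \<in> msum A B"
  unfolding msum_def using subm_0[of \<pi> A] add_0 by (metis (mono_tags, lifting) mem_Collect_eq)

lemma msum_dspan: "msum (dspan \<pi> G) (dspan \<pi> H) = dspan \<pi> (G \<union> H)"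
proof
  show "msum (dspan \<pi> G) (dspan \<pi> H) \<subseteq> dspan \<pi> (G \<union> H)"
    using dspan_mono[of G "G \<union> H" \<pi>] dspan_mono[of H "G \<union> H" \<pi>]
    by (auto simp: msum_def intro!: subm_add[OF subm_dspan])
  show "dspan \<pi> (G \<union> H) \<subseteq> msum (dspan \<pi> G) (dspan \<pi> H)"
    by (intro dspan_least subm_msum subm_dspan)
      (auto intro: msum_left[OF subm_dspan] msum_right[OF subm_dspan] dspan_inc)
qed

definition fg :: "(nat \<Rightarrow> 'k::comm_ring_1) \<Rightarrow> nat \<Rightarrow> 'k vec set \<Rightarrow> bool" where
  "fg \<pi> r Z \<longleftrightarrow> (\<exists>G. finite G \<and> G \<subseteq> F r \<and> Z = dspan \<pi> G)"

lemma fg_subm: "fg \<pi> r Z \<Longrightarrow> subm \<pi> Z"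
  by (auto simp: fg_def subm_dspan)

lemma fg_subset: "fg \<pi> r Z \<Longrightarrow> Z \<subseteq> F r"
  unfolding fg_def using dspan_least[OF subm_F] by blast

lemma fg_dspan: "finite G \<Longrightarrow> G \<subseteq> F r \<Longrightarrow> fg \<pi> r (dspan \<pi> G)"
  by (auto simp: fg_def)

lemma fg_msum: "fg \<pi> r A \<Longrightarrow> fg \<pi> r B \<Longrightarrow> fg \<pi> r (msum A B)"
proof -
  assume "fg \<pi> r A" "fg \<pi> r B"
  then obtain G H where "finite G" "G \<subseteq> F r" "A = dspan \<pi> G" "finite H" "H \<subseteq> F r" "B = dspan \<pi> H"
    by (auto simp: fg_def)
  then show ?thesis using fg_dspan[of "G \<union> H"] by (simp add: msum_dspan)
qed

definition ebas :: "nat \<Rightarrow> 'k::comm_ring_1 vec" where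
  "ebas j = (\<lambda>i n. if i = j \<and> n = 0 then 1 else 0)"

lemma ebas_F: "j < s \<Longrightarrow> ebas j \<in> F s"
  by (rule FI[where B = 1]) (auto simp: ebas_def)

lemma X_ebas: "X \<pi> n (ebas j) i m = (if i = j \<and> m = n then 1 else 0)"
  by (auto simp: X_apply ebas_def)

lemma F_expand:
  assumes "v \<in> F s" "\<And>i n. n \<ge> B \<Longrightarrow> v i n = 0"
  shows "v = (\<Sum>j<s. \<Sum>n<B. sm (v j n) (X \<pi> n (ebas j)))"
proof (intro ext)
  fix i m
  have "(\<Sum>j<s. \<Sum>n<B. sm (v j n) (X \<pi> n (ebas j))) i m
      = (\<Sum>j<s. \<Sum>n<B. if i = j \<and> m = n then v j n else 0)"
    by (simp add: sum_vec_apply X_ebas vec_apply if_distrib cong: if_cong)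
  also have "\<dots> = (\<Sum>j<s. if i = j then (\<Sum>n<B. if m = n then v j n else 0) else 0)"
    by (intro sum.cong) auto
  also have "\<dots> = (if i < s then (if m < B then v i m else 0) else 0)"
    by simp
  also have "\<dots> = v i m" using assms F_out[of v s i m] by auto
  finally show "v i m = (\<Sum>j<s. \<Sum>n<B. sm (v j n) (X \<pi> n (ebas j))) i m" by simp
qed

lemma subm_sum: "subm \<pi> Z \<Longrightarrow> (\<And>a. a \<in> A \<Longrightarrow> f a \<in> Z) \<Longrightarrow> sum f A \<in> Z"
  by (induction A rule: infinite_finite_induct) (auto simp: subm_0 subm_add)

lemma F_eq_dspan: "F s = dspan \<pi> (ebas ` {..<s})"
proof
  show "F s \<subseteq> dspan \<pi> (ebas ` {..<s})"
  proof
    fix v :: "'a vec" assume v: "v \<in> F s"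
    then obtain B where B: "\<And>i n. n \<ge> B \<Longrightarrow> v i n = 0" using F_bound by metis
    show "v \<in> dspan \<pi> (ebas ` {..<s})"
      by (subst F_expand[OF v B, where \<pi> = \<pi>])
        (auto intro!: subm_sum[OF subm_dspan] subm_sm[OF subm_dspan] dspan_base)
  qed
  show "dspan \<pi> (ebas ` {..<s}) \<subseteq> F s"
    by (rule dspan_least[OF subm_F]) (auto intro: ebas_F)
qed

lemma F_induct [consumes 1, case_names zero base add]:
  assumes "c \<in> F s" "P 0" "\<And>n j. j < s \<Longrightarrow> P (X \<pi> n (ebas j))"
    "\<And>c a b. a \<in> F s \<Longrightarrow> b \<in> F s \<Longrightarrow> P a \<Longrightarrow> P b \<Longrightarrow> P (sm c a + b)"
  shows "P c"
proof -
  have "c \<in> F s \<and> P c"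
    using assms(1) unfolding F_eq_dspan[of s \<pi>]
  proof (induction rule: dspan_induct)
    case zero
    show "0 \<in> dspan \<pi> (ebas ` {..<s}) \<and> P 0" using assms(2) by (simp add: subm_0[OF subm_dspan])
  next
    case (base n g)
    then show ?case using assms(3) by (auto intro: dspan_base)
  next
    case (add c a b)
    then show ?case using assms(4)[of a b c]
      by (auto simp: F_eq_dspan[of s \<pi>] intro: subm_add[OF subm_dspan] subm_sm[OF subm_dspan])
  qed
  then show ?thesis by simp
qed

section \<open>Linear maps\<close>

definition lin :: "(nat \<Rightarrow> 'k::comm_ring_1) \<Rightarrow> nat \<Rightarrow> nat \<Rightarrow> ('k vec \<Rightarrow> 'k vec) \<Rightarrow> bool" where
  "lin \<pi> s r L \<longleftrightarrow> (\<forall>c\<in>F s. L c \<in> F r) \<and> (\<forall>c\<in>F s. \<forall>d\<in>F s. L (c + d) = L c + L d) \<and>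
     (\<forall>a. \<forall>c\<in>F s. L (sm a c) = sm a (L c)) \<and> (\<forall>n. \<forall>c\<in>F s. L (X \<pi> n c) = X \<pi> n (L c))"

lemma
  assumes "lin \<pi> s r L"
  shows lin_F: "\<And>c. c \<in> F s \<Longrightarrow> L c \<in> F r"
    and lin_add: "\<And>c d. c \<in> F s \<Longrightarrow> d \<in> F s \<Longrightarrow> L (c + d) = L c + L d"
    and lin_sm: "\<And>a c. c \<in> F s \<Longrightarrow> L (sm a c) = sm a (L c)"
    and lin_X: "\<And>n c. c \<in> F s \<Longrightarrow> L (X \<pi> n c) = X \<pi> n (L c)"
  using assms by (auto simp: lin_def)

lemma lin_0: "lin \<pi> s r L \<Longrightarrow> L 0 = 0"
  using lin_sm[of \<pi> s r L 0 0] F_0[of s] by (simp add: V.scale_zero_left)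

lemma lin_diff: "lin \<pi> s r L \<Longrightarrow> c \<in> F s \<Longrightarrow> d \<in> F s \<Longrightarrow> L (c - d) = L c - L d"
  using lin_add[of \<pi> s r L "c - d" d] F_diff[of c s d] by (simp add: algebra_simps)

lemma lin_sum:
  assumes "lin \<pi> s r L" "\<And>a. a \<in> A \<Longrightarrow> f a \<in> F s"
  shows "L (sum f A) = (\<Sum>a\<in>A. L (f a))"
  using assms(2)
proof (induction A rule: infinite_finite_induct)
  case (insert x A)
  moreover have "sum f A \<in> F s" by (rule subm_sum[OF subm_F]) (use insert in auto)
  ultimately show ?case by (simp add: lin_add[OF assms(1)])
qed (auto simp: lin_0[OF assms(1)])

lemma lin_comp: "lin \<pi> s r L \<Longrightarrow> lin \<pi> t s K \<Longrightarrow> lin \<pi> t r (\<lambda>c. L (K c))"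
  unfolding lin_def by auto

lemma lin_id: "lin \<pi> s s (\<lambda>c. c)"
  by (auto simp: lin_def)

lemma lin_image_dspan:
  assumes L: "lin \<pi> s r L" and G: "G \<subseteq> F s"
  shows "L ` dspan \<pi> G = dspan \<pi> (L ` G)"
proof
  have GF: "dspan \<pi> G \<subseteq> F s" by (rule dspan_least[OF subm_F G])
  show "L ` dspan \<pi> G \<subseteq> dspan \<pi> (L ` G)"
  proof safe
    fix z assume "z \<in> dspan \<pi> G"
    then have "z \<in> F s \<and> L z \<in> dspan \<pi> (L ` G)"
    proof (induction rule: dspan_induct)
      case zero
      show "0 \<in> F s \<and> L 0 \<in> dspan \<pi> (L ` G)" by (simp add: lin_0[OF L] subm_0[OF subm_dspan] F_0)
    next
      case (base n g)
      with G have "g \<in> F s" by auto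
      with base show ?case by (simp add: lin_X[OF L] dspan_base F_X)
    next
      case (add c a b)
      then show ?case
        by (auto simp: lin_add[OF L] lin_sm[OF L] F_sm F_add
            intro!: subm_add[OF subm_dspan] subm_sm[OF subm_dspan])
    qed
    then show "L z \<in> dspan \<pi> (L ` G)" by simp
  qed
  show "dspan \<pi> (L ` G) \<subseteq> L ` dspan \<pi> G"
  proof (rule dspan_least)
    note s = subm_dspan[of \<pi> G]
    show "subm \<pi> (L ` dspan \<pi> G)"
    proof (rule submI)
      show "0 \<in> L ` dspan \<pi> G" using lin_0[OF L] subm_0[OF s] by force
      show "a + b \<in> L ` dspan \<pi> G" if "a \<in> L ` dspan \<pi> G" "b \<in> L ` dspan \<pi> G" for a b
      proof -
        from that obtain p q where "p \<in> dspan \<pi> G" "q \<in> dspan \<pi> G" "a = L p" "b = L q" by auto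
        then show ?thesis using GF by (intro image_eqI[of _ _ "p + q"]) (simp_all add: lin_add[OF L] subm_add[OF s] subset_iff)
      qed
      show "sm c a \<in> L ` dspan \<pi> G" if "a \<in> L ` dspan \<pi> G" for a c
      proof -
        from that obtain p where "p \<in> dspan \<pi> G" "a = L p" by auto
        then show ?thesis using GF by (intro image_eqI[of _ _ "sm c p"]) (auto simp: lin_sm[OF L] subm_sm[OF s])
      qed
      show "X \<pi> n a \<in> L ` dspan \<pi> G" if "a \<in> L ` dspan \<pi> G" for a n
      proof -
        from that obtain p where "p \<in> dspan \<pi> G" "a = L p" by auto
        then show ?thesis using GF by (intro image_eqI[of _ _ "X \<pi> n p"]) (auto simp: lin_X[OF L] subm_X[OF s])
      qed
    qed
    show "L ` G \<subseteq> L ` dspan \<pi> G" by (auto intro: dspan_inc)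
  qed
qed

lemma fg_image: "lin \<pi> s r L \<Longrightarrow> fg \<pi> s Z \<Longrightarrow> fg \<pi> r (L ` Z)"
proof -
  assume L: "lin \<pi> s r L" and "fg \<pi> s Z"
  then obtain G where G: "finite G" "G \<subseteq> F s" "Z = dspan \<pi> G" by (auto simp: fg_def)
  then have "L ` Z = dspan \<pi> (L ` G)" using lin_image_dspan[OF L] by simp
  moreover have "L ` G \<subseteq> F r" using lin_F[OF L] G by auto
  ultimately show ?thesis using G by (simp add: fg_dspan)
qed

text \<open>Multiplication of v by the element of D with coefficients f. Degree m receives only
  terms with n \<le> m, so the formula makes sense without finite support.\<close>

definition act :: "(nat \<Rightarrow> 'k::comm_ring_1) \<Rightarrow> (nat \<Rightarrow> 'k) \<Rightarrow> 'k vec \<Rightarrow> 'k vec" where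
  "act \<pi> f v = (\<lambda>i m. \<Sum>n\<le>m. f n * X \<pi> n v i m)"

lemma act_apply: "act \<pi> f v i m = (\<Sum>n\<le>m. f n * X \<pi> n v i m)"
  by (simp add: act_def)

lemma act_finite:
  assumes "\<And>n. n \<ge> B \<Longrightarrow> f n = 0"
  shows "act \<pi> f v = (\<Sum>n<B. sm (f n) (X \<pi> n v))"
proof (intro ext)
  fix i m
  have "(\<Sum>n\<le>m. f n * X \<pi> n v i m) = (\<Sum>n<B. f n * X \<pi> n v i m)"
    by (rule sum.mono_neutral_cong) (use assms in \<open>auto simp: X_apply not_less not_le\<close>)
  then show "act \<pi> f v i m = (\<Sum>n<B. sm (f n) (X \<pi> n v)) i m"
    by (simp add: act_apply sum_vec_apply vec_apply)
qed

text \<open>Row j of x^[a] c is x^[a] times the element \<open>c j\<close> of D, so this is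
  associativity after reindexing the sum by a + n.\<close>

lemma act_X: "act \<pi> (X \<pi> a c j) v = X \<pi> a (act \<pi> (c j) v)"
proof (intro ext)
  fix i m
  show "act \<pi> (X \<pi> a c j) v i m = X \<pi> a (act \<pi> (c j) v) i m"
  proof (cases "a \<le> m")
    case False
    then show ?thesis by (auto simp: act_apply X_apply intro!: sum.neutral)
  next
    case True
    then obtain m' where m: "m = a + m'" by (auto simp: le_iff_add)
    have "act \<pi> (X \<pi> a c j) v i m = (\<Sum>n\<in>{a..m}. X \<pi> a c j n * X \<pi> n v i m)"
      unfolding act_apply by (rule sum.mono_neutral_right) (auto simp: X_apply[of \<pi> a])
    also have "\<dots> = (\<Sum>n\<le>m'. X \<pi> a c j (a + n) * X \<pi> (a + n) v i m)"
      by (rule sum.reindex_bij_witness[of _ "\<lambda>n. a + n" "\<lambda>n. n - a"]) (auto simp: m)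
    also have "\<dots> = (\<Sum>n\<le>m'. c j n * X \<pi> a (X \<pi> n v) i m)"
      by (simp add: X_X vec_apply mult_ac)
    also have "\<dots> = cc \<pi> a m' * (\<Sum>n\<le>m'. c j n * X \<pi> n v i m')"
      unfolding m by (simp add: sum_distrib_left mult_ac)
    also have "\<dots> = X \<pi> a (act \<pi> (c j) v) i m"
      by (simp add: m act_apply)
    finally show ?thesis .
  qed
qed

lemma act_ebas: "act \<pi> (ebas j k) v = (if j = k then v else 0)"
  by (subst act_finite[where B = 1]) (auto simp: ebas_def fun_eq_iff)

text \<open>The universal property of the free module on the \<open>ebas j\<close>. The last clause
  exposes the formula so that it can be compared with the matrix product in
  \<open>in_image\<close>.\<close>

lemma ex_lin:
  assumes h: "\<And>j. j < t \<Longrightarrow> h j \<in> F r"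
  obtains L where "lin \<pi> t r L" "\<And>j. j < t \<Longrightarrow> L (ebas j) = h j" "L ` F t = dspan \<pi> (h ` {..<t})"
    "L = (\<lambda>c. \<Sum>j<t. act \<pi> (c j) (h j))"
proof -
  define L where "L c = (\<Sum>j<t. act \<pi> (c j) (h j))" for c
  have act_F: "act \<pi> (c j) (h j) \<in> F r" if c: "c \<in> F t" and j: "j < t" for c j
  proof -
    obtain B where "\<And>i n. n \<ge> B \<Longrightarrow> c i n = 0" using F_bound[OF c] by blast
    then show ?thesis using h[OF j]
      by (subst act_finite[where B = B]) (auto intro!: subm_sum[OF subm_F] F_sm F_X)
  qed
  have L: "lin \<pi> t r L"
    unfolding lin_def
  proof (intro conjI ballI allI)
    show "L c \<in> F r" if "c \<in> F t" for c
      unfolding L_def using that by (auto intro!: subm_sum[OF subm_F] act_F)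
    show "L (c + d) = L c + L d" if "c \<in> F t" "d \<in> F t" for c d
      unfolding L_def by (auto simp: fun_eq_iff vec_apply sum_vec_apply act_apply algebra_simps sum.distrib)
    show "L (sm a c) = sm a (L c)" if "c \<in> F t" for a c
      unfolding L_def by (auto simp: fun_eq_iff vec_apply sum_vec_apply act_apply algebra_simps sum_distrib_left)
    show "L (X \<pi> n c) = X \<pi> n (L c)" if "c \<in> F t" for n c
      unfolding L_def act_X by (induction t) (auto simp: X_add)
  qed
  have eb: "L (ebas j) = h j" if "j < t" for j
    unfolding L_def act_ebas using that by (simp add: eq_commute[of _ j])
  have "L ` F t = dspan \<pi> (L ` ebas ` {..<t})"
    by (subst F_eq_dspan[of _ \<pi>], rule lin_image_dspan[OF L]) (auto intro: ebas_F)
  also have "L ` ebas ` {..<t} = h ` {..<t}" using eb by force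
  finally show ?thesis using that L eb L_def by blast
qed

lemma fg_lin_image:
  assumes "fg \<pi> r Z"
  obtains t L where "lin \<pi> t r L" "L ` F t = Z"
proof -
  obtain G where G: "finite G" "G \<subseteq> F r" "Z = dspan \<pi> G" using assms by (auto simp: fg_def)
  obtain h and t :: nat where "G = h ` {i. i < t}" using finite_imp_nat_seg_image_inj_on[OF G(1)] by blast
  then have h: "G = h ` {..<t}" by (simp add: lessThan_def)
  then have "\<And>j. j < t \<Longrightarrow> h j \<in> F r" using G by auto
  from ex_lin[of t h r \<pi>, OF this] show ?thesis using that G h by metis
qed

section \<open>Ideals of the base ring\<close>

lemma
  assumes "cr_ideal I"
  shows ideal_0: "0 \<in> I"
    and ideal_add: "\<And>x y. x \<in> I \<Longrightarrow> y \<in> I \<Longrightarrow> x + y \<in> I"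
    and ideal_mult: "\<And>r x. x \<in> I \<Longrightarrow> r * x \<in> I"
  using assms by (auto simp: cr_ideal_def)

lemma ideal_mult_right: "cr_ideal I \<Longrightarrow> x \<in> I \<Longrightarrow> x * r \<in> I"
  using ideal_mult[of I x r] by (simp add: mult.commute)

lemma ideal_diff: "cr_ideal I \<Longrightarrow> x \<in> I \<Longrightarrow> y \<in> I \<Longrightarrow> x - y \<in> I"
  using ideal_add[of I x "-1 * y"] ideal_mult[of I y "-1"] by simp

lemma ideal_sum: "cr_ideal I \<Longrightarrow> (\<And>a. a \<in> A \<Longrightarrow> f a \<in> I) \<Longrightarrow> sum f A \<in> I"
  by (induction A rule: infinite_finite_induct) (auto simp: ideal_0 ideal_add)

lemma ideal_Union_chain:
  assumes "subset.chain {I. cr_ideal I} C" "C \<noteq> {}"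
  shows "cr_ideal (\<Union>C)"
proof -
  have id: "cr_ideal I" if "I \<in> C" for I using that assms by (auto simp: subset.chain_def)
  have "x + y \<in> \<Union>C" if "x \<in> \<Union>C" "y \<in> \<Union>C" for x y
  proof -
    from that obtain I J where IJ: "I \<in> C" "J \<in> C" "x \<in> I" "y \<in> J" by auto
    then have "I \<subseteq> J \<or> J \<subseteq> I" using assms(1) by (auto simp: subset_chain_def)
    then show ?thesis using IJ ideal_add[OF id] by blast
  qed
  then show ?thesis unfolding cr_ideal_def using id assms(2) ideal_0 ideal_mult by blast
qed

text \<open>Otherwise Zorn's lemma gives an ideal maximal among the counterexamples: the union of a
  chain of counterexamples is generated by a finite set, this set already lies in one member, and
  that member is then the union.\<close>

lemma noetherian_induct [consumes 2, case_names step]: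
  assumes "noetherian TYPE('k::comm_ring_1)" "cr_ideal (I :: 'k set)"
    and step: "\<And>I :: 'k set. cr_ideal I \<Longrightarrow> (\<And>J. cr_ideal J \<Longrightarrow> I \<subset> J \<Longrightarrow> P J) \<Longrightarrow> P I"
  shows "P I"
proof (rule ccontr)
  assume nP: "\<not> P I"
  let ?A = "{I. cr_ideal I \<and> \<not> P I}"
  have "\<exists>M\<in>?A. \<forall>J\<in>?A. M \<subseteq> J \<longrightarrow> J = M"
  proof (rule subset_Zorn)
    fix C assume C: "subset.chain ?A C"
    show "\<exists>U\<in>?A. \<forall>J\<in>C. J \<subseteq> U"
    proof (cases "C = {}")
      case True
      then show ?thesis using nP assms(2) by auto
    next
      case False
      have C': "subset.chain {I. cr_ideal I} C" using C by (auto simp: subset.chain_def)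
      have "cr_ideal (\<Union>C)" by (rule ideal_Union_chain[OF C' False])
      then obtain S where S: "finite S" "S \<subseteq> \<Union>C" "\<And>J. cr_ideal J \<Longrightarrow> S \<subseteq> J \<Longrightarrow> \<Union>C \<subseteq> J"
        using assms(1) unfolding noetherian_def by metis
      have "\<exists>J\<in>C. S \<subseteq> J"
        using finite_subset_Union_chain[OF S(1,2) False C] by metis
      then obtain J where "J \<in> C" "S \<subseteq> J" by blast
      moreover from this have "J \<in> ?A" using C by (auto simp: subset.chain_def)
      ultimately show ?thesis using S(3)[of J] by auto
    qed
  qed
  then obtain J where "cr_ideal J" "\<not> P J" "\<And>K. cr_ideal K \<Longrightarrow> J \<subset> K \<Longrightarrow> P K" by blast
  then show False using step by blast
qed

definition add_principal :: "'k::comm_ring_1 set \<Rightarrow> 'k \<Rightarrow> 'k set" where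
  "add_principal I a = {x + a * y |x y. x \<in> I}"

definition colon :: "'k::comm_ring_1 set \<Rightarrow> 'k \<Rightarrow> 'k set" where
  "colon I a = {x. a * x \<in> I}"

lemma ideal_add_principal:
  assumes "cr_ideal I" shows "cr_ideal (add_principal I a)"
  unfolding cr_ideal_def add_principal_def
proof (safe)
  show "\<exists>x y. 0 = x + a * y \<and> x \<in> I" by (rule exI[of _ 0], rule exI[of _ 0]) (simp add: ideal_0[OF assms])
  fix x y x' y' r assume *: "x \<in> I" "x' \<in> I"
  show "\<exists>xa ya. x + a * y + (x' + a * y') = xa + a * ya \<and> xa \<in> I"
    by (rule exI[of _ "x + x'"], rule exI[of _ "y + y'"]) (simp add: * ideal_add[OF assms] algebra_simps)
  show "\<exists>xa ya. r * (x + a * y) = xa + a * ya \<and> xa \<in> I"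
    by (rule exI[of _ "r * x"], rule exI[of _ "r * y"]) (simp add: * ideal_mult[OF assms] algebra_simps)
qed

lemma add_principal_subset: "I \<subseteq> add_principal I a"
proof
  fix x assume "x \<in> I"
  then show "x \<in> add_principal I a"
    unfolding add_principal_def by (intro CollectI exI[of _ x] exI[of _ 0]) simp
qed

lemma add_principal_mem: "cr_ideal I \<Longrightarrow> a * y \<in> add_principal I a"
  unfolding add_principal_def using ideal_0[of I] by force

lemma ideal_colon: "cr_ideal I \<Longrightarrow> cr_ideal (colon I a)"
  unfolding cr_ideal_def colon_def by (auto simp: algebra_simps)

definition inI :: "'k::comm_ring_1 set \<Rightarrow> 'k vec \<Rightarrow> bool" where
  "inI I v \<longleftrightarrow> (\<forall>i n. v i n \<in> I)"

text \<open>The submodule I D^r. Modules over D/I are handled as quotients of \<open>F r\<close> by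
  submodules containing it.\<close>

definition IF :: "'k::comm_ring_1 set \<Rightarrow> nat \<Rightarrow> 'k vec set" where
  "IF I r = {v \<in> F r. inI I v}"

lemma
  assumes I: "cr_ideal I"
  shows inI_0: "inI I 0"
    and inI_add: "\<And>v w. inI I v \<Longrightarrow> inI I w \<Longrightarrow> inI I (v + w)"
    and inI_diff: "\<And>v w. inI I v \<Longrightarrow> inI I w \<Longrightarrow> inI I (v - w)"
    and inI_sm: "\<And>c v. inI I v \<Longrightarrow> inI I (sm c v)"
    and inI_sm_ideal: "\<And>c v. c \<in> I \<Longrightarrow> inI I (sm c v)"
    and inI_X: "\<And>n v. inI I v \<Longrightarrow> inI I (X \<pi> n v)"
  by (auto simp: inI_def vec_apply X_apply ideal_0[OF I] ideal_add[OF I] ideal_diff[OF I]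
      ideal_mult[OF I] ideal_mult_right[OF I])

lemma inI_sum: "cr_ideal I \<Longrightarrow> (\<And>a. a \<in> A \<Longrightarrow> inI I (f a)) \<Longrightarrow> inI I (sum f A)"
  by (auto simp: inI_def sum_vec_apply intro: ideal_sum)

lemma subm_IF: "cr_ideal I \<Longrightarrow> subm \<pi> (IF I r)"
  by (rule submI) (auto simp: IF_def F_0 F_add F_sm F_X inI_0 inI_add inI_sm inI_X)

lemma fg_IF:
  assumes "noetherian TYPE('k::comm_ring_1)" and I: "cr_ideal (I :: 'k set)"
  shows "fg \<pi> r (IF I r)"
proof -
  obtain S where S: "finite S" "S \<subseteq> I" "\<And>J. cr_ideal J \<Longrightarrow> S \<subseteq> J \<Longrightarrow> I \<subseteq> J"
    using assms unfolding noetherian_def by metis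
  define G where "G = (\<lambda>(x, j). sm x (ebas j)) ` (S \<times> {..<r})"
  have G: "finite G" "G \<subseteq> F r" using S(1) by (auto simp: G_def intro: F_sm ebas_F)
  have "dspan \<pi> G \<subseteq> IF I r"
    using S(2) G by (intro dspan_least subm_IF I) (auto simp: IF_def G_def intro: inI_sm_ideal[OF I])
  moreover have "IF I r \<subseteq> dspan \<pi> G"
  proof
    fix v assume v: "v \<in> IF I r"
    then have vF: "v \<in> F r" by (simp add: IF_def)
    obtain B where B: "\<And>i n. n \<ge> B \<Longrightarrow> v i n = 0" using F_bound[OF vF] by blast
    have *: "sm x (X \<pi> n (ebas j)) \<in> dspan \<pi> G" if "x \<in> I" "j < r" for x n j
    proof -
      \<comment> \<open>That S generates I is known only through the ideals containing S, so the
        scalars x with the desired property are collected into an ideal.\<close>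
      let ?J = "{x. sm x (X \<pi> n (ebas j)) \<in> dspan \<pi> G}"
      note s = subm_dspan[of \<pi> G]
      have "cr_ideal ?J"
        unfolding cr_ideal_def
        using subm_0[OF s] subm_add[OF s] subm_sm[OF s]
        by (auto simp: V.scale_left_distrib V.scale_scale[symmetric] simp del: V.scale_scale)
      moreover have "S \<subseteq> ?J"
        using that(2) by (auto simp: G_def X_sm[symmetric] intro!: dspan_base)
      ultimately show ?thesis using S(3) that(1) by auto
    qed
    show "v \<in> dspan \<pi> G"
      by (subst F_expand[OF vF B, where \<pi> = \<pi>])
        (use v in \<open>auto intro!: subm_sum[OF subm_dspan] * simp: IF_def inI_def\<close>)
  qed
  ultimately show ?thesis using fg_dspan[OF G, of \<pi>] by auto
qed

lemma lin_inI:
  assumes I: "cr_ideal I" and L: "lin \<pi> s r L" and c: "c \<in> F s" "inI I c"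
  shows "inI I (L c)"
proof -
  obtain B where B: "\<And>i n. n \<ge> B \<Longrightarrow> c i n = 0" using F_bound[OF c(1)] by blast
  have X: "X \<pi> n (ebas j) \<in> F s" if "j < s" for n j by (intro F_X ebas_F that)
  have "L (\<Sum>j<s. \<Sum>n<B. sm (c j n) (X \<pi> n (ebas j))) = (\<Sum>j<s. \<Sum>n<B. L (sm (c j n) (X \<pi> n (ebas j))))"
    by (subst lin_sum[OF L], fastforce intro!: subm_sum[OF subm_F] F_sm X)
      (intro sum.cong refl lin_sum[OF L], auto intro!: F_sm X)
  also have "\<dots> = (\<Sum>j<s. \<Sum>n<B. sm (c j n) (L (X \<pi> n (ebas j))))"
    by (intro sum.cong refl lin_sm[OF L] X) auto
  finally have "L c = (\<Sum>j<s. \<Sum>n<B. sm (c j n) (L (X \<pi> n (ebas j))))"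
    using F_expand[OF c(1) B, where \<pi> = \<pi>] by simp
  then show ?thesis using c(2) by (auto intro!: inI_sum I inI_sm_ideal simp: inI_def[of I c])
qed

lemma lin_scale: "lin \<pi> s r L \<Longrightarrow> lin \<pi> s r (\<lambda>c. sm a (L c))"
  unfolding lin_def by (auto simp: F_sm V.scale_right_distrib X_sm mult.commute)

lemma lin_minus: "lin \<pi> s r L \<Longrightarrow> lin \<pi> s r K \<Longrightarrow> lin \<pi> s r (\<lambda>c. L c - K c)"
  unfolding lin_def by (auto simp: F_diff V.scale_right_diff_distrib X_diff algebra_simps)

lemma lin_inI_ebas:
  assumes I: "cr_ideal I" and L: "lin \<pi> s r L" and e: "\<And>j. j < s \<Longrightarrow> inI I (L (ebas j))" and c: "c \<in> F s"
  shows "inI I (L c)"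
  using c
proof (induction rule: F_induct[where \<pi> = \<pi>])
  case zero
  then show ?case by (simp add: lin_0[OF L] inI_0[OF I])
next
  case (base n j)
  then show ?case by (simp add: lin_X[OF L] ebas_F inI_X[OF I] e)
next
  case (add c a b)
  then show ?case by (simp add: lin_add[OF L] lin_sm[OF L] F_sm inI_add[OF I] inI_sm[OF I])
qed

lemma lin_inI_diff_ebas:
  assumes I: "cr_ideal I" and L: "lin \<pi> s r L" and K: "lin \<pi> s r K"
    and e: "\<And>j. j < s \<Longrightarrow> inI I (L (ebas j) - K (ebas j))" and c: "c \<in> F s"
  shows "inI I (L c - K c)"
  using lin_inI_ebas[OF I lin_minus[OF L K] _ c] e by blast

lemma inI_add_principal:
  assumes "v \<in> F r" "inI (add_principal I a) v" and I: "cr_ideal I"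
  obtains h where "h \<in> F r" "inI I (v - sm a h)"
proof -
  have "\<exists>y. v i n - a * y \<in> I" for i n
  proof -
    obtain x y where "v i n = x + a * y" "x \<in> I"
      using assms(2) unfolding inI_def add_principal_def by blast
    then show ?thesis by (intro exI[of _ y]) simp
  qed
  then obtain y where y: "\<And>i n. v i n - a * y i n \<in> I" by metis
  \<comment> \<open>The quotient is set to 0 wherever v vanishes, so that h has finite
    support.\<close>
  define h where "h i n = (if v i n = 0 then 0 else y i n)" for i n
  obtain B where "\<And>i n. n \<ge> B \<Longrightarrow> v i n = 0" using F_bound[OF assms(1)] by blast
  then have "h \<in> F r" using F_out[OF assms(1)] by (intro FI[where B = B]) (auto simp: h_def)
  moreover have "inI I (v - sm a h)" using y ideal_0[OF I] by (auto simp: inI_def h_def vec_apply)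
  ultimately show ?thesis using that by blast
qed

text \<open>The preimage in D^s of the kernel of the map that L induces between free
  D/I-modules.\<close>

definition kerI :: "'k::comm_ring_1 set \<Rightarrow> nat \<Rightarrow> ('k vec \<Rightarrow> 'k vec) \<Rightarrow> 'k vec set" where
  "kerI I s L = {c \<in> F s. inI I (L c)}"

lemma subm_kerI: "cr_ideal I \<Longrightarrow> lin \<pi> s r L \<Longrightarrow> subm \<pi> (kerI I s L)"
  by (rule submI)
    (auto simp: kerI_def F_0 F_add F_sm F_X lin_0 lin_add lin_sm lin_X inI_0 inI_add inI_sm inI_X)

lemma IF_subset_kerI: "cr_ideal I \<Longrightarrow> lin \<pi> s r L \<Longrightarrow> IF I s \<subseteq> kerI I s L"
  by (auto simp: kerI_def IF_def lin_inI)

section \<open>Coherence and torsion-freeness modulo an ideal\<close>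

text \<open>Coherence of D/I, stated over D: kernels are replaced by their preimages in D^s. Nothing
  is lost, since I D^s is itself finitely generated when k is noetherian
  (\<open>fg_IF\<close>).\<close>

definition Coh :: "(nat \<Rightarrow> 'k::comm_ring_1) \<Rightarrow> 'k set \<Rightarrow> bool" where
  "Coh \<pi> I \<longleftrightarrow> (\<forall>s r L. lin \<pi> s r L \<longrightarrow> fg \<pi> s (kerI I s L))"

text \<open>The scalars \<sigma> outside the prime ideal M stand for localization at M.\<close>

definition torsion_mod :: "'k set \<Rightarrow> (nat \<Rightarrow> 'k::comm_ring_1) \<Rightarrow> 'k vec set \<Rightarrow> 'k vec \<Rightarrow> bool" where
  "torsion_mod M \<pi> Z v \<longleftrightarrow> (\<exists>n0. \<forall>n\<ge>n0. \<exists>\<sigma>. \<sigma> \<notin> M \<and> sm \<sigma> (X \<pi> n v) \<in> Z)"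

text \<open>The quotients of \<open>F r\<close> by such Z are the finitely presented D-modules
  killed by I. The condition says that a torsion element of the localization at M vanishes
  there.\<close>

definition Tor :: "'k::comm_ring_1 set \<Rightarrow> (nat \<Rightarrow> 'k) \<Rightarrow> 'k set \<Rightarrow> bool" where
  "Tor M \<pi> I \<longleftrightarrow> (\<forall>r Z v. fg \<pi> r Z \<longrightarrow> IF I r \<subseteq> Z \<longrightarrow> v \<in> F r \<longrightarrow> torsion_mod M \<pi> Z v \<longrightarrow>
     (\<exists>\<sigma>. \<sigma> \<notin> M \<and> sm \<sigma> v \<in> Z))"

text \<open>On the kernel modulo I + (a) the values of L are divisible by a modulo I, and dividing
  them on generators defines a new linear map L'. This factorization opens \<open>Coh_step\<close>,
  \<open>Tor_step\<close> and the final part of \<open>Coh_regular\<close>.\<close>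

lemma kerI_add_principal:
  assumes I: "cr_ideal I" and C: "Coh \<pi> (add_principal I a)" and L: "lin \<pi> s r L"
  obtains t \<theta> L' where "lin \<pi> t s \<theta>" "\<theta> ` F t = kerI (add_principal I a) s L" "lin \<pi> t r L'"
    "\<And>d. d \<in> F t \<Longrightarrow> inI I (L (\<theta> d) - sm a (L' d))"
proof -
  have "fg \<pi> s (kerI (add_principal I a) s L)" using C L by (simp add: Coh_def)
  then obtain t \<theta> where \<theta>: "lin \<pi> t s \<theta>" "\<theta> ` F t = kerI (add_principal I a) s L"
    using fg_lin_image by metis
  have "\<exists>h. h \<in> F r \<and> inI I (L (\<theta> (ebas j)) - sm a h)" if "j < t" for j
  proof -
    have "\<theta> (ebas j) \<in> kerI (add_principal I a) s L" using \<theta>(2) ebas_F[OF that] by blast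
    then have "L (\<theta> (ebas j)) \<in> F r" "inI (add_principal I a) (L (\<theta> (ebas j)))"
      using lin_F[OF L] by (auto simp: kerI_def)
    then show ?thesis using inI_add_principal[OF _ _ I] by metis
  qed
  then obtain h where h: "\<And>j. j < t \<Longrightarrow> h j \<in> F r" "\<And>j. j < t \<Longrightarrow> inI I (L (\<theta> (ebas j)) - sm a (h j))"
    by metis
  obtain L' where L': "lin \<pi> t r L'" "\<And>j. j < t \<Longrightarrow> L' (ebas j) = h j"
    using ex_lin[of t h r \<pi>] h(1) by metis
  have "inI I (L (\<theta> d) - sm a (L' d))" if "d \<in> F t" for d
    by (rule lin_inI_diff_ebas[OF I lin_comp[OF L \<theta>(1)] lin_scale[OF L'(1)] _ that])
      (simp add: L'(2) h(2))
  then show ?thesis using that \<theta> L' by blast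
qed

lemma inI_sm_colon: "inI I (sm a v) \<longleftrightarrow> inI (colon I a) v"
  by (simp add: inI_def colon_def vec_apply)

text \<open>From L \<theta> = a L' modulo I it follows that L (\<theta> d) vanishes modulo I exactly
  when L' d vanishes modulo (I : a). So the kernel of L modulo I is the image under \<theta> of a
  kernel modulo (I : a).\<close>

lemma Coh_step:
  assumes I: "cr_ideal I" and C1: "Coh \<pi> (add_principal I a)" and C2: "Coh \<pi> (colon I a)"
  shows "Coh \<pi> I"
  unfolding Coh_def
proof (intro allI impI)
  fix s r L assume L: "lin \<pi> s r L"
  obtain t \<theta> L' where \<theta>: "lin \<pi> t s \<theta>" "\<theta> ` F t = kerI (add_principal I a) s L" and L': "lin \<pi> t r L'"
    and d: "\<And>d. d \<in> F t \<Longrightarrow> inI I (L (\<theta> d) - sm a (L' d))"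
    using kerI_add_principal[OF I C1 L] by metis
  have key: "inI I (L (\<theta> d)) \<longleftrightarrow> inI (colon I a) (L' d)" if "d \<in> F t" for d
    using inI_add[OF I d[OF that], of "sm a (L' d)"] inI_diff[OF I _ d[OF that], of "L (\<theta> d)"]
    by (auto simp: inI_sm_colon)
  have "kerI I s L = \<theta> ` kerI (colon I a) t L'"
  proof (intro equalityI subsetI)
    fix c assume c: "c \<in> kerI I s L"
    then have "c \<in> kerI (add_principal I a) s L"
      using add_principal_subset[of I a] by (auto simp: kerI_def inI_def)
    then obtain d where "d \<in> F t" "c = \<theta> d" using \<theta>(2) by blast
    then show "c \<in> \<theta> ` kerI (colon I a) t L'" using c key by (auto simp: kerI_def)
  next
    fix c assume "c \<in> \<theta> ` kerI (colon I a) t L'"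
    then show "c \<in> kerI I s L" using key lin_F[OF \<theta>(1)] by (auto simp: kerI_def)
  qed
  then show "fg \<pi> s (kerI I s L)" using fg_image[OF \<theta>(1)] C2 L' by (simp add: Coh_def)
qed

locale prime_setup =
  fixes M :: "'k::comm_ring_1 set"
  assumes noeth: "noetherian TYPE('k)"
    and M_ideal: "cr_ideal M"
    and M_one: "1 \<notin> M"
    and M_prime: "a * b \<in> M \<Longrightarrow> a \<in> M \<or> b \<in> M"
begin

text \<open>Multiplication by a gives the exact sequence D^r/Y -> D^r/Z -> D^r/(Z + a D^r) with Y =
  (Z : a). The last module falls under I + (a) and the first under (I : a), provided that Y is
  finitely generated; this is where coherence enters.\<close>

lemma Tor_step:
  assumes I: "cr_ideal I" and C1: "Coh \<pi> (add_principal I a)"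
    and T1: "Tor M \<pi> (add_principal I a)" and T2: "Tor M \<pi> (colon I a)"
  shows "Tor M \<pi> I"
  unfolding Tor_def
proof (intro allI impI)
  fix r Z v assume Z: "fg \<pi> r Z" "IF I r \<subseteq> Z" and v: "v \<in> F r" "torsion_mod M \<pi> Z v"
  note s = fg_subm[OF Z(1)]
  note J1 = ideal_add_principal[OF I, of a] and J2 = ideal_colon[OF I, of a]
  obtain q L where L: "lin \<pi> q r L" "L ` F q = Z" using fg_lin_image[OF Z(1)] by metis
  obtain t \<theta> L' where \<theta>: "lin \<pi> t q \<theta>" "\<theta> ` F t = kerI (add_principal I a) q L" and L': "lin \<pi> t r L'"
    and d: "\<And>d. d \<in> F t \<Longrightarrow> inI I (L (\<theta> d) - sm a (L' d))"
    using kerI_add_principal[OF I C1 L(1)] by metis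
  \<comment> \<open>Generators for (Z : a); \<open>Y1\<close> and \<open>Y2\<close> prove the two
    inclusions.\<close>
  define Y where "Y = msum (L' ` F t) (IF (colon I a) r)"
  have L'F: "fg \<pi> r (L' ` F t)"
    by (rule fg_image[OF L'], subst F_eq_dspan[of _ \<pi>], rule fg_dspan) (auto intro: ebas_F)
  have Y: "fg \<pi> r Y" unfolding Y_def by (rule fg_msum[OF L'F fg_IF[OF noeth J2]])
  have Y1: "sm a w \<in> Z" if "w \<in> Y" for w
  proof -
    from that obtain d u where w: "w = L' d + u" "d \<in> F t" "u \<in> IF (colon I a) r"
      by (auto simp: Y_def msum_def)
    have "L (\<theta> d) - sm a (L' d) \<in> IF I r"
      using d w lin_F[OF L(1) lin_F[OF \<theta>(1)]] lin_F[OF L'] by (auto simp: IF_def intro!: F_diff F_sm)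
    then have "L (\<theta> d) - sm a (L' d) \<in> Z" using Z(2) by blast
    moreover have "L (\<theta> d) \<in> Z" using L(2) lin_F[OF \<theta>(1) w(2)] by blast
    ultimately have "L (\<theta> d) - (L (\<theta> d) - sm a (L' d)) \<in> Z" by (rule subm_diff[OF s, rotated])
    moreover have "sm a u \<in> Z"
      using w(3) Z(2) by (auto simp: IF_def inI_sm_colon F_sm subset_iff)
    ultimately show ?thesis using w(1) subm_add[OF s] by (simp add: V.scale_right_distrib)
  qed
  have Y2: "w \<in> Y" if w: "w \<in> F r" "sm a w \<in> Z" for w
  proof -
    obtain c where c: "c \<in> F q" "sm a w = L c" using w(2) L(2) by auto
    have "inI (add_principal I a) (sm a w)"
      by (simp add: inI_def vec_apply add_principal_mem[OF I])
    then have "c \<in> kerI (add_principal I a) q L" using c by (simp add: kerI_def)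
    then obtain e where e: "e \<in> F t" "c = \<theta> e" using \<theta>(2) by blast
    have "inI I (sm a (w - L' e))"
      using d[OF e(1)] c e by (simp add: V.scale_right_diff_distrib)
    then have "w - L' e \<in> IF (colon I a) r"
      using w(1) lin_F[OF L' e(1)] by (simp add: IF_def inI_sm_colon F_diff)
    then have "L' e + (w - L' e) \<in> Y" unfolding Y_def msum_def using e(1) by blast
    then show ?thesis by simp
  qed
  have Z1: "fg \<pi> r (msum Z (IF (add_principal I a) r))"
    by (rule fg_msum[OF Z(1) fg_IF[OF noeth J1]])
  have "torsion_mod M \<pi> (msum Z (IF (add_principal I a) r)) v"
    using v(2) msum_left[OF subm_IF[OF J1]] unfolding torsion_mod_def by metis
  then obtain \<sigma> where \<sigma>: "\<sigma> \<notin> M" "sm \<sigma> v \<in> msum Z (IF (add_principal I a) r)"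
    using T1 Z1 v(1) msum_right[OF s] unfolding Tor_def by blast
  then obtain z u where zu: "sm \<sigma> v = z + u" "z \<in> Z" "u \<in> IF (add_principal I a) r"
    by (auto simp: msum_def)
  obtain w where w: "w \<in> F r" "inI I (u - sm a w)"
    using inI_add_principal[of u r I a] zu(3) I by (auto simp: IF_def)
  \<comment> \<open>The part of u in I D^r is moved into Z, which leaves the exact equation \<sigma>
    v = z' + a w.\<close>
  define z' where "z' = z + (u - sm a w)"
  have "u - sm a w \<in> IF I r" using w zu(3) by (auto simp: IF_def intro!: F_diff F_sm)
  then have z': "z' \<in> Z" using zu(2) Z(2) by (auto simp: z'_def intro!: subm_add[OF s])
  have eq: "sm a w = sm \<sigma> v - z'" using zu(1) by (simp add: z'_def)
  have "torsion_mod M \<pi> Y w"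
  proof -
    obtain n0 where n0: "\<And>n. n \<ge> n0 \<Longrightarrow> \<exists>\<tau>. \<tau> \<notin> M \<and> sm \<tau> (X \<pi> n v) \<in> Z"
      using v(2) by (auto simp: torsion_mod_def)
    have "\<exists>\<tau>. \<tau> \<notin> M \<and> sm \<tau> (X \<pi> n w) \<in> Y" if n: "n \<ge> n0" for n
    proof -
      obtain \<tau> where \<tau>: "\<tau> \<notin> M" "sm \<tau> (X \<pi> n v) \<in> Z" using n0[OF n] by blast
      have "sm a (sm \<tau> (X \<pi> n w)) = sm \<tau> (X \<pi> n (sm a w))"
        by (simp add: X_sm mult.commute)
      also have "\<dots> = sm \<sigma> (sm \<tau> (X \<pi> n v)) - sm \<tau> (X \<pi> n z')"
        by (simp add: eq X_diff X_sm V.scale_right_diff_distrib mult.commute)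
      also have "\<dots> \<in> Z" by (intro subm_diff[OF s] subm_sm[OF s] subm_X[OF s] \<tau> z')
      finally have "sm \<tau> (X \<pi> n w) \<in> Y" by (intro Y2 F_sm F_X w)
      then show ?thesis using \<tau> by blast
    qed
    then show ?thesis by (auto simp: torsion_mod_def)
  qed
  moreover have "IF (colon I a) r \<subseteq> Y"
    unfolding Y_def using msum_right[OF fg_subm[OF L'F]] by blast
  ultimately obtain \<rho> where \<rho>: "\<rho> \<notin> M" "sm \<rho> w \<in> Y"
    using T2 Y w(1) unfolding Tor_def by blast
  have "sm \<rho> (sm a w) \<in> Z" using Y1[OF \<rho>(2)] by (simp add: mult.commute)
  then have "sm \<rho> (sm a w) + sm \<rho> z' \<in> Z" by (rule subm_add[OF s _ subm_sm[OF s z']])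
  then have "sm (\<rho> * \<sigma>) v \<in> Z" by (simp add: eq V.scale_right_diff_distrib)
  then show "\<exists>\<sigma>. \<sigma> \<notin> M \<and> sm \<sigma> v \<in> Z" using M_prime \<sigma>(1) \<rho>(1) by blast
qed

end

section \<open>A Krull intersection lemma\<close>

text \<open>For finite B this is the free k-module k^B; row and degree merely name its
  coordinates.\<close>

definition supp_in :: "(nat \<times> nat) set \<Rightarrow> 'k::comm_ring_1 vec set" where
  "supp_in B = {v. \<forall>i n. (i, n) \<notin> B \<longrightarrow> v i n = 0}"

lemma subspace_supp_in: "V.subspace (supp_in B)"
  by (auto simp: V.subspace_def supp_in_def vec_apply)

text \<open>Induction on the number of coordinates: the values of Z at one position form an ideal of
  k, and lifts of generators of this ideal reduce every element of Z to one vanishing at that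
  position.\<close>

lemma noetherian_supp_in:
  assumes noeth: "noetherian TYPE('k::comm_ring_1)" and "finite B"
    and "V.subspace Z" "Z \<subseteq> (supp_in B :: 'k vec set)"
  obtains G where "finite G" "Z = V.span G"
proof -
  have "\<exists>G. finite G \<and> Z = V.span G"
    using assms(2-4)
  proof (induction B arbitrary: Z)
    case empty
    have "v = 0" if "v \<in> Z" for v
      using empty(2) that by (auto simp: supp_in_def fun_eq_iff zero_fun_apply)
    then have "Z = {0}" using V.subspace_0[OF empty(1)] by blast
    then show ?case by (intro exI[of _ "{}"]) (simp add: V.span_empty)
  next
    case (insert p B)
    obtain a b where p: "p = (a, b)" by (cases p)
    note Zs = insert.prems(1)
    define I where "I = (\<lambda>v. v a b) ` Z"
    have "cr_ideal I"
      unfolding cr_ideal_def I_def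
    proof safe
      show "0 \<in> (\<lambda>v. v a b) ` Z" using V.subspace_0[OF Zs] by (intro image_eqI[of _ _ 0]) (auto simp: vec_apply)
      show "u a b + v a b \<in> (\<lambda>v. v a b) ` Z" if "u \<in> Z" "v \<in> Z" for u v
        using V.subspace_add[OF Zs that] by (intro image_eqI[of _ _ "u + v"]) (auto simp: vec_apply)
      show "c * u a b \<in> (\<lambda>v. v a b) ` Z" if "u \<in> Z" for u c
        using V.subspace_scale[OF Zs that] by (intro image_eqI[of _ _ "sm c u"]) (auto simp: vec_apply)
    qed
    then obtain S where S: "finite S" "S \<subseteq> I" "\<And>J. cr_ideal J \<Longrightarrow> S \<subseteq> J \<Longrightarrow> I \<subseteq> J"
      using noeth unfolding noetherian_def by metis
    have "\<forall>x\<in>S. \<exists>u. u \<in> Z \<and> u a b = x" using S(2) unfolding I_def by blast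
    then obtain z where z: "\<And>x. x \<in> S \<Longrightarrow> z x \<in> Z \<and> z x a b = x" by metis
    have "Z \<inter> supp_in B \<subseteq> supp_in B" by blast
    then obtain G where G: "finite G" "Z \<inter> supp_in B = V.span G"
      using insert.IH[of "Z \<inter> supp_in B"] V.subspace_inter[OF Zs subspace_supp_in] by blast
    have "Z = V.span (G \<union> z ` S)"
    proof
      have "G \<union> z ` S \<subseteq> Z" using G(2) V.span_superset[of G] z by auto
      then show "V.span (G \<union> z ` S) \<subseteq> Z" using Zs by (intro V.span_minimal)
      show "Z \<subseteq> V.span (G \<union> z ` S)"
      proof
        fix v assume v: "v \<in> Z"
        define J where "J = (\<lambda>v. v a b) ` V.span (z ` S)"
        have "cr_ideal J"
          unfolding cr_ideal_def J_def
        proof safe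
          show "0 \<in> (\<lambda>v. v a b) ` V.span (z ` S)" using V.span_zero by (intro image_eqI[of _ _ 0]) (auto simp: vec_apply)
          show "u a b + v a b \<in> (\<lambda>v. v a b) ` V.span (z ` S)" if "u \<in> V.span (z ` S)" "v \<in> V.span (z ` S)" for u v
            using V.span_add[OF that] by (intro image_eqI[of _ _ "u + v"]) (auto simp: vec_apply)
          show "c * u a b \<in> (\<lambda>v. v a b) ` V.span (z ` S)" if "u \<in> V.span (z ` S)" for u c
            using V.span_scale[OF that] by (intro image_eqI[of _ _ "sm c u"]) (auto simp: vec_apply)
        qed
        moreover have "S \<subseteq> J"
        proof
          fix x assume "x \<in> S"
          then show "x \<in> J" unfolding J_def using z[of x] V.span_base[of "z x" "z ` S"] by (auto intro!: image_eqI[of _ _ "z x"])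
        qed
        ultimately have "v a b \<in> J" using S(3) v by (auto simp: I_def)
        then obtain w where w: "w \<in> V.span (z ` S)" "w a b = v a b" by (auto simp: J_def)
        have "w \<in> Z" using w(1) z Zs V.span_minimal[of "z ` S" Z] by blast
        then have vw: "v - w \<in> Z" using V.subspace_diff[OF Zs v] by blast
        then have "v - w \<in> supp_in (insert p B)" using insert.prems(2) by blast
        moreover have "(v - w) a b = 0" using w(2) by (simp add: minus_apply)
        ultimately have "v - w \<in> supp_in B" by (auto simp: supp_in_def p)
        then have "v - w \<in> V.span (G \<union> z ` S)"
          using G(2) vw V.span_mono[of G "G \<union> z ` S"] by blast
        moreover have "w \<in> V.span (G \<union> z ` S)" using w(1) V.span_mono[of "z ` S" "G \<union> z ` S"] by blast
        ultimately have "(v - w) + w \<in> V.span (G \<union> z ` S)" by (rule V.span_add)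
        then show "v \<in> V.span (G \<union> z ` S)" by simp
      qed
    qed
    moreover have "finite (G \<union> z ` S)" using G(1) S(1) by simp
    ultimately show ?case by metis
  qed
  then show ?thesis using that by blast
qed

lemma chain_stabilizes:
  assumes noeth: "noetherian TYPE('k::comm_ring_1)" and "finite B"
    and U: "\<And>e. V.subspace (U e)" "\<And>e. U e \<subseteq> (supp_in B :: 'k vec set)" "\<And>e. U e \<subseteq> U (Suc e)"
  obtains e where "U (Suc e) = U e"
proof -
  have mono: "U e \<subseteq> U f" if "e \<le> f" for e f using lift_Suc_mono_le[of U] U(3) that by blast
  have sub: "V.subspace (\<Union>e. U e)"
    unfolding V.subspace_def
  proof (intro conjI ballI allI)
    show "0 \<in> (\<Union>e. U e)" using V.subspace_0[OF U(1)] by blast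
    show "x + y \<in> (\<Union>e. U e)" if "x \<in> (\<Union>e. U e)" "y \<in> (\<Union>e. U e)" for x y
    proof -
      from that obtain e f where "x \<in> U e" "y \<in> U f" by blast
      then have "x \<in> U (max e f)" "y \<in> U (max e f)" using mono[of e "max e f"] mono[of f "max e f"] by auto
      then show ?thesis using V.subspace_add[OF U(1)] by blast
    qed
    show "sm c x \<in> (\<Union>e. U e)" if "x \<in> (\<Union>e. U e)" for c x using that V.subspace_scale[OF U(1)] by blast
  qed
  obtain G where G: "finite G" "(\<Union>e. U e) = V.span G"
    using noetherian_supp_in[OF noeth assms(2) sub] U(2) by blast
  have "G \<subseteq> (\<Union>e. U e)" using G(2) V.span_superset by blast
  with G(1) have "\<exists>e. G \<subseteq> U e"
  proof (induction G)
    case (insert g G)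
    then obtain e f where "G \<subseteq> U e" "g \<in> U f" by blast
    then have "insert g G \<subseteq> U (max e f)" using mono[of e "max e f"] mono[of f "max e f"] by auto
    then show ?case by blast
  qed auto
  then obtain e where "G \<subseteq> U e" by blast
  then have "V.span G \<subseteq> U e" using U(1) by (rule V.span_minimal)
  then have "U (Suc e) = U e" using U(3)[of e] G(2) by blast
  then show ?thesis using that by blast
qed

context prime_setup
begin

text \<open>Enlarging U to a submodule W maximal among those avoiding every multiple of v
  by a scalar outside M makes x v lie in W for all x in M, which replaces Nakayama's lemma.\<close>

lemma krull:
  fixes p :: "nat \<Rightarrow> 'k"
  assumes B: "finite B" and U: "V.subspace U" "U \<subseteq> supp_in B" and p: "\<And>e. p e \<in> M"
    and v: "v \<in> supp_in B"
    and near: "\<And>e. \<exists>\<sigma>. \<sigma> \<notin> M \<and> (\<exists>u\<in>U. \<exists>w\<in>supp_in B. sm \<sigma> v = u + sm (\<Prod>i<e. p i) w)"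
  shows "\<exists>\<sigma>. \<sigma> \<notin> M \<and> sm \<sigma> v \<in> U"
proof (rule ccontr)
  assume contra: "\<not> ?thesis"
  let ?A = "{W. V.subspace W \<and> U \<subseteq> W \<and> W \<subseteq> supp_in B \<and> (\<forall>\<sigma>. \<sigma> \<notin> M \<longrightarrow> sm \<sigma> v \<notin> W)}"
  have UA: "U \<in> ?A" using U contra by auto
  have "\<exists>W\<in>?A. \<forall>W'\<in>?A. W \<subseteq> W' \<longrightarrow> W' = W"
  proof (rule subset_Zorn)
    fix C assume C: "subset.chain ?A C"
    show "\<exists>T\<in>?A. \<forall>W\<in>C. W \<subseteq> T"
    proof (cases "C = {}")
      case True
      then show ?thesis using UA by blast
    next
      case False
      have CA: "W \<in> ?A" if "W \<in> C" for W using that C by (auto simp: subset.chain_def)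
      have "V.subspace (\<Union>C)"
        unfolding V.subspace_def
      proof (intro conjI ballI allI)
        show "0 \<in> \<Union>C" using False CA V.subspace_0 by blast
        show "x + y \<in> \<Union>C" if "x \<in> \<Union>C" "y \<in> \<Union>C" for x y
        proof -
          from that obtain W W' where W: "W \<in> C" "W' \<in> C" "x \<in> W" "y \<in> W'" by blast
          then have "W \<subseteq> W' \<or> W' \<subseteq> W" using C by (auto simp: subset_chain_def)
          then show ?thesis using W CA V.subspace_add by blast
        qed
        show "sm c x \<in> \<Union>C" if "x \<in> \<Union>C" for c x using that CA V.subspace_scale by blast
      qed
      then have "\<Union>C \<in> ?A" using False CA by blast
      then show ?thesis by blast
    qed
  qed
  then obtain W where WA: "W \<in> ?A" and max: "\<forall>W'\<in>?A. W \<subseteq> W' \<longrightarrow> W' = W" by (rule bexE)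
  from WA have W: "V.subspace W" "U \<subseteq> W" "W \<subseteq> supp_in B" "\<And>\<sigma>. \<sigma> \<notin> M \<Longrightarrow> sm \<sigma> v \<notin> W"
    by auto
  have Mv: "sm x v \<in> W" if x: "x \<in> M" for x
  proof (rule ccontr)
    assume n: "sm x v \<notin> W"
    let ?W = "V.span (insert (sm x v) W)"
    have "W \<subseteq> ?W" using V.span_superset by blast
    moreover have "sm x v \<in> ?W" by (simp add: V.span_base)
    ultimately have "?W \<notin> ?A" using max n by blast
    moreover have "?W \<subseteq> supp_in B"
      using V.subspace_scale[OF subspace_supp_in v] W(3) by (intro V.span_minimal subspace_supp_in) auto
    ultimately obtain \<sigma> where \<sigma>: "\<sigma> \<notin> M" "sm \<sigma> v \<in> ?W"
      using \<open>W \<subseteq> ?W\<close> W(2) by (auto simp: V.subspace_span)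
    then obtain k where "sm \<sigma> v - sm k (sm x v) \<in> V.span W" by (auto simp: V.span_insert)
    moreover have "V.span W = W" using W(1) by (simp add: V.span_eq_iff)
    ultimately have "sm (\<sigma> - k * x) v \<in> W" by (simp add: V.scale_left_diff_distrib)
    moreover have "\<sigma> - k * x \<notin> M"
      using ideal_add[OF M_ideal, of "\<sigma> - k * x" "k * x"] ideal_mult[OF M_ideal x, of k] \<sigma>(1) by auto
    ultimately show False using W(4) by blast
  qed
  \<comment> \<open>The modules (W : c e) ascend inside k^B and hence become stationary at some e.
    For this e, multiplying \<sigma> v = u + c e w by p e shows that c (Suc e) w lies in W; then c e
    w does so too, and with it \<sigma> v.\<close>
  define c where "c e = (\<Prod>i<e. p i)" for e
  have "V.subspace {w \<in> supp_in B. sm (c e) w \<in> W}" for e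
    unfolding V.subspace_def
    using V.subspace_0[OF W(1)] V.subspace_add[OF W(1)] V.subspace_scale[OF W(1)]
      V.subspace_0[OF subspace_supp_in[of B]] V.subspace_add[OF subspace_supp_in[of B]]
      V.subspace_scale[OF subspace_supp_in[of B]]
    by (auto simp: V.scale_right_distrib V.scale_left_commute simp del: V.scale_scale)
  moreover have "{w \<in> supp_in B. sm (c e) w \<in> W} \<subseteq> {w \<in> supp_in B. sm (c (Suc e)) w \<in> W}" for e
    using V.subspace_scale[OF W(1), of _ "p e"]
    by (auto simp: c_def mult.commute V.scale_scale[symmetric] simp del: V.scale_scale)
  ultimately obtain e where e: "{w \<in> supp_in B. sm (c (Suc e)) w \<in> W} = {w \<in> supp_in B. sm (c e) w \<in> W}"
    using chain_stabilizes[OF noeth B, of "\<lambda>e. {w \<in> supp_in B. sm (c e) w \<in> W}"] by blast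
  obtain \<sigma> u w where *: "\<sigma> \<notin> M" "u \<in> U" "w \<in> supp_in B" "sm \<sigma> v = u + sm (c e) w"
    using near[of e] by (auto simp: c_def)
  have "sm (p e) (sm \<sigma> v) \<in> W"
    using V.subspace_scale[OF W(1) Mv[OF p[of e]], of \<sigma>] by (simp add: mult.commute)
  moreover have "sm (p e) u \<in> W" using V.subspace_scale[OF W(1)] W(2) *(2) by blast
  ultimately have "sm (p e) (sm \<sigma> v) - sm (p e) u \<in> W" by (rule V.subspace_diff[OF W(1)])
  moreover have "sm (p e) (sm \<sigma> v) - sm (p e) u = sm (c (Suc e)) w"
    unfolding *(4) by (simp add: V.scale_right_distrib c_def mult.commute)
  ultimately have "sm (c e) w \<in> W" using e *(3) by auto
  then have "sm \<sigma> v \<in> W" unfolding *(4) using *(2) W(1,2) by (auto intro: V.subspace_add)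
  then show False using W(4) *(1) by blast
qed

end

section \<open>Divisibility chains\<close>

text \<open>The normal form of the parameters near M that \<open>torsion_free_local\<close> reaches
  through \<open>normalized\<close>: P plays the part of the set of indices n \<ge> 2 with \<pi> n
  in M, and all other parameters have become 1.\<close>

definition dchain :: "'k::comm_ring_1 set \<Rightarrow> (nat \<Rightarrow> 'k) \<Rightarrow> nat set \<Rightarrow> bool" where
  "dchain M \<pi> P \<longleftrightarrow> P \<subseteq> {2..} \<and> infinite P \<and> (\<forall>a\<in>P. \<forall>b\<in>P. a dvd b \<or> b dvd a) \<and>
     (\<forall>j\<ge>2. j \<notin> P \<longrightarrow> \<pi> j = 1) \<and> (\<forall>j\<in>P. \<pi> j \<in> M)"

lemma
  assumes "dchain M \<pi> P"
  shows dchain_ge2: "\<And>a. a \<in> P \<Longrightarrow> 2 \<le> a"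
    and dchain_infinite: "infinite P"
    and dchain_dvd: "\<And>a b. a \<in> P \<Longrightarrow> b \<in> P \<Longrightarrow> a dvd b \<or> b dvd a"
    and dchain_one: "\<And>j. j \<ge> 2 \<Longrightarrow> j \<notin> P \<Longrightarrow> \<pi> j = 1"
    and dchain_mem: "\<And>j. j \<in> P \<Longrightarrow> \<pi> j \<in> M"
  using assms unfolding dchain_def by (auto simp: subset_iff)

lemma dchain_dvd_le:
  assumes "dchain M \<pi> P" "a \<in> P" "b \<in> P" "a \<le> b"
  shows "a dvd b"
  using dchain_dvd[OF assms(1-3)] dchain_ge2[OF assms(1) assms(2)] assms(4)
  by (auto dest: dvd_imp_le)

lemma cc_dchain:
  assumes "dchain M \<pi> P" "a + b \<le> N"
  shows "cc \<pi> a b = (\<Prod>j\<in>P \<inter> {2..N}. \<pi> j ^ eps j a b)"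
  unfolding cc_eq_prod_le[OF assms(2)]
  by (rule prod.mono_neutral_right) (use dchain_one[OF assms(1)] in force)+

lemma mod_mult_add:
  fixes k Q l t :: nat
  assumes "t < Q"
  shows "(k * Q + t) mod (Q * l) = Q * (k mod l) + t"
  using assms by (simp add: mod_mult2_eq)

text \<open>Adding k * Q changes no carry. A divisor of Q sees the same residues; for a multiple j =
  Q * l the residue Q * (k mod l) + b stays below j after n is added, since n + b < Q.\<close>

lemma cc_shift:
  assumes ch: "dchain M \<pi> P" and Q: "Q \<in> P" and lt: "n + b < Q"
  shows "cc \<pi> n (k * Q + b) = cc \<pi> n b"
proof -
  let ?N = "n + (k * Q + b)"
  have "eps j n (k * Q + b) = eps j n b" if j: "j \<in> P" for j
  proof -
    have j0: "j > 0" using dchain_ge2[OF ch j] by simp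
    consider "j dvd Q" | "Q dvd j" using dchain_dvd[OF ch j Q] by blast
    then show ?thesis
    proof cases
      case 1
      then have "(k * Q + b) mod j = b mod j"
        using mod_add_left_eq[of "k * Q" j b] by (simp add: mod_eq_0_iff_dvd[THEN iffD2] dvd_mult)
      then show ?thesis using j0 by (simp add: eps_mod)
    next
      case 2
      then obtain l where l: "j = Q * l" by (auto elim: dvdE)
      then have l0: "l > 0" "Q > 0" using j0 by auto
      have "Q * (k mod l) + Q \<le> Q * l"
        using mod_less_divisor[OF l0(1), of k] mult_le_mono2[of "Suc (k mod l)" l Q] by simp
      moreover have "(k * Q + b) mod j = Q * (k mod l) + b"
        unfolding l using mod_mult_add[of b Q] lt by simp
      moreover have "Q \<le> j" using l l0 by simp
      ultimately show ?thesis using lt j0 by (simp add: eps_mod l)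
    qed
  qed
  then show ?thesis
    using cc_dchain[OF ch, of n "k * Q + b" ?N] cc_dchain[OF ch, of n b ?N] by (auto intro: prod.cong)
qed

text \<open>Hence x^[k Q + t] = x^[k Q] x^[t] for t < Q, so the x^[t] form a basis of D over the
  span of the x^[k Q].\<close>

lemma cc_multiple: "dchain M \<pi> P \<Longrightarrow> Q \<in> P \<Longrightarrow> t < Q \<Longrightarrow> cc \<pi> (k * Q) t = 1"
  using cc_shift[of M \<pi> P Q t 0 k] by (simp add: cc_commute[of \<pi> "k * Q"])

text \<open>The bound l \<le> k * Q keeps the index set finite also for k = 0, where every l divides
  k * Q.\<close>

definition carry :: "(nat \<Rightarrow> 'k::comm_ring_1) \<Rightarrow> nat set \<Rightarrow> nat \<Rightarrow> nat \<Rightarrow> 'k" where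
  "carry \<pi> P Q k = (\<Prod>l\<in>{l \<in> P. Q \<le> l \<and> l \<le> k * Q \<and> l dvd k * Q}. \<pi> l)"

text \<open>Adding a to k Q + t - a carries past every l in P with Q \<le> l dividing k Q.\<close>

lemma cc_carry:
  assumes ch: "dchain M \<pi> P" and Q: "Q \<in> P" and a: "t < a" "a < Q" and k: "k > 0"
  shows "carry \<pi> P Q k dvd cc \<pi> a (k * Q + t - a)"
proof -
  define b where "b = k * Q + t - a"
  define S where "S = {l \<in> P. Q \<le> l \<and> l \<le> k * Q \<and> l dvd k * Q}"
  have aQ: "a \<le> k * Q" using a k by (cases k) auto
  have e: "eps l a b = 1" if "l \<in> S" for l
  proof -
    have l: "l \<in> P" "Q \<le> l" "l dvd k * Q" using that by (auto simp: S_def)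
    obtain c where c: "k * Q = l * c" using l(3) by (auto elim: dvdE)
    have "c > 0" using c k dchain_ge2[OF ch Q] by (cases c) auto
    then obtain c' where c': "c = Suc c'" by (cases c) auto
    \<comment> \<open>Since k * Q = l * Suc c', the residue of b modulo l is l - (a - t); adding a
      gives l + t, which overflows.\<close>
    have "b = l * c' + (l - (a - t))" using a l(2) unfolding b_def c c' by simp
    then have "b mod l = (l - (a - t)) mod l" by (simp only: mod_mult_self4)
    then have "b mod l = l - (a - t)" using a l(2) by simp
    moreover have "a mod l = a" using a l(2) by simp
    ultimately show ?thesis using a l(2) by (simp add: eps_mod)
  qed
  have "S \<subseteq> P \<inter> {2..a + b}"
    using dchain_ge2[OF ch] aQ by (auto simp: S_def b_def)
  then have "(\<Prod>l\<in>S. \<pi> l ^ eps l a b) dvd (\<Prod>j\<in>P \<inter> {2..a + b}. \<pi> j ^ eps j a b)"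
    by (intro prod_dvd_prod_subset) auto
  moreover have "(\<Prod>l\<in>S. \<pi> l ^ eps l a b) = carry \<pi> P Q k"
    unfolding carry_def S_def[symmetric] by (rule prod.cong) (auto simp: e)
  ultimately show ?thesis using cc_dchain[OF ch, of a b "a + b"] by (simp add: b_def)
qed

lemma carry_mem:
  assumes ch: "dchain M \<pi> P" and Q: "Q \<in> P" and "\<pi> Q \<in> I" "cr_ideal I" "k > 0"
  shows "carry \<pi> P Q k \<in> I"
proof -
  let ?S = "{l \<in> P. Q \<le> l \<and> l \<le> k * Q \<and> l dvd k * Q}"
  have "finite ?S" by (rule finite_subset[of _ "{..k * Q}"]) auto
  moreover have "Q \<in> ?S" using assms by auto
  ultimately have "carry \<pi> P Q k = \<pi> Q * (\<Prod>l\<in>?S - {Q}. \<pi> l)"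
    unfolding carry_def by (rule prod.remove)
  then show ?thesis using assms ideal_mult_right by metis
qed

section \<open>Blocks of Q consecutive degrees\<close>

definition slice :: "nat \<Rightarrow> nat \<Rightarrow> 'k::comm_ring_1 vec \<Rightarrow> 'k vec" where
  "slice Q k v = (\<lambda>i t. if t < Q then v i (k * Q + t) else 0)"

lemma slice_apply: "slice Q k v i t = (if t < Q then v i (k * Q + t) else 0)"
  by (simp add: slice_def)

lemma slice_add: "slice Q k (v + w) = slice Q k v + slice Q k w"
  by (auto simp: slice_apply fun_eq_iff vec_apply)

lemma slice_sm: "slice Q k (sm c v) = sm c (slice Q k v)"
  by (auto simp: slice_apply fun_eq_iff vec_apply)

lemma slice_0: "slice Q k 0 = 0"
  by (auto simp: slice_apply fun_eq_iff vec_apply)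

lemma slice_F: "v \<in> F r \<Longrightarrow> slice Q k v \<in> F r"
  by (rule FI[where B = Q]) (auto simp: slice_apply F_out)

lemma slice_supp: "v \<in> F r \<Longrightarrow> slice Q k v \<in> supp_in ({..<r} \<times> {..<Q})"
  by (auto simp: slice_apply supp_in_def F_out)

lemma inI_slice: "cr_ideal I \<Longrightarrow> inI I v \<Longrightarrow> inI I (slice Q k v)"
  by (auto simp: inI_def slice_apply ideal_0)

text \<open>A shift of g that starts inside block k acts there like a shift by n mod Q in degrees
  below Q, by \<open>cc_shift\<close>. A shift that starts earlier reaches the block only by
  crossing degree k * Q, which costs the factor \<open>carry \<pi> P Q k\<close>.\<close>

lemma slice_X:
  assumes ch: "dchain M \<pi> P" and Q: "Q \<in> P" and g: "g \<in> F r" "\<And>i n. n \<ge> Q \<Longrightarrow> g i n = 0"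
    and k: "k > 0"
  obtains w where "w \<in> supp_in ({..<r} \<times> {..<Q})"
    "slice Q k (X \<pi> n g) = (if n div Q = k then slice Q 0 (X \<pi> (n mod Q) g) else 0) + sm (carry \<pi> P Q k) w"
proof -
  have Q0: "Q > 0" using dchain_ge2[OF ch Q] by simp
  let ?m = "if n div Q = k then slice Q 0 (X \<pi> (n mod Q) g) else 0"
  have "\<exists>x. (i \<ge> r \<or> t \<ge> Q \<longrightarrow> x = 0) \<and> slice Q k (X \<pi> n g) i t = ?m i t + carry \<pi> P Q k * x" for i t
  proof (cases "i \<ge> r \<or> t \<ge> Q")
    case True
    then have "slice Q k (X \<pi> n g) i t = 0" "?m i t = 0"
      using F_out[OF F_X[OF g(1)]] by (auto simp: slice_apply vec_apply)
    then show ?thesis by (intro exI[of _ 0]) simp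
  next
    case False
    then have t: "t < Q" by simp
    consider "n div Q = k" | "n div Q > k" | "n div Q < k" by linarith
    then have "\<exists>x. slice Q k (X \<pi> n g) i t = ?m i t + carry \<pi> P Q k * x"
    proof cases
      case 1
      define n' where "n' = n mod Q"
      have n: "n = k * Q + n'" using 1 div_mult_mod_eq[of n Q] by (simp add: n'_def)
      have "X \<pi> n g i (k * Q + t) = X \<pi> n' g i t"
      proof (cases "n' \<le> t")
        case True
        then have "cc \<pi> (t - n') (k * Q + n') = cc \<pi> (t - n') n'"
          using t by (intro cc_shift[OF ch Q]) simp
        then have "cc \<pi> n (t - n') = cc \<pi> n' (t - n')" by (simp add: n cc_commute[of \<pi> _ "t - n'"])
        then show ?thesis using True by (simp add: X_apply n)
      next
        case False
        then show ?thesis by (simp add: X_apply n)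
      qed
      then show ?thesis using 1 t by (intro exI[of _ 0]) (simp add: slice_apply n'_def)
    next
      case 2
      then have "(k + 1) * Q \<le> n div Q * Q" by (intro mult_le_mono1) simp
      also have "\<dots> \<le> n" by simp
      finally have "n > k * Q + t" using t by simp
      then show ?thesis using 2 by (intro exI[of _ 0]) (simp add: slice_apply X_apply vec_apply)
    next
      case 3
      have nk: "n < k * Q" using 3 Q0 by (simp add: div_less_iff_less_mult)
      define b where "b = k * Q + t - n"
      have val: "slice Q k (X \<pi> n g) i t = cc \<pi> n b * g i b"
        using nk t by (simp add: slice_apply X_apply b_def)
      have m0: "?m i t = 0" using 3 by (simp add: vec_apply)
      show ?thesis
      proof (cases "b < Q")
        case True
        have "carry \<pi> P Q k dvd cc \<pi> b (k * Q + t - b)"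
          using nk True k by (intro cc_carry[OF ch Q]) (auto simp: b_def)
        moreover have "k * Q + t - b = n" using nk by (simp add: b_def)
        ultimately have "carry \<pi> P Q k dvd cc \<pi> n b * g i b" by (simp add: cc_commute[of \<pi> n])
        then show ?thesis using val m0 by (auto elim: dvdE)
      next
        case False
        then show ?thesis using val m0 g(2)[of b i] by (intro exI[of _ 0]) simp
      qed
    qed
    then show ?thesis using False by auto
  qed
  then obtain w where w: "\<And>i t. i \<ge> r \<or> t \<ge> Q \<longrightarrow> w i t = 0"
    "\<And>i t. slice Q k (X \<pi> n g) i t = ?m i t + carry \<pi> P Q k * w i t" by metis
  have "w \<in> supp_in ({..<r} \<times> {..<Q})" using w(1) by (auto simp: supp_in_def)
  moreover have "slice Q k (X \<pi> n g) = ?m + sm (carry \<pi> P Q k) w"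
    using w(2) by (intro ext) (simp add: vec_apply)
  ultimately show ?thesis using that by blast
qed

lemma slice_X_0: "slice Q 0 (X \<pi> n g) = (if n div Q = 0 then slice Q 0 (X \<pi> (n mod Q) g) else 0)"
  by (auto simp: slice_apply X_apply fun_eq_iff vec_apply div_eq_0_iff)

lemma slice_X_multiple:
  assumes ch: "dchain M \<pi> P" and Q: "Q \<in> P" and v: "\<And>i n. n \<ge> Q \<Longrightarrow> v i n = 0"
  shows "slice Q k (X \<pi> (k * Q) v) = v"
  using v by (auto simp: slice_apply fun_eq_iff cc_multiple[OF ch Q] not_less)

lemma sum_slices:
  assumes ch: "dchain M \<pi> P" and Q: "Q \<in> P" and v: "\<And>i n. n \<ge> K * Q \<Longrightarrow> v i n = 0"
  shows "v = (\<Sum>k<K. X \<pi> (k * Q) (slice Q k v))"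
proof (intro ext)
  fix i m
  have Q0: "Q > 0" using dchain_ge2[OF ch Q] by simp
  define k t where "k = m div Q" and "t = m mod Q"
  have m: "m = k * Q + t" and t: "t < Q" using Q0 by (auto simp: k_def t_def)
  have "X \<pi> (l * Q) (slice Q l v) i m = (if l = k then v i m else 0)" for l
  proof (cases l k rule: linorder_cases)
    case equal
    then show ?thesis using t by (simp add: m cc_multiple[OF ch Q] slice_apply)
  next
    case greater
    then have "(k + 1) * Q \<le> l * Q" by (intro mult_le_mono1) simp
    then have "\<not> l * Q \<le> m" using t by (simp add: m)
    then show ?thesis using greater by (simp add: X_apply)
  next
    case less
    then have "(l + 1) * Q \<le> k * Q" by (intro mult_le_mono1) simp
    then have "m - l * Q \<ge> Q" by (simp add: m)
    then show ?thesis using less by (simp add: X_apply slice_apply)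
  qed
  then have "(\<Sum>k<K. X \<pi> (k * Q) (slice Q k v)) i m = (if k < K then v i m else 0)"
    by (simp add: sum_vec_apply)
  also have "\<dots> = v i m"
  proof (cases "k < K")
    case False
    then have "K * Q \<le> k * Q" by simp
    then have "K * Q \<le> m" using m by linarith
    then show ?thesis using v by simp
  qed simp
  finally show "v i m = (\<Sum>k<K. X \<pi> (k * Q) (slice Q k v)) i m" by simp
qed

section \<open>Ideals containing infinitely many of the parameters\<close>

lemma inI_diff_trans: "cr_ideal I \<Longrightarrow> inI I (a - b) \<Longrightarrow> inI I (b - c) \<Longrightarrow> inI I (a - c)"
  using inI_add[of I "a - b" "b - c"] by simp

text \<open>When \<pi> Q lies in I, so does every carry factor with k > 0. Modulo I the blocks
  therefore do not interact, and products that would pass from one block into the next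
  vanish.\<close>

lemma slice_X_inI:
  assumes ch: "dchain M \<pi> P" and Q: "Q \<in> P" "\<pi> Q \<in> I" and I: "cr_ideal I"
    and g: "g \<in> F r" "\<And>i n. n \<ge> Q \<Longrightarrow> g i n = 0"
  shows "inI I (slice Q k (X \<pi> n g) - (if n div Q = k then X \<pi> (n mod Q) g else 0))"
proof -
  have Q0: "Q > 0" using dchain_ge2[OF ch Q(1)] by simp
  have low: "inI I (slice Q 0 (X \<pi> n' g) - X \<pi> n' g)" if n': "n' < Q" for n'
    unfolding inI_def
  proof (intro allI)
    fix i m
    show "(slice Q 0 (X \<pi> n' g) - X \<pi> n' g) i m \<in> I"
    proof (cases "m < Q \<or> m - n' \<ge> Q")
      case True
      then have "(slice Q 0 (X \<pi> n' g) - X \<pi> n' g) i m = 0"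
        using g(2)[of "m - n'" i] by (auto simp: slice_apply X_apply vec_apply)
      then show ?thesis by (simp add: ideal_0[OF I])
    next
      case False
      define t where "t = m - Q"
      have t: "t < n'" "m = 1 * Q + t" using False by (auto simp: t_def)
      have "carry \<pi> P Q 1 dvd cc \<pi> n' (m - n')"
        unfolding t(2) by (rule cc_carry[OF ch Q(1) t(1) n']) simp
      then have "cc \<pi> n' (m - n') \<in> I"
        using carry_mem[OF ch Q I, of 1] ideal_mult_right[OF I] by (auto elim!: dvdE)
      then have "0 - X \<pi> n' g i m \<in> I"
        using ideal_diff[OF I ideal_0[OF I]] ideal_mult_right[OF I] ideal_0[OF I] by (simp add: X_apply)
      then show ?thesis using False by (simp add: slice_apply vec_apply)
    qed
  qed
  have "inI I (slice Q k (X \<pi> n g) - (if n div Q = k then slice Q 0 (X \<pi> (n mod Q) g) else 0))"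
  proof (cases "k = 0")
    case True
    then show ?thesis using slice_X_0[of Q \<pi> n g] inI_0[OF I] by simp
  next
    case False
    then obtain w where "slice Q k (X \<pi> n g)
        = (if n div Q = k then slice Q 0 (X \<pi> (n mod Q) g) else 0) + sm (carry \<pi> P Q k) w"
      using slice_X[OF ch Q(1) g, of k n] by (metis neq0_conv)
    then show ?thesis using inI_sm_ideal[OF I carry_mem[OF ch Q I]] False by simp
  qed
  moreover have "inI I ((if n div Q = k then slice Q 0 (X \<pi> (n mod Q) g) else 0)
      - (if n div Q = k then X \<pi> (n mod Q) g else 0))"
    using low[of "n mod Q"] Q0 inI_0[OF I] by simp
  ultimately show ?thesis by (rule inI_diff_trans[OF I])
qed

lemma ex_large_zero:
  fixes P :: "nat set"
  assumes "infinite {l \<in> P. \<pi> l \<in> I}"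
  obtains Q where "Q \<in> P" "\<pi> Q \<in> I" "B \<le> Q"
proof -
  have "\<exists>Q\<ge>B. Q \<in> {l \<in> P. \<pi> l \<in> I}" 
    using assms infinite_nat_iff_unbounded_le[THEN iffD1, rule_format] by metis
  then show ?thesis using that by blast
qed

text \<open>Let Q exceed all degrees in the matrix of L. Modulo I the map L commutes with taking
  blocks, so its kernel is generated by the part in degrees below Q, a submodule of a finitely
  generated k-module.\<close>

lemma Coh_infinite:
  assumes noeth: "noetherian TYPE('k::comm_ring_1)" and ch: "dchain M (\<pi> :: nat \<Rightarrow> 'k) P" and I: "cr_ideal I"
    and inf: "infinite {l \<in> P. \<pi> l \<in> I}"
  shows "Coh \<pi> I"
  unfolding Coh_def
proof (intro allI impI)
  fix s r L assume L: "lin \<pi> s r L"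
  have "(\<lambda>j. L (ebas j)) ` {..<s} \<subseteq> F r" using lin_F[OF L] ebas_F by blast
  then obtain B where B: "\<And>g i n. g \<in> (\<lambda>j. L (ebas j)) ` {..<s} \<Longrightarrow> n \<ge> B \<Longrightarrow> g i n = 0"
    using finite_F_bound[of "(\<lambda>j. L (ebas j)) ` {..<s}" r] by blast
  obtain Q where Q: "Q \<in> P" "\<pi> Q \<in> I" "B \<le> Q" using ex_large_zero[OF inf] by blast
  have Q0: "Q > 0" using dchain_ge2[OF ch Q(1)] by simp
  have deg: "L (ebas j) i n = 0" if "j < s" "n \<ge> Q" for j i n using B[of "L (ebas j)" n i] that Q(3) by auto
  have sl: "inI I (slice Q k (L c) - L (slice Q k c))" if "c \<in> F s" for k c
    using that
  proof (induction rule: F_induct[where \<pi> = \<pi>])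
    case zero
    show "inI I (slice Q k (L 0) - L (slice Q k 0))" by (simp add: slice_0 lin_0[OF L] inI_0[OF I])
  next
    case (base n j)
    have *: "slice Q k (X \<pi> n (ebas j)) = (if n div Q = k then X \<pi> (n mod Q) (ebas j) else 0)"
    proof (intro ext)
      fix i t
      have "n = k * Q + t \<and> t < Q \<longleftrightarrow> n div Q = k \<and> n mod Q = t" using Q0 by (auto simp: mult.commute)
      then show "slice Q k (X \<pi> n (ebas j)) i t = (if n div Q = k then X \<pi> (n mod Q) (ebas j) else 0) i t"
        by (auto simp: slice_apply X_ebas vec_apply)
    qed
    have "L (slice Q k (X \<pi> n (ebas j))) = (if n div Q = k then X \<pi> (n mod Q) (L (ebas j)) else 0)"
      unfolding * using base by (simp add: lin_0[OF L] lin_X[OF L] ebas_F)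
    moreover have "L (X \<pi> n (ebas j)) = X \<pi> n (L (ebas j))" using base by (simp add: lin_X[OF L] ebas_F)
    ultimately show "inI I (slice Q k (L (X \<pi> n (ebas j))) - L (slice Q k (X \<pi> n (ebas j))))"
      using slice_X_inI[OF ch Q(1,2) I lin_F[OF L ebas_F[OF base]] deg[OF base], of k n] by simp
  next
    case (add c a b)
    have "slice Q k (L (sm c a + b)) - L (slice Q k (sm c a + b))
        = sm c (slice Q k (L a) - L (slice Q k a)) + (slice Q k (L b) - L (slice Q k b))"
      using add(1,2) by (simp add: lin_add[OF L] lin_sm[OF L] slice_add slice_sm slice_F F_sm
          V.scale_right_diff_distrib)
    then show "inI I (slice Q k (L (sm c a + b)) - L (slice Q k (sm c a + b)))"
      using add(3,4) by (simp add: inI_add[OF I] inI_sm[OF I])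
  qed
  define U where "U = kerI I s L \<inter> supp_in ({..<s} \<times> {..<Q})"
  have "V.subspace U"
    unfolding U_def by (intro V.subspace_inter subm_subspace[OF subm_kerI[OF I L]] subspace_supp_in)
  then obtain G where G: "finite G" "U = V.span G"
    using noetherian_supp_in[OF noeth, of "{..<s} \<times> {..<Q}" U] by (auto simp: U_def)
  have GU: "G \<subseteq> kerI I s L" using G(2) V.span_superset[of G] by (auto simp: U_def)
  have "kerI I s L \<subseteq> dspan \<pi> G"
  proof
    fix c assume c: "c \<in> kerI I s L"
    then have cF: "c \<in> F s" by (simp add: kerI_def)
    obtain K where K: "\<And>i n. n \<ge> K \<Longrightarrow> c i n = 0" using F_bound[OF cF] by blast
    have "slice Q k c \<in> dspan \<pi> G" for k
    proof -
      have "inI I (slice Q k (L c))" using c by (simp add: kerI_def inI_slice[OF I])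
      then have "inI I (L (slice Q k c))" using inI_diff[OF I _ sl[OF cF, of k], of "slice Q k (L c)"] by simp
      then have "slice Q k c \<in> U" by (simp add: U_def kerI_def slice_F[OF cF] slice_supp[OF cF])
      moreover have "V.span G \<subseteq> dspan \<pi> G"
        by (rule V.span_minimal[OF _ subm_subspace[OF subm_dspan]]) (auto intro: dspan_inc)
      ultimately show ?thesis using G(2) by blast
    qed
    then have "(\<Sum>k<K. X \<pi> (k * Q) (slice Q k c)) \<in> dspan \<pi> G"
      by (intro subm_sum[OF subm_dspan] subm_X[OF subm_dspan])
    moreover have "K \<le> K * Q" using Q0 by simp
    then have "c i n = 0" if "n \<ge> K * Q" for i n using K[of n i] that by linarith
    ultimately show "c \<in> dspan \<pi> G" using sum_slices[OF ch Q(1), of K c] by metis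
  qed
  moreover have "dspan \<pi> G \<subseteq> kerI I s L" by (rule dspan_least[OF subm_kerI[OF I L] GU])
  ultimately have "kerI I s L = dspan \<pi> G" by blast
  moreover have "G \<subseteq> F s" using GU by (auto simp: kerI_def)
  ultimately show "fg \<pi> s (kerI I s L)" using G(1) by (simp add: fg_dspan)
qed

text \<open>Let Q exceed the degrees of v and of the generators of Z. Then Z is stable under taking
  blocks, because it contains I D^r. Block n0 of x^[n0 Q] v is v itself, so a single torsion
  relation suffices.\<close>

lemma Tor_infinite:
  assumes ch: "dchain M (\<pi> :: nat \<Rightarrow> 'k::comm_ring_1) P" and I: "cr_ideal I" and inf: "infinite {l \<in> P. \<pi> l \<in> I}"
  shows "Tor M \<pi> I"
  unfolding Tor_def
proof (intro allI impI)
  fix r Z v assume Z: "fg \<pi> r Z" "IF I r \<subseteq> Z" and v: "v \<in> F r" "torsion_mod M \<pi> Z v"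
  note s = fg_subm[OF Z(1)]
  obtain G where G: "finite G" "G \<subseteq> F r" "Z = dspan \<pi> G" using Z(1) by (auto simp: fg_def)
  obtain B where B: "\<And>g i n. g \<in> insert v G \<Longrightarrow> n \<ge> B \<Longrightarrow> g i n = 0"
    using finite_F_bound[of "insert v G" r] G v by blast
  obtain Q where Q: "Q \<in> P" "\<pi> Q \<in> I" "B \<le> Q" using ex_large_zero[OF inf] by blast
  have Q0: "Q > 0" using dchain_ge2[OF ch Q(1)] by simp
  have sl: "slice Q k z \<in> Z" if "z \<in> Z" for z k
    using that unfolding G(3)
  proof (induction rule: dspan_induct)
    case zero
    show "slice Q k 0 \<in> dspan \<pi> G" by (simp add: slice_0 subm_0[OF subm_dspan])
  next
    case (base n g)
    have gF: "g \<in> F r" using base G(2) by blast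
    let ?m = "if n div Q = k then X \<pi> (n mod Q) g else 0"
    have "?m \<in> F r" using gF by (simp add: F_X F_0)
    then have "slice Q k (X \<pi> n g) - ?m \<in> IF I r"
      using slice_X_inI[OF ch Q(1,2) I gF, of k n] B[of g] base Q(3) gF
      by (auto simp: IF_def intro!: F_diff slice_F F_X)
    then have "slice Q k (X \<pi> n g) - ?m \<in> dspan \<pi> G" using Z(2) G(3) by blast
    moreover have "?m \<in> dspan \<pi> G" using base by (simp add: dspan_base subm_0[OF subm_dspan])
    ultimately have "(slice Q k (X \<pi> n g) - ?m) + ?m \<in> dspan \<pi> G" by (rule subm_add[OF subm_dspan])
    then show "slice Q k (X \<pi> n g) \<in> dspan \<pi> G" by simp
  next
    case (add c a b)
    then show "slice Q k (sm c a + b) \<in> dspan \<pi> G"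
      by (simp add: slice_add slice_sm subm_add[OF subm_dspan] subm_sm[OF subm_dspan])
  qed
  obtain n0 where n0: "\<And>n. n \<ge> n0 \<Longrightarrow> \<exists>\<sigma>. \<sigma> \<notin> M \<and> sm \<sigma> (X \<pi> n v) \<in> Z"
    using v(2) by (auto simp: torsion_mod_def)
  have "n0 \<le> n0 * Q" using Q0 by simp
  then obtain \<sigma> where \<sigma>: "\<sigma> \<notin> M" "sm \<sigma> (X \<pi> (n0 * Q) v) \<in> Z" using n0 by blast
  have "slice Q n0 (X \<pi> (n0 * Q) v) = v"
    by (rule slice_X_multiple[OF ch Q(1)]) (use B[of v] Q(3) in auto)
  then have "sm \<sigma> v \<in> Z" using sl[OF \<sigma>(2), of n0] by (simp add: slice_sm)
  then show "\<exists>\<sigma>. \<sigma> \<notin> M \<and> sm \<sigma> v \<in> Z" using \<sigma>(1) by blast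
qed

section \<open>Prime ideals containing none of the parameters\<close>

text \<open>No structure constant vanishes in the domain k/I, so over its fraction field x^[n] is a
  nonzero multiple of the n-th power of x^[1]. The lemmas below are the theory of modules over a
  principal ideal domain with all denominators cleared.\<close>

locale regular_prime =
  fixes \<pi> :: "nat \<Rightarrow> 'k::comm_ring_1" and I :: "'k set"
  assumes I: "cr_ideal I" and I_one: "1 \<notin> I" and I_prime: "a * b \<in> I \<Longrightarrow> a \<in> I \<or> b \<in> I"
    and \<pi>_notin: "l \<ge> 2 \<Longrightarrow> \<pi> l \<notin> I"
begin

lemma prod_notin: "(\<And>a. a \<in> A \<Longrightarrow> f a \<notin> I) \<Longrightarrow> prod f A \<notin> I"
  by (induction A rule: infinite_finite_induct) (use I_one I_prime in auto)

lemma power_notin: "a \<notin> I \<Longrightarrow> a ^ n \<notin> I"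
  by (induction n) (use I_one I_prime in auto)

lemma cc_notin: "cc \<pi> a b \<notin> I"
  unfolding cc_eq_prod by (intro prod_notin power_notin \<pi>_notin) auto

lemma inI_cancel: "\<alpha> \<notin> I \<Longrightarrow> inI I (sm \<alpha> v) \<Longrightarrow> inI I v"
  using I_prime by (auto simp: inI_def vec_apply)

section \<open>Leading terms and division modulo the prime\<close>

lemma top_coeff:
  assumes "v \<in> F r" "v i n \<notin> I"
  obtains d where "v i d \<notin> I" "\<And>n. n > d \<Longrightarrow> v i n \<in> I"
proof -
  obtain B where B: "\<And>i n. n \<ge> B \<Longrightarrow> v i n = 0" using F_bound[OF assms(1)] by blast
  have fin: "finite {n. v i n \<notin> I}"
  proof (rule finite_subset[of _ "{..<B}"])
    show "{n. v i n \<notin> I} \<subseteq> {..<B}" using B[of _ i] ideal_0[OF I] by (force simp: not_le[symmetric])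
  qed simp
  have "v i (Max {n. v i n \<notin> I}) \<notin> I" using Max_in[OF fin] assms(2) by blast
  moreover have "v i n \<in> I" if "n > Max {n. v i n \<notin> I}" for n using Max_ge[OF fin, of n] that by force
  ultimately show ?thesis using that by blast
qed

text \<open>Let m be the largest index with q m outside I and d the degree of row i of w modulo I.
  In degree m + d all other terms lie in I, and what remains is q m times a structure constant times
  the leading coefficient of w, none of them in I.\<close>

lemma independent:
  assumes w: "w \<in> F r" "w i n \<notin> I" and sum: "\<And>m. (\<Sum>n<B. sm (q n) (X \<pi> n w)) i m \<in> I" and "n' < B"
  shows "q n' \<in> I"
proof (rule ccontr)
  assume "q n' \<notin> I"
  obtain d where d: "w i d \<notin> I" "\<And>n. n > d \<Longrightarrow> w i n \<in> I" using top_coeff[OF w] by blast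
  let ?S = "{n. n < B \<and> q n \<notin> I}"
  have fin: "finite ?S" by (rule finite_subset[of _ "{..<B}"]) auto
  define m where "m = Max ?S"
  have "m \<in> ?S" unfolding m_def using Max_in[OF fin] \<open>n' < B\<close> \<open>q n' \<notin> I\<close> by blast
  then have m: "m < B" "q m \<notin> I" by auto
  have gt: "q n \<in> I" if "n < B" "n > m" for n
    using Max_ge[OF fin, of n] that unfolding m_def by fastforce
  have rest: "q n * X \<pi> n w i (m + d) \<in> I" if "n \<in> {..<B} - {m}" for n
  proof (cases "n > m")
    case True
    then show ?thesis using gt that ideal_mult_right[OF I] by auto
  next
    case False
    then have "w i (m + d - n) \<in> I" using that by (intro d(2)) auto
    then show ?thesis using False ideal_mult[OF I] by (auto simp: X_apply ideal_0[OF I])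
  qed
  have "(\<Sum>n<B. q n * X \<pi> n w i (m + d)) = q m * X \<pi> m w i (m + d) + (\<Sum>n\<in>{..<B} - {m}. q n * X \<pi> n w i (m + d))"
    using m by (intro sum.remove) auto
  then have "q m * X \<pi> m w i (m + d) = (\<Sum>n<B. q n * X \<pi> n w i (m + d)) - (\<Sum>n\<in>{..<B} - {m}. q n * X \<pi> n w i (m + d))"
    by simp
  also have "\<dots> \<in> I"
    using sum[of "m + d"] by (intro ideal_diff[OF I _ ideal_sum[OF I rest]]) (auto simp: sum_vec_apply vec_apply)
  finally have "q m * (cc \<pi> m d * w i d) \<in> I" by simp
  then show False using I_prime cc_notin m(2) d(1) by blast
qed

lemma dspan_single:
  assumes "u \<in> dspan \<pi> {w}"
  obtains B q where "u = (\<Sum>n<B. sm (q n) (X \<pi> n w))"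
proof -
  have "\<exists>q B. (\<forall>n\<ge>B. q n = 0) \<and> u = act \<pi> q w"
    using assms
  proof (induction rule: dspan_induct)
    case zero
    show "\<exists>q B. (\<forall>n\<ge>B. q n = 0) \<and> 0 = act \<pi> q w"
      by (rule exI[of _ "\<lambda>_. 0"]) (auto simp: act_apply fun_eq_iff vec_apply)
  next
    case (base m g)
    then have "g = w" by simp
    then have "act \<pi> (\<lambda>n. if n = m then 1 else 0) w = X \<pi> m g"
      by (subst act_finite[where B = "Suc m"]) (auto intro!: ext simp: vec_apply sum_vec_apply if_distrib
          if_distribR cong: if_cong)
    then show "\<exists>q B. (\<forall>n\<ge>B. q n = 0) \<and> X \<pi> m g = act \<pi> q w"
      by (intro exI[of _ "\<lambda>n. if n = m then 1 else 0"] exI[of _ "Suc m"]) auto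
  next
    case (add c a b)
    then obtain q1 B1 q2 B2 where q: "\<forall>n\<ge>B1. q1 n = 0" "a = act \<pi> q1 w" "\<forall>n\<ge>B2. q2 n = 0" "b = act \<pi> q2 w"
      by blast
    have "sm c a + b = act \<pi> (\<lambda>n. c * q1 n + q2 n) w"
      unfolding q by (auto simp: fun_eq_iff vec_apply act_apply sum.distrib sum_distrib_left algebra_simps)
    moreover have "\<forall>n\<ge>max B1 B2. c * q1 n + q2 n = 0" using q by simp
    ultimately show "\<exists>q B. (\<forall>n\<ge>B. q n = 0) \<and> sm c a + b = act \<pi> q w"
      by (intro exI[of _ "\<lambda>n. c * q1 n + q2 n"] exI[of _ "max B1 B2"] conjI)
  qed
  then obtain q B where "\<forall>n\<ge>B. q n = 0" "u = act \<pi> q w" by blast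
  then show ?thesis using that act_finite[of B q \<pi> w] by metis
qed

text \<open>Division with remainder by an element w0 whose row i has least degree modulo I. Leading
  coefficients are multiplied crosswise instead of being inverted, which produces \<beta>, and
  minimality forces row i of the remainder into I.\<close>

lemma pseudo_division:
  assumes N: "subm \<pi> N" "N \<subseteq> F r" and w1: "w1 \<in> N" "w1 i n1 \<notin> I"
  obtains w0 n0 where "w0 \<in> N" "w0 i n0 \<notin> I"
    "\<And>w. w \<in> N \<Longrightarrow> \<exists>\<beta> u. \<beta> \<notin> I \<and> u \<in> dspan \<pi> {w0} \<and> (\<forall>n. (sm \<beta> w - u) i n \<in> I)"
proof -
  let ?P = "\<lambda>d. \<exists>w\<in>N. w i d \<notin> I \<and> (\<forall>n>d. w i n \<in> I)"
  define d where "d = (LEAST d. ?P d)"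
  have "w1 \<in> F r" using w1 N by blast
  then obtain d1 where "w1 i d1 \<notin> I" "\<And>n. n > d1 \<Longrightarrow> w1 i n \<in> I" using top_coeff w1(2) by blast
  then have "?P d1" using w1(1) by blast
  then have "?P d" unfolding d_def by (rule LeastI)
  then obtain w0 where w0: "w0 \<in> N" "w0 i d \<notin> I" "\<And>n. n > d \<Longrightarrow> w0 i n \<in> I" by blast
  have least: "d \<le> b" if "?P b" for b unfolding d_def using that by (rule Least_le)
  have main: "\<exists>\<beta> u. \<beta> \<notin> I \<and> u \<in> dspan \<pi> {w0} \<and> (\<forall>n. (sm \<beta> w - u) i n \<in> I)"
    if "w \<in> N" "\<And>n. n \<ge> b \<Longrightarrow> w i n \<in> I" for w b
    using that
  proof (induction b arbitrary: w)
    case 0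
    then show ?case
      using I_one subm_0[OF subm_dspan] by - (rule exI[of _ 1], rule exI[of _ 0], auto)
  next
    case (Suc b)
    show ?case
    proof (cases "w i b \<in> I")
      case True
      then have "w i n \<in> I" if "n \<ge> b" for n using Suc.prems(2)[of n] that by (cases "n = b") auto
      then show ?thesis using Suc.IH[of w] Suc.prems(1) by blast
    next
      case False
      then have "?P b" using Suc.prems by (intro bexI[of _ w]) auto
      then obtain e where e: "b = e + d" using least[of b] by (metis le_add_diff_inverse2)
      define \<gamma> where "\<gamma> = w0 i d * cc \<pi> e d"
      have \<gamma>: "\<gamma> \<notin> I" unfolding \<gamma>_def using I_prime w0(2) cc_notin by blast
      define w' where "w' = sm \<gamma> w - sm (w i b) (X \<pi> e w0)"
      have w': "w' \<in> N"
        unfolding w'_def by (intro subm_diff[OF N(1)] subm_sm[OF N(1)] subm_X[OF N(1)] Suc.prems w0)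
      have "w' i n \<in> I" if "n \<ge> b" for n
      proof (cases "n = b")
        case True
        have "w' i n = 0" unfolding True w'_def \<gamma>_def by (simp add: vec_apply e mult_ac)
        then show ?thesis by (simp add: ideal_0[OF I])
      next
        case False
        then have "w0 i (n - e) \<in> I" "w i n \<in> I" using that e by (auto intro: w0(3) Suc.prems(2))
        then show ?thesis
          by (auto simp: w'_def vec_apply X_apply ideal_0[OF I] intro!: ideal_diff[OF I] ideal_mult[OF I])
      qed
      then obtain \<beta> u where *: "\<beta> \<notin> I" "u \<in> dspan \<pi> {w0}" "\<And>n. (sm \<beta> w' - u) i n \<in> I"
        using Suc.IH[OF w'] by blast
      have "sm (\<beta> * \<gamma>) w - (u + sm (\<beta> * w i b) (X \<pi> e w0)) = sm \<beta> w' - u"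
        by (simp add: w'_def V.scale_right_diff_distrib)
      moreover have "u + sm (\<beta> * w i b) (X \<pi> e w0) \<in> dspan \<pi> {w0}"
        by (intro subm_add[OF subm_dspan] subm_sm[OF subm_dspan] dspan_base *(2)) simp
      moreover have "\<beta> * \<gamma> \<notin> I" using I_prime *(1) \<gamma> by blast
      ultimately show ?thesis using *(3) by metis
    qed
  qed
  have "\<exists>\<beta> u. \<beta> \<notin> I \<and> u \<in> dspan \<pi> {w0} \<and> (\<forall>n. (sm \<beta> w - u) i n \<in> I)" if "w \<in> N" for w
  proof -
    have "w \<in> F r" using that N(2) by blast
    then obtain B where "\<And>i n. n \<ge> B \<Longrightarrow> w i n = 0" using F_bound by metis
    then show ?thesis using main[OF that, of B] ideal_0[OF I] by simp
  qed
  then show ?thesis using that w0 by blast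
qed

definition row :: "nat \<Rightarrow> 'k vec \<Rightarrow> 'k vec" where
  "row i v = (\<lambda>i' n. if i' = i then v i n else 0)"

lemma lin_row: "i < r \<Longrightarrow> lin \<pi> r r (row i)"
  unfolding lin_def
proof (intro conjI ballI allI)
  fix c :: "'k vec" assume c: "c \<in> F r" and i: "i < r"
  obtain B where "\<And>i n. n \<ge> B \<Longrightarrow> c i n = 0" using F_bound[OF c] by blast
  then show "row i c \<in> F r" using i by (intro FI[where B = B]) (auto simp: row_def)
qed (auto simp: row_def fun_eq_iff vec_apply X_apply)

lemma inI_row: "inI I (row i v) \<longleftrightarrow> (\<forall>n. v i n \<in> I)"
  using ideal_0[OF I] by (auto simp: inI_def row_def)

text \<open>Up to scalars, row i of the image of L is a cyclic module generated by row i of w0 = L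
  c0. The map \<Psi> sends c to the multiple of c0 for which row i of L (\<Psi> c) and of \<alpha> L
  c agree modulo I, and \<Phi> is \<alpha> minus \<Psi>. Where row i of L c already vanishes, this
  multiple is 0 modulo I by \<open>independent\<close>.\<close>

lemma row_projector:
  assumes L: "lin \<pi> s r L" and i: "i < r"
  obtains \<alpha> \<Phi> where "\<alpha> \<notin> I" "lin \<pi> s s \<Phi>" "\<And>c. c \<in> F s \<Longrightarrow> inI I (row i (L (\<Phi> c)))"
    "\<And>c. c \<in> F s \<Longrightarrow> inI I (row i (L c)) \<Longrightarrow> inI I (\<Phi> c - sm \<alpha> c)"
proof (cases "\<forall>c\<in>F s. inI I (row i (L c))")
  case True
  show ?thesis
    by (rule that[of 1 "\<lambda>c. c"]) (use True I_one inI_0[OF I] in \<open>auto simp: lin_id\<close>)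
next
  case False
  then obtain c1 n1 where c1: "c1 \<in> F s" "L c1 i n1 \<notin> I" by (auto simp: inI_row)
  have img: "L ` F s = dspan \<pi> (L ` ebas ` {..<s})"
    by (subst F_eq_dspan[of _ \<pi>], rule lin_image_dspan[OF L]) (auto intro: ebas_F)
  have "subm \<pi> (L ` F s)" unfolding img by (rule subm_dspan)
  moreover have "L ` F s \<subseteq> F r" using lin_F[OF L] by blast
  ultimately obtain w0 n0 where w0: "w0 \<in> L ` F s" "w0 i n0 \<notin> I"
    "\<And>w. w \<in> L ` F s \<Longrightarrow> \<exists>\<beta> u. \<beta> \<notin> I \<and> u \<in> dspan \<pi> {w0} \<and> (\<forall>n. (sm \<beta> w - u) i n \<in> I)"
    using pseudo_division[of "L ` F s" r "L c1" i n1] c1 by blast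
  obtain c0 where c0: "c0 \<in> F s" "w0 = L c0" using w0(1) by blast
  have c0F: "dspan \<pi> {c0} \<subseteq> F s" by (rule dspan_least[OF subm_F]) (use c0 in simp)
  have lc0: "L ` dspan \<pi> {c0} = dspan \<pi> {w0}" using lin_image_dspan[OF L, of "{c0}"] c0 by simp
  have "\<exists>\<beta> u. \<beta> \<notin> I \<and> u \<in> dspan \<pi> {c0} \<and> (\<forall>n. (sm \<beta> (L (ebas j)) - L u) i n \<in> I)" if "j < s" for j
  proof -
    have "L (ebas j) \<in> L ` F s" using ebas_F[OF that] by blast
    from w0(3)[OF this] show ?thesis unfolding lc0[symmetric] by blast
  qed
  then obtain \<beta> u where bu: "\<And>j. j < s \<Longrightarrow> \<beta> j \<notin> I" "\<And>j. j < s \<Longrightarrow> u j \<in> dspan \<pi> {c0}"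
    "\<And>j n. j < s \<Longrightarrow> (sm (\<beta> j) (L (ebas j)) - L (u j)) i n \<in> I"
    by metis
  \<comment> \<open>A common denominator for all basis vectors; \<rho> j stands for the quotient of
    \<alpha> by \<beta> j.\<close>
  define \<alpha> where "\<alpha> = (\<Prod>j<s. \<beta> j)"
  define \<rho> where "\<rho> j = (\<Prod>k\<in>{..<s} - {j}. \<beta> k)" for j
  have \<alpha>: "\<alpha> \<notin> I" unfolding \<alpha>_def using bu(1) by (intro prod_notin) auto
  have \<rho>: "\<alpha> = \<rho> j * \<beta> j" if "j < s" for j
    unfolding \<alpha>_def \<rho>_def using that by (subst prod.remove[of _ j]) (auto simp: mult.commute)
  have uF: "u j \<in> F s" if "j < s" for j using bu(2)[OF that] c0F by blast
  have "sm (\<rho> j) (u j) \<in> F s" if "j < s" for j using uF[OF that] by (rule F_sm)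
  then obtain \<Psi> where \<Psi>: "lin \<pi> s s \<Psi>" "\<And>j. j < s \<Longrightarrow> \<Psi> (ebas j) = sm (\<rho> j) (u j)"
    "\<Psi> ` F s = dspan \<pi> ((\<lambda>j. sm (\<rho> j) (u j)) ` {..<s})"
    using ex_lin[of s "\<lambda>j. sm (\<rho> j) (u j)" s \<pi>] by blast
  define \<Phi> where "\<Phi> c = sm \<alpha> c - \<Psi> c" for c
  have \<Phi>: "lin \<pi> s s \<Phi>" unfolding \<Phi>_def by (intro lin_minus lin_scale lin_id \<Psi>)
  have rL: "lin \<pi> s r (\<lambda>c. row i (L (\<Phi> c)))" by (intro lin_comp[OF lin_row[OF i] lin_comp[OF L \<Phi>]])
  have 1: "inI I (row i (L (\<Phi> c)))" if "c \<in> F s" for c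
  proof (rule lin_inI_ebas[OF I rL _ that])
    fix j assume j: "j < s"
    have "L (\<Phi> (ebas j)) = sm (\<rho> j) (sm (\<beta> j) (L (ebas j)) - L (u j))"
      unfolding \<Phi>_def \<Psi>(2)[OF j] \<rho>[OF j]
      by (simp add: lin_diff[OF L] lin_sm[OF L] F_sm ebas_F j uF V.scale_right_diff_distrib)
    then show "inI I (row i (L (\<Phi> (ebas j))))"
      using bu(3)[OF j] ideal_mult[OF I] by (simp add: inI_row sm_apply)
  qed
  have 2: "inI I (\<Phi> c - sm \<alpha> c)" if c: "c \<in> F s" "inI I (row i (L c))" for c
  proof -
    have "\<Psi> c \<in> dspan \<pi> ((\<lambda>j. sm (\<rho> j) (u j)) ` {..<s})" using \<Psi>(3) c(1) by blast
    moreover have "dspan \<pi> ((\<lambda>j. sm (\<rho> j) (u j)) ` {..<s}) \<subseteq> dspan \<pi> {c0}"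
      by (rule dspan_least[OF subm_dspan]) (auto intro: subm_sm[OF subm_dspan] bu(2))
    ultimately have "\<Psi> c \<in> dspan \<pi> {c0}" by blast
    then obtain B q where q: "\<Psi> c = (\<Sum>n<B. sm (q n) (X \<pi> n c0))" using dspan_single by metis
    have "L (\<Psi> c) = (\<Sum>n<B. sm (q n) (X \<pi> n (L c0)))"
      unfolding q by (subst lin_sum[OF L]) (auto simp: c0 lin_sm[OF L] lin_X[OF L] F_sm F_X)
    moreover have "L (\<Psi> c) i m \<in> I" for m
    proof -
      have "L (\<Phi> c) = sm \<alpha> (L c) - L (\<Psi> c)"
        unfolding \<Phi>_def using c(1) lin_F[OF \<Psi>(1)] by (simp add: lin_diff[OF L] lin_sm[OF L] F_sm)
      then have "L (\<Psi> c) i m = \<alpha> * L c i m - L (\<Phi> c) i m" by (simp add: vec_apply)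
      also have "\<dots> \<in> I" using 1[OF c(1)] c(2) by (intro ideal_diff[OF I] ideal_mult[OF I]) (auto simp: inI_row)
      finally show ?thesis .
    qed
    ultimately have "q n \<in> I" if "n < B" for n
      using independent[where w = "L c0" and r = r and i = i and n = n0 and B = B and q = q] w0(2) c0 lin_F[OF L c0(1)] that by simp
    then have "inI I (\<Psi> c)" unfolding q by (intro inI_sum[OF I] inI_sm_ideal[OF I]) auto
    then have "inI I (0 - \<Psi> c)" by (rule inI_diff[OF I inI_0[OF I]])
    moreover have "\<Phi> c - sm \<alpha> c = 0 - \<Psi> c" by (simp add: \<Phi>_def)
    ultimately show ?thesis by simp
  qed
  show ?thesis using that \<alpha> \<Phi> 1 2 by blast
qed

text \<open>Modulo I and up to scalars outside I the algebra is a polynomial ring in one variable over a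
  field, so kernels of linear maps are direct summands.\<close>

lemma kernel_projector:
  assumes L: "lin \<pi> s r L"
  obtains \<alpha> \<Phi> where "\<alpha> \<notin> I" "lin \<pi> s s \<Phi>" "\<And>c. c \<in> F s \<Longrightarrow> inI I (L (\<Phi> c))"
    "\<And>c. c \<in> F s \<Longrightarrow> inI I (L c) \<Longrightarrow> inI I (\<Phi> c - sm \<alpha> c)"
proof -
  have "\<exists>\<alpha> \<Phi>. \<alpha> \<notin> I \<and> lin \<pi> s s \<Phi> \<and> (\<forall>c\<in>F s. \<forall>i<\<rho>. inI I (row i (L (\<Phi> c)))) \<and>
      (\<forall>c\<in>F s. (\<forall>i<\<rho>. inI I (row i (L c))) \<longrightarrow> inI I (\<Phi> c - sm \<alpha> c))" if "\<rho> \<le> r" for \<rho>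
    using that
  proof (induction \<rho>)
    case 0
    show ?case by (rule exI[of _ 1], rule exI[of _ "\<lambda>c. c"]) (auto simp: I_one lin_id inI_0[OF I])
  next
    case (Suc \<rho>)
    then obtain \<alpha> \<Phi> where \<Phi>: "\<alpha> \<notin> I" "lin \<pi> s s \<Phi>" "\<And>c i. c \<in> F s \<Longrightarrow> i < \<rho> \<Longrightarrow> inI I (row i (L (\<Phi> c)))"
      "\<And>c. c \<in> F s \<Longrightarrow> (\<forall>i<\<rho>. inI I (row i (L c))) \<Longrightarrow> inI I (\<Phi> c - sm \<alpha> c)"
      by (metis Suc_leD)
    have L\<Phi>: "lin \<pi> s r (\<lambda>c. L (\<Phi> c))" by (rule lin_comp[OF L \<Phi>(2)])
    have \<rho>r: "\<rho> < r" using Suc.prems by simp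
    \<comment> \<open>The next row is treated for L \<circ> \<Phi> rather than for L, so that \<Phi>
      \<circ> \<Phi>' keeps the rows that \<Phi> has already killed.\<close>
    obtain \<beta> \<Phi>' where \<Phi>': "\<beta> \<notin> I" "lin \<pi> s s \<Phi>'" "\<And>c. c \<in> F s \<Longrightarrow> inI I (row \<rho> (L (\<Phi> (\<Phi>' c))))"
      "\<And>c. c \<in> F s \<Longrightarrow> inI I (row \<rho> (L (\<Phi> c))) \<Longrightarrow> inI I (\<Phi>' c - sm \<beta> c)"
      using row_projector[OF L\<Phi> \<rho>r] by blast
    have lc: "lin \<pi> s s (\<lambda>c. \<Phi> (\<Phi>' c))" by (rule lin_comp[OF \<Phi>(2) \<Phi>'(2)])
    have "inI I (row i (L (\<Phi> (\<Phi>' c))))" if "c \<in> F s" "i < Suc \<rho>" for c i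
      using that \<Phi>(3)[OF lin_F[OF \<Phi>'(2)]] \<Phi>'(3) by (cases "i = \<rho>") auto
    moreover have "inI I (\<Phi> (\<Phi>' c) - sm (\<alpha> * \<beta>) c)" if c: "c \<in> F s" and h: "\<forall>i<Suc \<rho>. inI I (row i (L c))" for c
    proof -
      have 1: "inI I (\<Phi> c - sm \<alpha> c)" using \<Phi>(4)[OF c] h by simp
      have "inI I (L (\<Phi> c - sm \<alpha> c))" by (rule lin_inI[OF I L _ 1]) (intro F_diff F_sm lin_F[OF \<Phi>(2)] c)
      then have L\<Phi>c: "inI I (L (\<Phi> c) - sm \<alpha> (L c))" using c lin_F[OF \<Phi>(2)] by (simp add: lin_diff[OF L] lin_sm[OF L] F_sm)
      have "L (\<Phi> c) \<rho> n \<in> I" for n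
      proof -
        have "(L (\<Phi> c) - sm \<alpha> (L c)) \<rho> n + \<alpha> * L c \<rho> n \<in> I"
          using L\<Phi>c h
          by (intro ideal_add[OF I] ideal_mult[OF I]) (auto simp: inI_row inI_def[of I "_ - _"])
        then show ?thesis by (simp add: vec_apply)
      qed
      then have 2: "inI I (\<Phi>' c - sm \<beta> c)" using \<Phi>'(4)[OF c] by (simp add: inI_row)
      have "inI I (\<Phi> (\<Phi>' c - sm \<beta> c))" by (rule lin_inI[OF I \<Phi>(2) _ 2]) (intro F_diff F_sm lin_F[OF \<Phi>'(2)] c)
      then have "inI I (\<Phi> (\<Phi>' c) - sm \<beta> (\<Phi> c))"
        using c lin_F[OF \<Phi>'(2)] by (simp add: lin_diff[OF \<Phi>(2)] lin_sm[OF \<Phi>(2)] F_sm)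
      moreover have "inI I (sm \<beta> (\<Phi> c) - sm (\<alpha> * \<beta>) c)"
        using inI_sm[OF I 1, of \<beta>] by (simp add: V.scale_right_diff_distrib mult.commute)
      ultimately show ?thesis by (rule inI_diff_trans[OF I])
    qed
    moreover have "\<alpha> * \<beta> \<notin> I" using I_prime \<Phi>(1) \<Phi>'(1) by blast
    ultimately show ?case using lc by blast
  qed
  from this[of r] obtain \<alpha> \<Phi> where *: "\<alpha> \<notin> I" "lin \<pi> s s \<Phi>" "\<And>c i. c \<in> F s \<Longrightarrow> i < r \<Longrightarrow> inI I (row i (L (\<Phi> c)))"
      "\<And>c. c \<in> F s \<Longrightarrow> (\<forall>i<r. inI I (row i (L c))) \<Longrightarrow> inI I (\<Phi> c - sm \<alpha> c)" by blast
  have rows: "(\<forall>i<r. inI I (row i v)) \<longleftrightarrow> inI I v" if "v \<in> F r" for v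
  proof
    assume *: "\<forall>i<r. inI I (row i v)"
    show "inI I v"
      unfolding inI_def
    proof (intro allI)
      fix i n
      show "v i n \<in> I" using * F_out[OF that, of i n] ideal_0[OF I] by (cases "i < r") (auto simp: inI_row)
    qed
  qed (simp add: inI_row, simp add: inI_def)
  show ?thesis
    by (rule that[OF *(1,2)]) (use * rows lin_F[OF L] lin_F[OF *(2)] in blast)+
qed

text \<open>On the kernel \<Phi> is multiplication by \<alpha>, so the kernel arises by taking the
  values of \<Phi> that are divisible by \<alpha> modulo I and dividing them by \<alpha>. The
  arguments with such values form a kernel modulo I + (\<alpha>), which is finitely generated by
  hypothesis.\<close>

lemma Coh_regular:
  assumes noeth: "noetherian TYPE('k)" and C: "\<And>\<alpha>. \<alpha> \<notin> I \<Longrightarrow> Coh \<pi> (add_principal I \<alpha>)"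
  shows "Coh \<pi> I"
  unfolding Coh_def
proof (intro allI impI)
  fix s r L assume L: "lin \<pi> s r L"
  obtain \<alpha> \<Phi> where \<Phi>: "\<alpha> \<notin> I" "lin \<pi> s s \<Phi>" "\<And>c. c \<in> F s \<Longrightarrow> inI I (L (\<Phi> c))"
    "\<And>c. c \<in> F s \<Longrightarrow> inI I (L c) \<Longrightarrow> inI I (\<Phi> c - sm \<alpha> c)"
    using kernel_projector[OF L] by blast
  obtain t \<theta> L' where \<theta>: "lin \<pi> t s \<theta>" "\<theta> ` F t = kerI (add_principal I \<alpha>) s \<Phi>" and L': "lin \<pi> t s L'"
    and d: "\<And>d. d \<in> F t \<Longrightarrow> inI I (\<Phi> (\<theta> d) - sm \<alpha> (L' d))"
    using kerI_add_principal[OF I C[OF \<Phi>(1)] \<Phi>(2)] by metis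
  have L'F: "fg \<pi> s (L' ` F t)"
    by (rule fg_image[OF L'], subst F_eq_dspan[of _ \<pi>], rule fg_dspan) (auto intro: ebas_F)
  have "kerI I s L \<subseteq> msum (L' ` F t) (IF I s)"
  proof
    fix c assume c: "c \<in> kerI I s L"
    then have cF: "c \<in> F s" and 1: "inI I (\<Phi> c - sm \<alpha> c)" using \<Phi>(4) by (auto simp: kerI_def)
    have "inI (add_principal I \<alpha>) (\<Phi> c)"
      unfolding inI_def
    proof (intro allI)
      fix i n
      have "\<Phi> c i n = (\<Phi> c - sm \<alpha> c) i n + \<alpha> * c i n" by (simp add: vec_apply)
      moreover have "(\<Phi> c - sm \<alpha> c) i n \<in> I" using 1 by (simp add: inI_def)
      ultimately show "\<Phi> c i n \<in> add_principal I \<alpha>" unfolding add_principal_def by blast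
    qed
    then obtain e where e: "e \<in> F t" "c = \<theta> e" using \<theta>(2) cF by (auto simp: kerI_def)
    have "inI I ((\<Phi> c - sm \<alpha> (L' e)) - (\<Phi> c - sm \<alpha> c))"
      using inI_diff[OF I d[OF e(1)] 1] by (simp add: e(2))
    then have "inI I (sm \<alpha> (c - L' e))" by (simp add: V.scale_right_diff_distrib)
    then have "inI I (c - L' e)" by (rule inI_cancel[OF \<Phi>(1)])
    then have "c - L' e \<in> IF I s" using cF lin_F[OF L' e(1)] by (simp add: IF_def F_diff)
    then have "L' e + (c - L' e) \<in> msum (L' ` F t) (IF I s)" unfolding msum_def using e(1) by blast
    then show "c \<in> msum (L' ` F t) (IF I s)" by simp
  qed
  moreover have "msum (L' ` F t) (IF I s) \<subseteq> kerI I s L"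
  proof -
    have "L' e \<in> kerI I s L" if e: "e \<in> F t" for e
    proof -
      have eF: "\<theta> e \<in> F s" "\<Phi> (\<theta> e) \<in> F s" "L' e \<in> F s" using lin_F[OF \<theta>(1) e] lin_F[OF \<Phi>(2)] lin_F[OF L' e] by auto
      have "inI I (L (\<Phi> (\<theta> e) - sm \<alpha> (L' e)))"
        by (rule lin_inI[OF I L _ d[OF e]]) (intro F_diff F_sm eF)
      then have "inI I (L (\<Phi> (\<theta> e)) - sm \<alpha> (L (L' e)))"
        using eF by (simp add: lin_diff[OF L] lin_sm[OF L] F_sm)
      from inI_diff[OF I \<Phi>(3)[OF eF(1)] this] have "inI I (sm \<alpha> (L (L' e)))" by simp
      then show ?thesis using inI_cancel[OF \<Phi>(1)] eF by (simp add: kerI_def)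
    qed
    then show ?thesis
      using IF_subset_kerI[OF I L] subm_add[OF subm_kerI[OF I L]] by (auto simp: msum_def)
  qed
  ultimately have "kerI I s L = msum (L' ` F t) (IF I s)" by blast
  then show "fg \<pi> s (kerI I s L)" using fg_msum[OF L'F fg_IF[OF noeth I]] by simp
qed

section \<open>Finite generation and torsion over the fraction field\<close>

lemma fg_up_to_scalars:
  assumes N: "subm \<pi> N" "N \<subseteq> F r"
  obtains W where "finite W" "W \<subseteq> N" "\<And>w. w \<in> N \<Longrightarrow> \<exists>\<beta> u. \<beta> \<notin> I \<and> u \<in> dspan \<pi> W \<and> inI I (sm \<beta> w - u)"
proof -
  \<comment> \<open>The usual induction for submodules of free modules over a principal ideal
    domain: \<rho> bounds the rows that are nonzero modulo I, and the step passes to the submodule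
    N' where row \<rho> vanishes modulo I.\<close>
  have "\<exists>W. finite W \<and> W \<subseteq> N \<and> (\<forall>w\<in>N. \<exists>\<beta> u. \<beta> \<notin> I \<and> u \<in> dspan \<pi> W \<and> inI I (sm \<beta> w - u))"
    if "subm \<pi> N" "N \<subseteq> F r" "\<And>w i n. w \<in> N \<Longrightarrow> i \<ge> \<rho> \<Longrightarrow> w i n \<in> I" for \<rho> N
    using that
  proof (induction \<rho> arbitrary: N)
    case 0
    have "\<exists>\<beta> u. \<beta> \<notin> I \<and> u \<in> dspan \<pi> {} \<and> inI I (sm \<beta> w - u)" if "w \<in> N" for w
      using 0(3)[OF that] I_one subm_0[OF subm_dspan] by - (rule exI[of _ 1], rule exI[of _ 0], auto simp: inI_def)
    then show ?case by (intro exI[of _ "{}"]) auto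
  next
    case (Suc \<rho>)
    define N' where "N' = {w \<in> N. \<forall>n. w \<rho> n \<in> I}"
    have N': "subm \<pi> N'"
      using Suc.prems(1)
      by (intro submI) (auto simp: N'_def subm_0 subm_add subm_sm subm_X vec_apply X_apply
          ideal_0[OF I] ideal_add[OF I] ideal_mult[OF I])
    have "w i n \<in> I" if "w \<in> N'" "i \<ge> \<rho>" for w i n
      using that Suc.prems(3)[of w i n] by (cases "i = \<rho>") (auto simp: N'_def)
    moreover have "N' \<subseteq> F r" using Suc.prems(2) by (auto simp: N'_def)
    ultimately have "\<exists>W. finite W \<and> W \<subseteq> N' \<and>
        (\<forall>w\<in>N'. \<exists>\<beta> u. \<beta> \<notin> I \<and> u \<in> dspan \<pi> W \<and> inI I (sm \<beta> w - u))"
      by (intro Suc.IH[OF N'])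
    then obtain W where W: "finite W" "W \<subseteq> N'" "\<And>w. w \<in> N' \<Longrightarrow> \<exists>\<beta> u. \<beta> \<notin> I \<and> u \<in> dspan \<pi> W \<and> inI I (sm \<beta> w - u)"
      by blast
    show ?case
    proof (cases "\<forall>w\<in>N. \<forall>n. w \<rho> n \<in> I")
      case True
      then have "N' = N" by (auto simp: N'_def)
      then show ?thesis using W by blast
    next
      case False
      then obtain w1 n1 where w1: "w1 \<in> N" "w1 \<rho> n1 \<notin> I" by blast
      obtain w0 n0 where w0: "w0 \<in> N" "w0 \<rho> n0 \<notin> I"
        "\<And>w. w \<in> N \<Longrightarrow> \<exists>\<beta> u. \<beta> \<notin> I \<and> u \<in> dspan \<pi> {w0} \<and> (\<forall>n. (sm \<beta> w - u) \<rho> n \<in> I)"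
        using pseudo_division[OF Suc.prems(1,2) w1] by blast
      have "\<exists>\<beta> u. \<beta> \<notin> I \<and> u \<in> dspan \<pi> (insert w0 W) \<and> inI I (sm \<beta> w - u)" if w: "w \<in> N" for w
      proof -
        obtain \<beta> u where 1: "\<beta> \<notin> I" "u \<in> dspan \<pi> {w0}" "\<And>n. (sm \<beta> w - u) \<rho> n \<in> I" using w0(3)[OF w] by blast
        have "u \<in> N" using 1(2) dspan_least[OF Suc.prems(1), of "{w0}"] w0(1) by blast
        then have "sm \<beta> w - u \<in> N'"
          using 1(3) w by (auto simp: N'_def intro!: subm_diff[OF Suc.prems(1)] subm_sm[OF Suc.prems(1)])
        then obtain \<gamma> u' where 2: "\<gamma> \<notin> I" "u' \<in> dspan \<pi> W" "inI I (sm \<gamma> (sm \<beta> w - u) - u')" using W(3) by blast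
        have "sm \<gamma> u + u' \<in> dspan \<pi> (insert w0 W)"
          using 1(2) 2(2) dspan_mono[of "{w0}" "insert w0 W" \<pi>] dspan_mono[of W "insert w0 W" \<pi>]
          by (intro subm_add[OF subm_dspan] subm_sm[OF subm_dspan]) auto
        moreover have "inI I (sm (\<gamma> * \<beta>) w - (sm \<gamma> u + u'))"
          using 2(3) by (simp add: V.scale_right_diff_distrib diff_diff_add)
        moreover have "\<gamma> * \<beta> \<notin> I" using I_prime 1(1) 2(1) by blast
        ultimately show ?thesis by blast
      qed
      moreover have "insert w0 W \<subseteq> N" using W(2) w0(1) by (auto simp: N'_def)
      ultimately show ?thesis using W(1) by (intro exI[of _ "insert w0 W"]) auto
    qed
  qed
  moreover have "w i n \<in> I" if "w \<in> N" "i \<ge> r" for w i n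
    using that N(2) F_out[of w r i n] ideal_0[OF I] by auto
  ultimately obtain W where "finite W" "W \<subseteq> N"
    "\<forall>w\<in>N. \<exists>\<beta> u. \<beta> \<notin> I \<and> u \<in> dspan \<pi> W \<and> inI I (sm \<beta> w - u)"
    using N by metis
  then show ?thesis using that by blast
qed

lemma X_raise:
  assumes Z: "subm \<pi> Z" and "\<alpha> \<notin> I" "sm \<alpha> (X \<pi> j w) \<in> Z" "j \<le> j'"
  obtains \<alpha>' where "\<alpha>' \<notin> I" "sm \<alpha>' (X \<pi> j' w) \<in> Z"
proof -
  obtain e where e: "j' = e + j" using assms(4) by (metis le_add_diff_inverse2)
  have "X \<pi> e (sm \<alpha> (X \<pi> j w)) \<in> Z" by (rule subm_X[OF Z assms(3)])
  then have "sm (\<alpha> * cc \<pi> e j) (X \<pi> j' w) \<in> Z" by (simp add: X_sm X_X e)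
  moreover have "\<alpha> * cc \<pi> e j \<notin> I" using I_prime cc_notin assms(2) by blast
  ultimately show ?thesis using that by blast
qed

text \<open>The vectors w with x^[j] w in Z up to a scalar outside I form a submodule that grows
  with j. Over the fraction field the union over all j is finitely generated, so it is reached at
  some j0.\<close>

lemma uniform_exponent:
  assumes Z: "subm \<pi> Z" "IF I r \<subseteq> Z"
  obtains j0 where "\<And>w j \<alpha>. w \<in> F r \<Longrightarrow> \<alpha> \<notin> I \<Longrightarrow> sm \<alpha> (X \<pi> j w) \<in> Z \<Longrightarrow>
    \<exists>\<beta>. \<beta> \<notin> I \<and> sm \<beta> (X \<pi> j0 w) \<in> Z"
proof -
  define T where "T j = {w \<in> F r. \<exists>\<alpha>. \<alpha> \<notin> I \<and> sm \<alpha> (X \<pi> j w) \<in> Z}" for j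
  have T: "subm \<pi> (T j)" for j
  proof (rule submI)
    show "0 \<in> T j" using I_one subm_0[OF Z(1)] by (auto simp: T_def F_0 V.scale_zero_right intro!: exI[of _ 1])
  next
    fix a b assume "a \<in> T j" "b \<in> T j"
    then obtain \<alpha> \<beta> where *: "a \<in> F r" "b \<in> F r" "\<alpha> \<notin> I" "\<beta> \<notin> I" "sm \<alpha> (X \<pi> j a) \<in> Z" "sm \<beta> (X \<pi> j b) \<in> Z"
      by (auto simp: T_def)
    have "sm \<beta> (sm \<alpha> (X \<pi> j a)) + sm \<alpha> (sm \<beta> (X \<pi> j b)) \<in> Z"
      by (intro subm_add[OF Z(1)] subm_sm[OF Z(1), OF *(5)] subm_sm[OF Z(1), OF *(6)])
    then have "sm (\<alpha> * \<beta>) (X \<pi> j (a + b)) \<in> Z" by (simp add: X_add V.scale_right_distrib mult.commute)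
    moreover have "\<alpha> * \<beta> \<notin> I" using I_prime * by blast
    ultimately show "a + b \<in> T j" using * by (auto simp: T_def F_add)
  next
    fix c a assume "a \<in> T j"
    then obtain \<alpha> where *: "a \<in> F r" "\<alpha> \<notin> I" "sm \<alpha> (X \<pi> j a) \<in> Z" by (auto simp: T_def)
    have "sm \<alpha> (X \<pi> j (sm c a)) \<in> Z" using subm_sm[OF Z(1) *(3), of c] by (simp add: X_sm mult.commute)
    then show "sm c a \<in> T j" using * by (auto simp: T_def F_sm)
  next
    fix n a assume "a \<in> T j"
    then obtain \<alpha> where *: "a \<in> F r" "\<alpha> \<notin> I" "sm \<alpha> (X \<pi> j a) \<in> Z" by (auto simp: T_def)
    have "sm \<alpha> (X \<pi> j (X \<pi> n a)) \<in> Z" using subm_X[OF Z(1) *(3), of n] by (simp add: X_sm X_commute[of \<pi> n])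
    then show "X \<pi> n a \<in> T j" using * by (auto simp: T_def F_X)
  qed
  have mono: "T j \<subseteq> T j'" if "j \<le> j'" for j j'
    unfolding T_def using X_raise[OF Z(1) _ _ that] by blast
  have "subm \<pi> (\<Union>j. T j)"
  proof (rule submI)
    show "0 \<in> (\<Union>j. T j)" using subm_0[OF T] by blast
    show "a + b \<in> (\<Union>j. T j)" if "a \<in> (\<Union>j. T j)" "b \<in> (\<Union>j. T j)" for a b
    proof -
      from that obtain j k where "a \<in> T j" "b \<in> T k" by blast
      then have "a \<in> T (max j k)" "b \<in> T (max j k)" using mono[of j "max j k"] mono[of k "max j k"] by auto
      then show ?thesis using subm_add[OF T] by blast
    qed
    show "sm c a \<in> (\<Union>j. T j)" if "a \<in> (\<Union>j. T j)" for c a using that subm_sm[OF T] by blast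
    show "X \<pi> n a \<in> (\<Union>j. T j)" if "a \<in> (\<Union>j. T j)" for n a using that subm_X[OF T] by blast
  qed
  moreover have "(\<Union>j. T j) \<subseteq> F r" by (auto simp: T_def)
  ultimately obtain W where W: "finite W" "W \<subseteq> (\<Union>j. T j)"
    "\<And>w. w \<in> (\<Union>j. T j) \<Longrightarrow> \<exists>\<beta> u. \<beta> \<notin> I \<and> u \<in> dspan \<pi> W \<and> inI I (sm \<beta> w - u)"
    using fg_up_to_scalars by metis
  have "\<exists>j. W \<subseteq> T j"
    using W(1,2)
  proof (induction W)
    case (insert w W)
    then obtain j k where "W \<subseteq> T j" "w \<in> T k" by blast
    then have "insert w W \<subseteq> T (max j k)" using mono[of j "max j k"] mono[of k "max j k"] by auto
    then show ?case by blast
  qed auto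
  then obtain j0 where j0: "W \<subseteq> T j0" by blast
  show ?thesis
  proof (rule that[of j0])
    fix w j \<alpha> assume w: "w \<in> F r" and "\<alpha> \<notin> I" "sm \<alpha> (X \<pi> j w) \<in> Z"
    then have "w \<in> (\<Union>j. T j)" by (auto simp: T_def)
    then obtain \<beta> u where bu: "\<beta> \<notin> I" "u \<in> dspan \<pi> W" "inI I (sm \<beta> w - u)" using W(3) by blast
    have "u \<in> T j0" using bu(2) dspan_least[OF T j0] by blast
    then obtain \<gamma> where \<gamma>: "\<gamma> \<notin> I" "sm \<gamma> (X \<pi> j0 u) \<in> Z" "u \<in> F r" by (auto simp: T_def)
    have "sm \<gamma> (X \<pi> j0 (sm \<beta> w - u)) \<in> IF I r"
      using bu(3) w \<gamma>(3) by (auto simp: IF_def intro!: F_sm F_X F_diff inI_sm[OF I] inI_X[OF I])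
    then have "sm \<gamma> (X \<pi> j0 (sm \<beta> w - u)) \<in> Z" using Z(2) by blast
    from subm_add[OF Z(1) this \<gamma>(2)] have "sm (\<gamma> * \<beta>) (X \<pi> j0 w) \<in> Z"
      by (simp add: X_diff X_sm V.scale_right_diff_distrib)
    moreover have "\<gamma> * \<beta> \<notin> I" using I_prime \<gamma>(1) bu(1) by blast
    ultimately show "\<exists>\<beta>. \<beta> \<notin> I \<and> sm \<beta> (X \<pi> j0 w) \<in> Z" by blast
  qed
qed

text \<open>Division by x^[j] divides the coefficient in degree j + m by
  \<open>cc \<pi> j m\<close>; the scalar \<gamma> clears these denominators for all m < B at
  once.\<close>

lemma divide_X:
  assumes w: "w \<in> F r" "\<And>i n. n < j \<Longrightarrow> w i n = 0"
  obtains \<gamma> w' where "\<gamma> \<notin> I" "w' \<in> F r" "sm \<gamma> w = X \<pi> j w'"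
proof -
  obtain B where B: "\<And>i n. n \<ge> B \<Longrightarrow> w i n = 0" using F_bound[OF w(1)] by blast
  define \<gamma> where "\<gamma> = (\<Prod>m<B. cc \<pi> j m)"
  define w' where "w' i m = (\<Prod>k\<in>{..<B} - {m}. cc \<pi> j k) * w i (j + m)" for i m
  have "\<gamma> \<notin> I" unfolding \<gamma>_def using cc_notin by (intro prod_notin) auto
  moreover have "w' \<in> F r" using B F_out[OF w(1)] by (intro FI[where B = B]) (auto simp: w'_def)
  moreover have "sm \<gamma> w = X \<pi> j w'"
  proof (intro ext)
    fix i n
    show "sm \<gamma> w i n = X \<pi> j w' i n"
    proof (cases "j \<le> n")
      case False
      then show ?thesis using w(2)[of n i] by (simp add: vec_apply X_apply)
    next
      case True
      then obtain m where n: "n = j + m" by (auto simp: le_iff_add)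
      show ?thesis
      proof (cases "m < B")
        case True
        then have "\<gamma> = cc \<pi> j m * (\<Prod>k\<in>{..<B} - {m}. cc \<pi> j k)"
          unfolding \<gamma>_def by (intro prod.remove) auto
        then show ?thesis by (simp add: n w'_def vec_apply mult.assoc)
      next
        case False
        then show ?thesis using B[of "j + m" i] by (simp add: n w'_def vec_apply)
      qed
    qed
  qed
  ultimately show ?thesis using that by blast
qed

end

section \<open>Torsion modulo a prime containing no parameter\<close>

context prime_setup
begin

text \<open>The Krull argument is run in degrees below some Q \<ge> j, with U the truncations of Z
  to these degrees. The torsion relations at the elements N \<ge> Q of P supply the approximations
  that \<open>krull\<close> asks for.\<close>

lemma torsion_near:
  assumes ch: "dchain M \<pi> P" and Z: "fg \<pi> r Z" and v: "v \<in> F r" "torsion_mod M \<pi> Z v"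
  obtains \<sigma> z where "\<sigma> \<notin> M" "z \<in> Z" "\<And>i n. n < j \<Longrightarrow> (sm \<sigma> v - z) i n = 0"
proof -
  note s = fg_subm[OF Z]
  obtain G where G: "finite G" "G \<subseteq> F r" "Z = dspan \<pi> G" using Z by (auto simp: fg_def)
  obtain B where B: "\<And>g i n. g \<in> insert v G \<Longrightarrow> n \<ge> B \<Longrightarrow> g i n = 0"
    using finite_F_bound[of "insert v G" r] G v by blast
  obtain n0 where n0: "\<And>n. n \<ge> n0 \<Longrightarrow> \<exists>\<sigma>. \<sigma> \<notin> M \<and> sm \<sigma> (X \<pi> n v) \<in> Z"
    using v(2) by (auto simp: torsion_mod_def)
  obtain Q where Q: "Q \<in> P" "max B j \<le> Q"
    using dchain_infinite[OF ch] infinite_nat_iff_unbounded_le by metis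
  have Q0: "Q > 0" using dchain_ge2[OF ch Q(1)] by simp
  define S where "S = P \<inter> {Q..}"
  have S: "infinite S"
  proof -
    have "P - {..<Q} \<subseteq> S" by (auto simp: S_def)
    then show ?thesis using dchain_infinite[OF ch] finite_subset by (metis Diff_infinite_finite finite_lessThan)
  qed
  define U where "U = slice Q 0 ` Z"
  \<comment> \<open>S lists P from Q on, so the carry factor at the element of S with number e' is
    the product of p 0, ..., p e'.\<close>
  define p where "p e = \<pi> (enumerate S e)" for e
  have enS: "enumerate S e \<in> P" "enumerate S e \<ge> Q" for e
    using enumerate_in_set[OF S, of e] by (auto simp: S_def)
  have U: "V.subspace U"
    unfolding V.subspace_def U_def
  proof (intro conjI ballI allI)
    show "0 \<in> slice Q 0 ` Z" using subm_0[OF s] slice_0 by (metis image_eqI)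
    show "x + y \<in> slice Q 0 ` Z" if "x \<in> slice Q 0 ` Z" "y \<in> slice Q 0 ` Z" for x y
    proof -
      from that obtain a b where "a \<in> Z" "b \<in> Z" "x = slice Q 0 a" "y = slice Q 0 b" by blast
      then show ?thesis using subm_add[OF s, of a b] by (intro image_eqI[of _ _ "a + b"]) (auto simp: slice_add)
    qed
    show "sm c x \<in> slice Q 0 ` Z" if "x \<in> slice Q 0 ` Z" for c x
    proof -
      from that obtain a where "a \<in> Z" "x = slice Q 0 a" by blast
      then show ?thesis using subm_sm[OF s, of a c] by (intro image_eqI[of _ _ "sm c a"]) (auto simp: slice_sm)
    qed
  qed
  have U2: "U \<subseteq> supp_in ({..<r} \<times> {..<Q})"
    unfolding U_def using fg_subset[OF Z] slice_supp by blast
  let ?B = "{..<r} \<times> {..<Q}"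
  have sl: "\<exists>u\<in>U. \<exists>w\<in>supp_in ?B. slice Q k z = u + sm (carry \<pi> P Q k) w" if k: "k > 0" and z: "z \<in> Z" for k z
    using z unfolding G(3)
  proof (induction rule: dspan_induct)
    case zero
    have "slice Q k 0 = 0 + sm (carry \<pi> P Q k) 0" by (simp add: slice_0 V.scale_zero_right)
    then show "\<exists>u\<in>U. \<exists>w\<in>supp_in ?B. slice Q k 0 = u + sm (carry \<pi> P Q k) w"
      using V.subspace_0[OF U] V.subspace_0[OF subspace_supp_in] by blast
  next
    case (base n g)
    have g: "g \<in> F r" using base G(2) by blast
    have gQ: "g i m = 0" if "m \<ge> Q" for i m using B[of g m i] base Q(2) that by simp
    obtain w where w: "w \<in> supp_in ?B"
      "slice Q k (X \<pi> n g) = (if n div Q = k then slice Q 0 (X \<pi> (n mod Q) g) else 0) + sm (carry \<pi> P Q k) w"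
      by (rule slice_X[OF ch Q(1) g gQ k])
    moreover have "(if n div Q = k then slice Q 0 (X \<pi> (n mod Q) g) else 0) \<in> U"
      using V.subspace_0[OF U] base by (auto simp: U_def G(3) intro!: imageI dspan_base)
    ultimately show "\<exists>u\<in>U. \<exists>w\<in>supp_in ?B. slice Q k (X \<pi> n g) = u + sm (carry \<pi> P Q k) w" by blast
  next
    case (add c a b)
    then obtain u w u' w' where *: "u \<in> U" "w \<in> supp_in ?B" "u' \<in> U" "w' \<in> supp_in ?B"
      "slice Q k a = u + sm (carry \<pi> P Q k) w" "slice Q k b = u' + sm (carry \<pi> P Q k) w'" by blast
    have "slice Q k (sm c a + b) = (sm c u + u') + sm (carry \<pi> P Q k) (sm c w + w')"
      by (simp add: slice_add slice_sm * V.scale_right_distrib mult.commute add_ac)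
    moreover have "sm c u + u' \<in> U" using * by (intro V.subspace_add[OF U] V.subspace_scale[OF U])
    moreover have "sm c w + w' \<in> supp_in ?B"
      using * by (intro V.subspace_add[OF subspace_supp_in] V.subspace_scale[OF subspace_supp_in])
    ultimately show "\<exists>u\<in>U. \<exists>w\<in>supp_in ?B. slice Q k (sm c a + b) = u + sm (carry \<pi> P Q k) w" by blast
  qed
  have near: "\<exists>\<sigma>. \<sigma> \<notin> M \<and> (\<exists>u\<in>U. \<exists>w\<in>supp_in ?B. sm \<sigma> v = u + sm (\<Prod>i<e. p i) w)" for e
  proof -
    \<comment> \<open>As e' \<ge> e, the carry factor contains the first e factors; as e' \<ge> n0,
      also N \<ge> n0, so a scalar outside M moves x^[N] v into Z.\<close>
    define e' where "e' = max e n0"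
    define N where "N = enumerate S e'"
    have N: "N \<in> P" "N \<ge> Q" "N \<ge> n0"
      using enS le_enumerate[OF S, of e'] unfolding N_def e'_def by (auto intro: order_trans[of _ "max e n0"])
    define k where "k = N div Q"
    have kN: "k * Q = N" using dchain_dvd_le[OF ch Q(1) N(1,2)] by (simp add: k_def)
    have k: "k > 0" using kN N(2) Q0 by (cases k) auto
    have "{l \<in> P. Q \<le> l \<and> l \<le> k * Q \<and> l dvd k * Q} = enumerate S ` {..e'}"
    proof (intro equalityI subsetI)
      fix l assume l: "l \<in> {l \<in> P. Q \<le> l \<and> l \<le> k * Q \<and> l dvd k * Q}"
      then have "l \<in> S" by (simp add: S_def)
      then obtain i where i: "enumerate S i = l" using enumerate_Ex[OF S] by blast
      have "i \<le> e'"
      proof (rule ccontr)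
        assume "\<not> i \<le> e'"
        then have "enumerate S e' < enumerate S i" using enumerate_mono[OF _ S] by simp
        then show False using l i by (simp add: kN N_def)
      qed
      then show "l \<in> enumerate S ` {..e'}" using i by blast
    next
      fix l assume "l \<in> enumerate S ` {..e'}"
      then obtain i where i: "i \<le> e'" "l = enumerate S i" by blast
      have "l \<le> N" using enumerate_mono[OF _ S, of i e'] i unfolding N_def by (cases "i = e'") auto
      then show "l \<in> {l \<in> P. Q \<le> l \<and> l \<le> k * Q \<and> l dvd k * Q}"
        using enS[of i] i(2) dchain_dvd_le[OF ch _ N(1), of l] by (simp add: kN)
    qed
    then have "carry \<pi> P Q k = (\<Prod>i\<le>e'. p i)"
      unfolding carry_def p_def using inj_enumerate[OF S] by (simp add: prod.reindex inj_on_subset)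
    moreover have "(\<Prod>i\<le>e'. p i) = (\<Prod>i<e. p i) * (\<Prod>i\<in>{..e'} - {..<e}. p i)"
      by (subst mult.commute, rule prod.subset_diff) (auto simp: e'_def)
    ultimately have c: "carry \<pi> P Q k = (\<Prod>i<e. p i) * (\<Prod>i\<in>{..e'} - {..<e}. p i)" by simp
    obtain \<sigma> where \<sigma>: "\<sigma> \<notin> M" "sm \<sigma> (X \<pi> N v) \<in> Z" using n0[OF N(3)] by blast
    obtain u w where uw: "u \<in> U" "w \<in> supp_in ?B" "slice Q k (sm \<sigma> (X \<pi> N v)) = u + sm (carry \<pi> P Q k) w"
      using sl[OF k \<sigma>(2)] by blast
    have "slice Q k (X \<pi> (k * Q) v) = v"
      by (rule slice_X_multiple[OF ch Q(1)]) (use B[of v] Q(2) in auto)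
    then have "sm \<sigma> v = u + sm (\<Prod>i<e. p i) (sm (\<Prod>i\<in>{..e'} - {..<e}. p i) w)"
      using uw(3) by (simp add: slice_sm kN c)
    then show ?thesis using \<sigma>(1) uw(1) V.subspace_scale[OF subspace_supp_in uw(2)] by blast
  qed
  have "v \<in> supp_in ?B" using B[of v] Q(2) F_out[OF v(1)] by (auto simp: supp_in_def not_less)
  then obtain \<sigma> where \<sigma>: "\<sigma> \<notin> M" "sm \<sigma> v \<in> U"
    using krull[of ?B U p v] U U2 near dchain_mem[OF ch enS(1)] by (auto simp: p_def)
  then obtain z where z: "z \<in> Z" "sm \<sigma> v = slice Q 0 z" by (auto simp: U_def)
  have "(sm \<sigma> v - z) i n = 0" if "n < j" for i n
    using that Q(2) unfolding z(2) by (simp add: slice_apply minus_apply)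
  then show ?thesis using that \<sigma>(1) z(1) by blast
qed

lemma Tor_regular:
  assumes rp: "regular_prime \<pi> I" and IM: "I \<subseteq> M" and ch: "dchain M \<pi> P"
    and C: "\<And>\<alpha>. \<alpha> \<notin> I \<Longrightarrow> Coh \<pi> (add_principal I \<alpha>)"
    and T: "\<And>\<alpha>. \<alpha> \<notin> I \<Longrightarrow> Tor M \<pi> (add_principal I \<alpha>)"
  shows "Tor M \<pi> I"
  unfolding Tor_def
proof (intro allI impI)
  interpret regular_prime \<pi> I by (rule rp)
  fix r Z v assume Z: "fg \<pi> r Z" "IF I r \<subseteq> Z" and v: "v \<in> F r" "torsion_mod M \<pi> Z v"
  note s = fg_subm[OF Z(1)]
  obtain n0 where n0: "\<And>n. n \<ge> n0 \<Longrightarrow> \<exists>\<sigma>. \<sigma> \<notin> M \<and> sm \<sigma> (X \<pi> n v) \<in> Z"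
    using v(2) by (auto simp: torsion_mod_def)
  obtain \<alpha> where \<alpha>: "\<alpha> \<notin> I" "sm \<alpha> v \<in> Z"
  proof -
    obtain j0 where j0: "\<And>w j \<alpha>. w \<in> F r \<Longrightarrow> \<alpha> \<notin> I \<Longrightarrow> sm \<alpha> (X \<pi> j w) \<in> Z \<Longrightarrow>
        \<exists>\<beta>. \<beta> \<notin> I \<and> sm \<beta> (X \<pi> j0 w) \<in> Z"
      using uniform_exponent[OF s Z(2)] by blast
    \<comment> \<open>After subtraction of z nothing is left below degree j0, so x^[j0] can be
      divided out up to a scalar. The quotient w inherits a torsion relation from v, and
      \<open>uniform_exponent\<close> lowers its exponent to j0 itself.\<close>
    obtain \<sigma> z where \<sigma>: "\<sigma> \<notin> M" "z \<in> Z" "\<And>i n. n < j0 \<Longrightarrow> (sm \<sigma> v - z) i n = 0"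
      using torsion_near[OF ch Z(1) v] by blast
    have "sm \<sigma> v - z \<in> F r" using fg_subset[OF Z(1)] \<sigma>(2) v(1) by (auto intro!: F_diff F_sm)
    then obtain \<gamma> w where w: "\<gamma> \<notin> I" "w \<in> F r" "sm \<gamma> (sm \<sigma> v - z) = X \<pi> j0 w"
      using divide_X \<sigma>(3) by blast
    obtain \<tau> where \<tau>: "\<tau> \<notin> M" "sm \<tau> (X \<pi> n0 v) \<in> Z" using n0[of n0] by blast
    have "sm \<tau> (X \<pi> n0 (sm \<gamma> (sm \<sigma> v - z))) = sm (\<gamma> * \<sigma>) (sm \<tau> (X \<pi> n0 v)) - sm (\<tau> * \<gamma>) (X \<pi> n0 z)"
      by (simp add: X_sm X_diff V.scale_right_diff_distrib mult_ac)
    also have "\<dots> \<in> Z" by (intro subm_diff[OF s] subm_sm[OF s] subm_sm[OF s, OF \<tau>(2)] subm_X[OF s] \<sigma>(2))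
    finally have "sm (\<tau> * cc \<pi> n0 j0) (X \<pi> (n0 + j0) w) \<in> Z" by (simp add: w(3) X_X)
    moreover have "\<tau> * cc \<pi> n0 j0 \<notin> I" using I_prime cc_notin \<tau>(1) IM by blast
    ultimately obtain \<beta> where \<beta>: "\<beta> \<notin> I" "sm \<beta> (X \<pi> j0 w) \<in> Z" using j0 w(2) by blast
    have "sm \<beta> (sm \<gamma> (sm \<sigma> v - z)) + sm (\<beta> * \<gamma>) z \<in> Z"
      using \<beta>(2) \<sigma>(2) by (intro subm_add[OF s] subm_sm[OF s, of z]) (simp_all add: w(3))
    then have "sm (\<beta> * \<gamma> * \<sigma>) v \<in> Z" by (simp add: V.scale_right_diff_distrib mult.assoc)
    moreover have "\<beta> * \<gamma> * \<sigma> \<notin> I" using I_prime \<beta>(1) w(1) \<sigma>(1) IM by blast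
    ultimately show ?thesis using that by blast
  qed
  have CI: "Coh \<pi> I" by (rule Coh_regular[OF noeth C])
  obtain t L where L: "lin \<pi> t r L" "L ` F t = Z" using fg_lin_image[OF Z(1)] by metis
  obtain c where c: "c \<in> F t" "sm \<alpha> v = L c" using \<alpha>(2) L(2) by auto
  define aF where "aF = (\<lambda>c. sm \<alpha> c) ` F t"
  have "fg \<pi> t (F t)" by (subst F_eq_dspan[of _ \<pi>], rule fg_dspan) (auto intro: ebas_F)
  then have aF: "fg \<pi> t aF" unfolding aF_def using fg_image[OF lin_scale[OF lin_id]] by blast
  have kI: "fg \<pi> t (kerI I t L)" using CI L(1) by (simp add: Coh_def)
  \<comment> \<open>As L maps onto Z and Z contains I D^r, the quotient D^t/K is Z/(\<alpha> Z + I
    D^r). In it c represents \<alpha> v and is again torsion, so the hypothesis for I + (\<alpha>)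
    applies; cancelling \<alpha> modulo I then returns to v.\<close>
  define K where "K = msum (kerI I t L) aF"
  have K: "fg \<pi> t K" unfolding K_def by (rule fg_msum[OF kI aF])
  have "IF (add_principal I \<alpha>) t \<subseteq> K"
  proof
    fix u assume u: "u \<in> IF (add_principal I \<alpha>) t"
    then obtain h where h: "h \<in> F t" "inI I (u - sm \<alpha> h)"
      using inI_add_principal[of u t I \<alpha>] I by (auto simp: IF_def)
    have "u - sm \<alpha> h \<in> kerI I t L"
      using IF_subset_kerI[OF I L(1)] h u by (auto simp: IF_def intro!: F_diff F_sm)
    then have "(u - sm \<alpha> h) + sm \<alpha> h \<in> K" unfolding K_def msum_def aF_def using h(1) by blast
    then show "u \<in> K" by simp
  qed
  moreover have "torsion_mod M \<pi> K c"
    unfolding torsion_mod_def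
  proof (intro exI[of _ n0] allI impI)
    fix n assume "n \<ge> n0"
    then obtain \<sigma> where \<sigma>: "\<sigma> \<notin> M" "sm \<sigma> (X \<pi> n v) \<in> Z" using n0 by blast
    then obtain d where d: "d \<in> F t" "sm \<sigma> (X \<pi> n v) = L d" using L(2) by auto
    have "L (sm \<sigma> (X \<pi> n c) - sm \<alpha> d) = sm \<sigma> (X \<pi> n (L c)) - sm \<alpha> (L d)"
      using c(1) d(1) by (simp add: lin_diff[OF L(1)] lin_sm[OF L(1)] lin_X[OF L(1)] F_sm F_X)
    also have "\<dots> = 0" by (simp add: c(2)[symmetric] d(2)[symmetric] X_sm mult.commute)
    finally have "sm \<sigma> (X \<pi> n c) - sm \<alpha> d \<in> kerI I t L"
      using c(1) d(1) inI_0[OF I] by (simp add: kerI_def F_diff F_sm F_X)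
    then have "(sm \<sigma> (X \<pi> n c) - sm \<alpha> d) + sm \<alpha> d \<in> K" unfolding K_def msum_def aF_def using d(1) by blast
    then have "sm \<sigma> (X \<pi> n c) \<in> K" by simp
    then show "\<exists>\<sigma>. \<sigma> \<notin> M \<and> sm \<sigma> (X \<pi> n c) \<in> K" using \<sigma>(1) by blast
  qed
  ultimately obtain \<sigma> where \<sigma>: "\<sigma> \<notin> M" "sm \<sigma> c \<in> K"
    using T[OF \<alpha>(1)] K c(1) unfolding Tor_def by blast
  then obtain k e where ke: "sm \<sigma> c = k + sm \<alpha> e" "k \<in> kerI I t L" "e \<in> F t" by (auto simp: K_def msum_def aF_def)
  have kF: "k \<in> F t" "inI I (L k)" using ke(2) by (auto simp: kerI_def)
  have "sm \<sigma> (L c) = L k + sm \<alpha> (L e)"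
    using lin_sm[OF L(1) c(1), of \<sigma>] ke kF by (simp add: lin_add[OF L(1)] lin_sm[OF L(1)] F_sm)
  then have "sm \<alpha> (sm \<sigma> v - L e) = L k"
    by (simp add: V.scale_right_diff_distrib c(2)[symmetric] mult.commute diff_eq_eq)
  then have "inI I (sm \<sigma> v - L e)" using kF(2) inI_cancel[OF \<alpha>(1)] by simp
  then have "sm \<sigma> v - L e \<in> Z"
    using Z(2) v(1) lin_F[OF L(1) ke(3)] by (auto simp: IF_def intro!: F_diff F_sm)
  moreover have "L e \<in> Z" using L(2) ke(3) by blast
  ultimately have "(sm \<sigma> v - L e) + L e \<in> Z" by (rule subm_add[OF s])
  then have "sm \<sigma> v \<in> Z" by simp
  then show "\<exists>\<sigma>. \<sigma> \<notin> M \<and> sm \<sigma> v \<in> Z" using \<sigma>(1) by blast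
qed

end

section \<open>Passing to the subalgebra spanned by the degrees divisible by Q\<close>

text \<open>Only multiples of Q larger than Q are kept. They are all the elements of P beyond Q,
  hence infinitely many.\<close>

lemma dchain_scale:
  assumes ch: "dchain M \<pi> P" and Q: "Q \<in> P"
  shows "dchain M (\<lambda>l. \<pi> (Q * l)) {l. 2 \<le> l \<and> Q * l \<in> P}"
proof -
  have Q2: "Q \<ge> 2" by (rule dchain_ge2[OF ch Q])
  have "P - {..Q} \<subseteq> (\<lambda>l. Q * l) ` {l. 2 \<le> l \<and> Q * l \<in> P}"
  proof
    fix p assume p: "p \<in> P - {..Q}"
    then obtain l where l: "p = Q * l" using dchain_dvd_le[OF ch Q, of p] by (auto elim: dvdE)
    have "l \<noteq> 0" "l \<noteq> 1" using p l by auto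
    then show "p \<in> (\<lambda>l. Q * l) ` {l. 2 \<le> l \<and> Q * l \<in> P}" using p l by auto
  qed
  then have "infinite {l. 2 \<le> l \<and> Q * l \<in> P}"
    using dchain_infinite[OF ch] by (metis Diff_infinite_finite finite_atMost finite_imageI finite_subset)
  moreover have "2 \<le> Q * j" if "2 \<le> j" for j using that Q2 by (cases Q) auto
  ultimately show ?thesis
    unfolding dchain_def using Q2 dchain_one[OF ch] dchain_mem[OF ch] dchain_dvd[OF ch] by fastforce
qed

text \<open>An index dividing Q sees i * Q as 0 and gives no carry. For an index Q * l the remainder
  t < Q is too small to matter, and the carry is that of i + k modulo l.\<close>

lemma cc_scale:
  assumes ch: "dchain M \<pi> P" and Q: "Q \<in> P" and t: "t < Q"
  shows "cc \<pi> (i * Q) (k * Q + t) = cc (\<lambda>l. \<pi> (Q * l)) i k"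
proof -
  have Q2: "Q \<ge> 2" by (rule dchain_ge2[OF ch Q])
  let ?N = "(i + k + 1) * Q" and ?e = "\<lambda>j. eps j (i * Q) (k * Q + t)"
  have le: "i * Q + (k * Q + t) \<le> ?N" using t by (simp add: algebra_simps)
  have e: "?e (Q * l) = eps l i k" if "l > 0" for l
  proof -
    have "(i * Q) mod (Q * l) = Q * (i mod l)" "(k * Q + t) mod (Q * l) = Q * (k mod l) + t"
      using mod_mult_add[of 0 Q i l] mod_mult_add[OF t, of k l] Q2 by auto
    moreover have "Q * (i mod l) + (Q * (k mod l) + t) < Q * l \<longleftrightarrow> i mod l + k mod l < l"
    proof
      assume "Q * (i mod l) + (Q * (k mod l) + t) < Q * l"
      then have "Q * (i mod l + k mod l) < Q * l" by (simp add: algebra_simps)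
      then show "i mod l + k mod l < l" by simp
    next
      assume "i mod l + k mod l < l"
      then have "Q * (i mod l + k mod l + 1) \<le> Q * l" by (intro mult_le_mono2) simp
      then show "Q * (i mod l) + (Q * (k mod l) + t) < Q * l" using t by (simp add: algebra_simps)
    qed
    ultimately show ?thesis using that Q2 by (simp add: eps_mod)
  qed
  have "cc \<pi> (i * Q) (k * Q + t) = (\<Prod>j\<in>{2..?N}. \<pi> j ^ ?e j)" by (rule cc_eq_prod_le[OF le])
  also have "\<dots> = (\<Prod>j\<in>(\<lambda>l. Q * l) ` {2..i + k + 1}. \<pi> j ^ ?e j)"
  proof (rule prod.mono_neutral_right)
    show "(\<lambda>l. Q * l) ` {2..i + k + 1} \<subseteq> {2..?N}"
    proof clarify
      fix l assume l: "l \<in> {2..i + k + 1}"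
      have "2 * 2 \<le> Q * l" using Q2 l by (intro mult_le_mono) auto
      moreover have "Q * l \<le> Q * (i + k + 1)" using l by (intro mult_le_mono2) auto
      ultimately show "Q * l \<in> {2..?N}" by (simp add: mult.commute)
    qed
    show "\<forall>j\<in>{2..?N} - (\<lambda>l. Q * l) ` {2..i + k + 1}. \<pi> j ^ ?e j = 1"
    proof
      fix j assume j: "j \<in> {2..?N} - (\<lambda>l. Q * l) ` {2..i + k + 1}"
      show "\<pi> j ^ ?e j = 1"
      proof (cases "j \<in> P")
        case False
        then show ?thesis using j dchain_one[OF ch, of j] by simp
      next
        case True
        have "j dvd Q"
        proof (rule ccontr)
          assume n: "\<not> j dvd Q"
          then obtain l where l: "j = Q * l" using dchain_dvd[OF ch True Q] by (auto elim: dvdE)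
          have "l \<noteq> 0" "l \<noteq> 1" using l j n by auto
          moreover have "Q * l \<le> Q * (i + k + 1)" using j l by (simp add: mult.commute)
          then have "l \<le> i + k + 1" using Q2 by (simp only: mult_le_cancel1)
          ultimately show False using j l by auto
        qed
        then have "(i * Q) mod j = 0" by auto
        then have "?e j = 0" using j by (simp add: eps_mod)
        then show ?thesis by simp
      qed
    qed
  qed simp
  also have "\<dots> = (\<Prod>l\<in>{2..i + k + 1}. \<pi> (Q * l) ^ ?e (Q * l))"
    using Q2 by (subst prod.reindex) (auto simp: inj_on_def)
  also have "\<dots> = (\<Prod>l\<in>{2..i + k + 1}. \<pi> (Q * l) ^ eps l i k)"
    by (rule prod.cong) (auto simp: e)
  also have "\<dots> = cc (\<lambda>l. \<pi> (Q * l)) i k" by (rule cc_eq_prod_le[symmetric]) simp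
  finally show ?thesis .
qed

text \<open>Views D^r as a free module of rank r * Q over the span of the x^[j Q]: row i * Q + t and
  degree j hold the coefficient from row i and degree j * Q + t. The inverse is
  \<open>join_vec\<close>.\<close>

definition split_vec :: "nat \<Rightarrow> 'k::comm_ring_1 vec \<Rightarrow> 'k vec" where
  "split_vec Q v = (\<lambda>p j. v (p div Q) (j * Q + p mod Q))"

definition join_vec :: "nat \<Rightarrow> 'k::comm_ring_1 vec \<Rightarrow> 'k vec" where
  "join_vec Q u = (\<lambda>i n. u (i * Q + n mod Q) (n div Q))"

lemma split_linear: "split_vec Q (v + w) = split_vec Q v + split_vec Q w"
  "split_vec Q (sm c v) = sm c (split_vec Q v)" "split_vec Q 0 = 0"
  by (auto simp: split_vec_def fun_eq_iff vec_apply)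

lemma join_linear: "join_vec Q (v + w) = join_vec Q v + join_vec Q w"
  "join_vec Q (sm c v) = sm c (join_vec Q v)" "join_vec Q 0 = 0"
  by (auto simp: join_vec_def fun_eq_iff vec_apply)

locale scaled_chain = prime_setup M for M :: "'k::comm_ring_1 set" +
  fixes \<pi> :: "nat \<Rightarrow> 'k" and P :: "nat set" and Q :: nat
  assumes ch: "dchain M \<pi> P" and Q: "Q \<in> P"
begin

abbreviation \<pi>Q :: "nat \<Rightarrow> 'k" where "\<pi>Q \<equiv> \<lambda>l. \<pi> (Q * l)"

lemma Q_pos: "Q > 0"
  using dchain_ge2[OF ch Q] by simp

lemma join_split: "join_vec Q (split_vec Q v) = v"
  using Q_pos by (auto simp: join_vec_def split_vec_def fun_eq_iff)

lemma split_join: "split_vec Q (join_vec Q u) = u"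
  using Q_pos by (auto simp: join_vec_def split_vec_def fun_eq_iff)

lemma split_F: "v \<in> F r \<Longrightarrow> split_vec Q v \<in> F (r * Q)"
proof -
  assume v: "v \<in> F r"
  obtain B where B: "\<And>i n. n \<ge> B \<Longrightarrow> v i n = 0" using F_bound[OF v] by blast
  show ?thesis
  proof (rule FI[where B = B])
    fix p j assume "r * Q \<le> p"
    then have "r \<le> p div Q" using Q_pos by (simp add: less_eq_div_iff_mult_less_eq)
    then show "split_vec Q v p j = 0" using F_out[OF v] by (simp add: split_vec_def)
  next
    fix p j assume "B \<le> j"
    moreover have "j \<le> j * Q" using Q_pos by simp
    ultimately have "B \<le> j * Q + p mod Q" by linarith
    then show "split_vec Q v p j = 0" using B by (simp add: split_vec_def)
  qed
qed

lemma join_F: "u \<in> F (r * Q) \<Longrightarrow> join_vec Q u \<in> F r"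
proof -
  assume u: "u \<in> F (r * Q)"
  obtain B where B: "\<And>i n. n \<ge> B \<Longrightarrow> u i n = 0" using F_bound[OF u] by blast
  show ?thesis
  proof (rule FI[where B = "B * Q"])
    fix i n assume "r \<le> i"
    then have "r * Q \<le> i * Q" by simp
    then have "r * Q \<le> i * Q + n mod Q" by linarith
    then show "join_vec Q u i n = 0" using F_out[OF u] by (simp add: join_vec_def)
  next
    fix i n assume "B * Q \<le> n"
    then have "B \<le> n div Q" using Q_pos by (simp add: less_eq_div_iff_mult_less_eq)
    then show "join_vec Q u i n = 0" using B by (simp add: join_vec_def)
  qed
qed

lemma split_X: "split_vec Q (X \<pi> (n * Q) v) = X \<pi>Q n (split_vec Q v)"
proof (intro ext)
  fix p j
  define t where "t = p mod Q"
  have t: "t < Q" using Q_pos by (simp add: t_def)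
  show "split_vec Q (X \<pi> (n * Q) v) p j = X \<pi>Q n (split_vec Q v) p j"
  proof (cases "n \<le> j")
    case True
    then obtain k where j: "j = n + k" by (auto simp: le_iff_add)
    have "j * Q + t = n * Q + (k * Q + t)" by (simp add: j algebra_simps)
    then have "split_vec Q (X \<pi> (n * Q) v) p j = cc \<pi> (n * Q) (k * Q + t) * v (p div Q) (k * Q + t)"
      by (simp only: split_vec_def t_def[symmetric] X_add_apply)
    moreover have "X \<pi>Q n (split_vec Q v) p j = cc \<pi>Q n k * v (p div Q) (k * Q + t)"
      by (simp add: j split_vec_def t_def)
    ultimately show ?thesis by (simp add: cc_scale[OF ch Q t])
  next
    case False
    then have "(j + 1) * Q \<le> n * Q" by (intro mult_le_mono1) simp
    then have "\<not> n * Q \<le> j * Q + t" using t by simp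
    then show ?thesis using False by (simp add: split_vec_def X_apply t_def)
  qed
qed

lemma join_X: "join_vec Q (X \<pi>Q n u) = X \<pi> (n * Q) (join_vec Q u)"
  using split_X[of n "join_vec Q u"] by (metis join_split split_join)

lemma inI_split: "inI I (split_vec Q v) \<longleftrightarrow> inI I v"
proof
  assume *: "inI I (split_vec Q v)"
  show "inI I v"
    unfolding inI_def
  proof (intro allI)
    fix i n
    have "join_vec Q (split_vec Q v) i n \<in> I" using * by (simp add: inI_def join_vec_def)
    then show "v i n \<in> I" by (simp add: join_split)
  qed
qed (simp add: inI_def split_vec_def)

lemma join_dspan: "u \<in> dspan \<pi>Q H \<Longrightarrow> join_vec Q u \<in> dspan \<pi> (join_vec Q ` H)"
proof (induction rule: dspan_induct)
  case zero
  show "join_vec Q 0 \<in> dspan \<pi> (join_vec Q ` H)" by (simp add: join_linear subm_0[OF subm_dspan])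
next
  case (base n g)
  then show ?case by (simp add: join_X dspan_base)
next
  case (add c a b)
  then show "join_vec Q (sm c a + b) \<in> dspan \<pi> (join_vec Q ` H)"
    by (simp add: join_linear subm_add[OF subm_dspan] subm_sm[OF subm_dspan])
qed

text \<open>A D-linear map is linear over the smaller algebra, and generators of its kernel over the
  smaller algebra generate it over D.\<close>

lemma Coh_scale:
  assumes I: "cr_ideal I" and C: "Coh \<pi>Q I"
  shows "Coh \<pi> I"
  unfolding Coh_def
proof (intro allI impI)
  fix s r L assume L: "lin \<pi> s r L"
  define L' where "L' c = split_vec Q (L (join_vec Q c))" for c
  have "lin \<pi>Q (s * Q) (r * Q) L'"
    unfolding lin_def L'_def
    by (auto simp: join_linear split_linear join_X split_X lin_add[OF L] lin_sm[OF L] lin_X[OF L] join_F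
        intro!: split_F lin_F[OF L])
  then have "fg \<pi>Q (s * Q) (kerI I (s * Q) L')" using C unfolding Coh_def by blast
  then obtain H where H: "finite H" "H \<subseteq> F (s * Q)" "kerI I (s * Q) L' = dspan \<pi>Q H"
    by (auto simp: fg_def)
  have HF: "join_vec Q ` H \<subseteq> F s" using H(2) join_F by blast
  have "join_vec Q ` H \<subseteq> kerI I s L"
  proof clarify
    fix h assume "h \<in> H"
    then have "h \<in> kerI I (s * Q) L'" unfolding H(3) by (rule dspan_inc)
    then show "join_vec Q h \<in> kerI I s L" by (auto simp: kerI_def L'_def inI_split join_F)
  qed
  then have "dspan \<pi> (join_vec Q ` H) \<subseteq> kerI I s L" by (rule dspan_least[OF subm_kerI[OF I L]])
  moreover have "kerI I s L \<subseteq> dspan \<pi> (join_vec Q ` H)"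
  proof
    fix c assume "c \<in> kerI I s L"
    then have "split_vec Q c \<in> kerI I (s * Q) L'" by (auto simp: kerI_def L'_def inI_split join_split split_F)
    then show "c \<in> dspan \<pi> (join_vec Q ` H)" using join_dspan[of "split_vec Q c" H] H(3) by (simp add: join_split)
  qed
  ultimately have "kerI I s L = dspan \<pi> (join_vec Q ` H)" by blast
  then show "fg \<pi> s (kerI I s L)" using H(1) HF by (simp add: fg_dspan)
qed

text \<open>Over the smaller algebra Z is still finitely generated, namely by the x^[t] g with t < Q
  and g a generator. Torsion is inherited because n \<le> n * Q.\<close>

lemma Tor_scale:
  assumes I: "cr_ideal I" and T: "Tor M \<pi>Q I"
  shows "Tor M \<pi> I"
  unfolding Tor_def
proof (intro allI impI)
  fix r Z v assume Z: "fg \<pi> r Z" "IF I r \<subseteq> Z" and v: "v \<in> F r" "torsion_mod M \<pi> Z v"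
  note s = fg_subm[OF Z(1)]
  obtain G where G: "finite G" "G \<subseteq> F r" "Z = dspan \<pi> G" using Z(1) by (auto simp: fg_def)
  define H where "H = (\<lambda>(t, g). split_vec Q (X \<pi> t g)) ` ({..<Q} \<times> G)"
  have H: "finite H" "H \<subseteq> F (r * Q)" using G by (auto simp: H_def intro!: split_F F_X)
  have 1: "split_vec Q z \<in> dspan \<pi>Q H" if "z \<in> Z" for z
    using that unfolding G(3)
  proof (induction rule: dspan_induct)
    case zero
    show "split_vec Q 0 \<in> dspan \<pi>Q H" by (simp add: split_linear subm_0[OF subm_dspan])
  next
    case (base n g)
    have "X \<pi> (n div Q * Q) (X \<pi> (n mod Q) g) = X \<pi> n g"
      using cc_multiple[OF ch Q, of "n mod Q" "n div Q"] Q_pos by (simp add: X_X)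
    then have "split_vec Q (X \<pi> n g) = X \<pi>Q (n div Q) (split_vec Q (X \<pi> (n mod Q) g))"
      by (metis split_X)
    moreover have "split_vec Q (X \<pi> (n mod Q) g) \<in> H" using base Q_pos by (force simp: H_def)
    ultimately show ?case by (simp add: dspan_base)
  next
    case (add c a b)
    then show "split_vec Q (sm c a + b) \<in> dspan \<pi>Q H"
      by (simp add: split_linear subm_add[OF subm_dspan] subm_sm[OF subm_dspan])
  qed
  have 2: "join_vec Q u \<in> Z" if "u \<in> dspan \<pi>Q H" for u
  proof -
    have "join_vec Q ` H \<subseteq> Z" by (auto simp: H_def G(3) join_split dspan_base)
    then show ?thesis using join_dspan[OF that] dspan_least[OF s] by blast
  qed
  have "IF I (r * Q) \<subseteq> dspan \<pi>Q H"
  proof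
    fix u assume u: "u \<in> IF I (r * Q)"
    then have "join_vec Q u \<in> IF I r" using inI_split[of I "join_vec Q u"] by (simp add: IF_def join_F split_join)
    then show "u \<in> dspan \<pi>Q H" using 1[of "join_vec Q u"] Z(2) by (auto simp: split_join)
  qed
  moreover have "torsion_mod M \<pi>Q (dspan \<pi>Q H) (split_vec Q v)"
  proof -
    obtain n0 where n0: "\<And>n. n \<ge> n0 \<Longrightarrow> \<exists>\<sigma>. \<sigma> \<notin> M \<and> sm \<sigma> (X \<pi> n v) \<in> Z"
      using v(2) by (auto simp: torsion_mod_def)
    have "\<exists>\<sigma>. \<sigma> \<notin> M \<and> sm \<sigma> (X \<pi>Q n (split_vec Q v)) \<in> dspan \<pi>Q H" if "n \<ge> n0" for n
    proof -
      have "n \<le> n * Q" using Q_pos by simp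
      then have "n0 \<le> n * Q" using that by linarith
      then obtain \<sigma> where \<sigma>: "\<sigma> \<notin> M" "sm \<sigma> (X \<pi> (n * Q) v) \<in> Z" using n0 by blast
      then show ?thesis using 1[OF \<sigma>(2)] by (auto simp: split_linear split_X)
    qed
    then show ?thesis by (auto simp: torsion_mod_def)
  qed
  ultimately obtain \<sigma> where \<sigma>: "\<sigma> \<notin> M" "sm \<sigma> (split_vec Q v) \<in> dspan \<pi>Q H"
    using T fg_dspan[OF H] split_F[OF v(1)] unfolding Tor_def by blast
  then have "sm \<sigma> v \<in> Z" using 2[OF \<sigma>(2)] by (simp add: join_linear join_split)
  then show "\<exists>\<sigma>. \<sigma> \<notin> M \<and> sm \<sigma> v \<in> Z" using \<sigma>(1) by blast
qed

end

section \<open>The noetherian induction\<close>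

context prime_setup
begin

text \<open>If I is not contained in M, localizing D/I at M gives zero.\<close>

lemma Tor_trivial:
  assumes "\<sigma> \<in> I" "\<sigma> \<notin> M" "cr_ideal I"
  shows "Tor M \<pi> I"
  unfolding Tor_def using assms inI_sm_ideal[OF assms(3,1)] by (auto simp: IF_def subset_iff intro: F_sm)

theorem Coh_and_Tor:
  assumes "cr_ideal I" "dchain M \<pi> P"
  shows "Coh \<pi> I \<and> Tor M \<pi> I"
proof -
  \<comment> \<open>The parameters are quantified inside the induction because the last case
    replaces \<pi> by its values at the multiples of Q and needs the induction hypothesis for that
    sequence.\<close>
  have "\<forall>\<pi> P. dchain M \<pi> P \<longrightarrow> Coh \<pi> I \<and> Tor M \<pi> I"
    using noeth assms(1)
  proof (induction I rule: noetherian_induct)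
    case (step I)
    note I = step(1)
    have IH: "Coh \<pi> J" "Tor M \<pi> J" if "cr_ideal J" "I \<subset> J" "dchain M \<pi> P" for J \<pi> P
      using step(2)[OF that(1,2)] that(3) by auto
    have add: "cr_ideal (add_principal I a)" "I \<subset> add_principal I a" if "a \<notin> I" for a
      using ideal_add_principal[OF I] add_principal_subset[of I a] add_principal_mem[OF I, of a 1] that by auto
    show ?case
    proof (intro allI impI)
      fix \<pi> P assume ch: "dchain M \<pi> P"
      show "Coh \<pi> I \<and> Tor M \<pi> I"
      proof (cases "\<exists>a b. a * b \<in> I \<and> a \<notin> I \<and> b \<notin> I")
        case True
        then obtain a b where ab: "a * b \<in> I" "a \<notin> I" "b \<notin> I" by blast
        have J2: "cr_ideal (colon I a)" "I \<subset> colon I a"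
          using ideal_colon[OF I] ideal_mult[OF I] ab by (auto simp: colon_def)
        show ?thesis
          using Coh_step[OF I IH(1)[OF add[OF ab(2)] ch] IH(1)[OF J2 ch]]
            Tor_step[OF I IH(1)[OF add[OF ab(2)] ch] IH(2)[OF add[OF ab(2)] ch] IH(2)[OF J2 ch]] by blast
      next
        case False
        then have prime: "a \<in> I \<or> b \<in> I" if "a * b \<in> I" for a b using that by blast
        have regular: "Coh \<rho> I \<and> Tor M \<rho> I" if "regular_prime \<rho> I" "dchain M \<rho> R" for \<rho> R
        proof -
          interpret regular_prime \<rho> I by (rule that(1))
          have "Coh \<rho> I" by (rule Coh_regular[OF noeth IH(1)[OF add that(2)]])
          moreover have "Tor M \<rho> I"
          proof (cases "I \<subseteq> M")
            case True
            show ?thesis by (rule Tor_regular[OF that(1) True that(2) IH(1)[OF add that(2)] IH(2)[OF add that(2)]])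
          next
            case False
            then show ?thesis using Tor_trivial I by blast
          qed
          ultimately show ?thesis ..
        qed
        consider "1 \<in> I" | "infinite {l \<in> P. \<pi> l \<in> I}" | "1 \<notin> I" "{l \<in> P. \<pi> l \<in> I} = {}"
          | "1 \<notin> I" "finite {l \<in> P. \<pi> l \<in> I}" "{l \<in> P. \<pi> l \<in> I} \<noteq> {}" by blast
        then show ?thesis
        proof cases
          case 1
          have "x \<in> I" for x using ideal_mult[OF I 1, of x] by simp
          then have "kerI I s L = IF I s" for s L by (auto simp: kerI_def IF_def inI_def)
          then have "Coh \<pi> I" using fg_IF[OF noeth I] by (simp add: Coh_def)
          then show ?thesis using Tor_trivial[OF 1 M_one I] by blast
        next
          case 2
          then show ?thesis using Coh_infinite[OF noeth ch I] Tor_infinite[OF ch I] by blast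
        next
          case 3
          have "\<pi> l \<notin> I" if "l \<ge> 2" for l using 3 dchain_one[OF ch that] by (cases "l \<in> P") auto
          then have "regular_prime \<pi> I" using I 3(1) prime by unfold_locales auto
          then show ?thesis using regular ch by blast
        next
          case 4
          define Q where "Q = Max {l \<in> P. \<pi> l \<in> I}"
          have Q: "Q \<in> P" using Max_in[OF 4(2,3)] by (auto simp: Q_def)
          have max: "l \<le> Q" if "l \<in> P" "\<pi> l \<in> I" for l unfolding Q_def using 4(2) that by (intro Max_ge) auto
          interpret S: scaled_chain M \<pi> P Q using ch Q by unfold_locales
          have "\<pi> (Q * l) \<notin> I" if "l \<ge> 2" for l
          proof (cases "Q * l \<in> P")
            case True
            have "Q * 2 \<le> Q * l" using that by (intro mult_le_mono2)
            then have "Q < Q * l" using S.Q_pos by linarith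
            then show ?thesis using max[OF True] by auto
          next
            case False
            have "1 * 2 \<le> Q * l" using that S.Q_pos by (intro mult_le_mono) auto
            then show ?thesis using dchain_one[OF ch _ False] 4(1) by simp
          qed
          then have "regular_prime (\<lambda>l. \<pi> (Q * l)) I" using I 4(1) prime by unfold_locales auto
          then have "Coh (\<lambda>l. \<pi> (Q * l)) I \<and> Tor M (\<lambda>l. \<pi> (Q * l)) I"
            using regular dchain_scale[OF ch Q] by blast
          then show ?thesis using S.Coh_scale[OF I] S.Tor_scale[OF I] by blast
        qed
      qed
    qed
  qed
  then show ?thesis using assms(2) by blast
qed

end

section \<open>Removing the parameters outside the maximal ideal\<close>

text \<open>The exponents n div j have coboundary \<open>eps j\<close>, so rescaling x^[n] by this
  factor removes from the structure constants exactly the parameters outside P.\<close>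

definition weight :: "(nat \<Rightarrow> 'k::comm_ring_1) \<Rightarrow> nat set \<Rightarrow> nat \<Rightarrow> 'k" where
  "weight \<pi> P n = (\<Prod>j\<in>{2..n} - P. \<pi> j ^ (n div j))"

definition normalized :: "(nat \<Rightarrow> 'k::comm_ring_1) \<Rightarrow> nat set \<Rightarrow> nat \<Rightarrow> 'k" where
  "normalized \<pi> P j = (if j \<in> P then \<pi> j else 1)"

lemma weight_le: "n \<le> N \<Longrightarrow> weight \<pi> P n = (\<Prod>j\<in>{2..N} - P. \<pi> j ^ (n div j))"
  unfolding weight_def
  by (rule prod.mono_neutral_left) (auto, metis div_less not_le power_0)

lemma cc_normalized:
  "cc \<pi> a b * (weight \<pi> P a * weight \<pi> P b) = cc (normalized \<pi> P) a b * weight \<pi> P (a + b)"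
proof -
  let ?N = "a + b"
  have "cc \<pi> a b = (\<Prod>j\<in>{2..?N} - P. \<pi> j ^ eps j a b) * (\<Prod>j\<in>{2..?N} \<inter> P. \<pi> j ^ eps j a b)"
    unfolding cc_eq_prod by (subst prod.subset_diff[of "{2..?N} \<inter> P"]) (auto simp: Diff_Int)
  moreover have "cc (normalized \<pi> P) a b = (\<Prod>j\<in>{2..?N} \<inter> P. \<pi> j ^ eps j a b)"
    unfolding cc_eq_prod
    by (rule prod.mono_neutral_cong_right) (auto simp: normalized_def)
  moreover have "weight \<pi> P (a + b)
      = (\<Prod>j\<in>{2..?N} - P. \<pi> j ^ eps j a b) * (weight \<pi> P a * weight \<pi> P b)"
    by (simp add: weight_le[of _ ?N] div_add_eps power_add prod.distrib mult_ac)
  ultimately show ?thesis by (simp add: mult_ac)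
qed

text \<open>Induced by the algebra map that sends the basis element of degree n of the normalized
  algebra to \<open>weight \<pi> P n\<close> x^[n]. If P contains all n \<ge> 2 with \<pi> n in M
  and M is prime, the weights lie outside M and the map is invertible after localization at
  M.\<close>

definition rescale :: "(nat \<Rightarrow> 'k::comm_ring_1) \<Rightarrow> nat set \<Rightarrow> 'k vec \<Rightarrow> 'k vec" where
  "rescale \<pi> P v = (\<lambda>i n. weight \<pi> P n * v i n)"

lemma rescale_linear: "rescale \<pi> P (v + w) = rescale \<pi> P v + rescale \<pi> P w"
  "rescale \<pi> P (sm c v) = sm c (rescale \<pi> P v)" "rescale \<pi> P 0 = 0"
  by (auto simp: rescale_def fun_eq_iff vec_apply algebra_simps)

lemma rescale_X: "rescale \<pi> P (X (normalized \<pi> P) n v) = sm (weight \<pi> P n) (X \<pi> n (rescale \<pi> P v))"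
proof (intro ext)
  fix i m
  show "rescale \<pi> P (X (normalized \<pi> P) n v) i m = sm (weight \<pi> P n) (X \<pi> n (rescale \<pi> P v)) i m"
  proof (cases "n \<le> m")
    case False
    then show ?thesis by (simp add: rescale_def X_apply vec_apply)
  next
    case True
    then obtain k where m: "m = n + k" by (auto simp: le_iff_add)
    show ?thesis
      using arg_cong[OF cc_normalized[of \<pi> n k P], of "\<lambda>x. x * v i k"]
      by (simp add: rescale_def m vec_apply mult_ac)
  qed
qed

context prime_setup
begin

lemma prod_notin_M: "(\<And>a. a \<in> A \<Longrightarrow> f a \<notin> M) \<Longrightarrow> prod f A \<notin> M"
  by (induction A rule: infinite_finite_induct) (use M_one M_prime in auto)

lemma power_notin_M: "a \<notin> M \<Longrightarrow> a ^ n \<notin> M"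
  by (induction n) (use M_one M_prime in auto)

lemma torsion_free_local:
  assumes inf: "infinite {n. 2 \<le> n \<and> \<pi> n \<in> M}"
    and comp: "\<And>m n. 2 \<le> m \<Longrightarrow> 2 \<le> n \<Longrightarrow> \<pi> m \<in> M \<Longrightarrow> \<pi> n \<in> M \<Longrightarrow> m dvd n \<or> n dvd m"
    and Z: "fg \<pi> r Z" and v: "v \<in> F r" and tors: "\<And>n. n \<ge> n0 \<Longrightarrow> X \<pi> n v \<in> Z"
  shows "\<exists>\<sigma>. \<sigma> \<notin> M \<and> sm \<sigma> v \<in> Z"
proof -
  note s = fg_subm[OF Z]
  define P where "P = {n. 2 \<le> n \<and> \<pi> n \<in> M}"
  define \<rho> where "\<rho> = normalized \<pi> P"
  have ch: "dchain M \<rho> P"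
    using inf comp by (auto simp: dchain_def P_def \<rho>_def normalized_def)
  have wt: "weight \<pi> P n \<notin> M" for n
    unfolding weight_def by (intro prod_notin_M power_notin_M) (auto simp: P_def)
  obtain G where G: "finite G" "G \<subseteq> F r" "Z = dspan \<pi> G" using Z by (auto simp: fg_def)
  obtain B where B: "\<And>g i n. g \<in> insert v G \<Longrightarrow> n \<ge> B \<Longrightarrow> g i n = 0"
    using finite_F_bound[of "insert v G" r] G v by blast
  define W where "W = (\<Prod>m<B. weight \<pi> P m)"
  \<comment> \<open>The inverse of the rescaling multiplied by W, which clears the denominators in
    degrees below B.\<close>
  define star where "star g = (\<lambda>i n. (\<Prod>m\<in>{..<B} - {n}. weight \<pi> P m) * g i n)" for g :: "'k vec"
  have W: "W \<notin> M" unfolding W_def by (intro prod_notin_M wt)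
  have star: "rescale \<pi> P (star g) = sm W g" if "g \<in> insert v G" for g
  proof (intro ext)
    fix i n
    show "rescale \<pi> P (star g) i n = sm W g i n"
    proof (cases "n < B")
      case True
      then have "W = weight \<pi> P n * (\<Prod>m\<in>{..<B} - {n}. weight \<pi> P m)"
        unfolding W_def by (intro prod.remove) auto
      then show ?thesis by (simp add: rescale_def star_def vec_apply mult_ac)
    next
      case False
      then show ?thesis using B[OF that, of n i] by (simp add: rescale_def star_def vec_apply)
    qed
  qed
  have star_F: "star g \<in> F r" if "g \<in> insert v G" for g
  proof -
    have "g \<in> F r" using that G(2) v by auto
    then show ?thesis using B[OF that] by (intro FI[where B = B]) (auto simp: star_def F_out)
  qed
  define Z' where "Z' = dspan \<rho> (star ` G)"
  have Z': "fg \<rho> r Z'" unfolding Z'_def using G(1) star_F by (intro fg_dspan) auto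
  note s' = fg_subm[OF Z']
  have down: "rescale \<pi> P u \<in> Z" if "u \<in> Z'" for u
    using that unfolding Z'_def
  proof (induction rule: dspan_induct)
    case zero
    show "rescale \<pi> P 0 \<in> Z" by (simp add: rescale_linear subm_0[OF s])
  next
    case (base n h)
    then obtain g where g: "g \<in> G" "h = star g" by blast
    then have "rescale \<pi> P (X \<rho> n h) = sm (weight \<pi> P n) (X \<pi> n (sm W g))"
      unfolding \<rho>_def rescale_X using star[of g] by simp
    also have "\<dots> \<in> Z" using g(1) by (intro subm_sm[OF s] subm_X[OF s]) (simp add: G(3) dspan_inc)
    finally show ?case .
  next
    case (add c a b)
    then show "rescale \<pi> P (sm c a + b) \<in> Z" by (simp add: rescale_linear subm_add[OF s] subm_sm[OF s])
  qed
  have up: "\<exists>\<sigma> u. \<sigma> \<notin> M \<and> u \<in> Z' \<and> rescale \<pi> P u = sm \<sigma> z" if "z \<in> Z" for z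
    using that unfolding G(3)
  proof (induction rule: dspan_induct)
    case zero
    show "\<exists>\<sigma> u. \<sigma> \<notin> M \<and> u \<in> Z' \<and> rescale \<pi> P u = sm \<sigma> 0"
      by (rule exI[of _ 1], rule exI[of _ 0]) (simp add: M_one subm_0[OF s'] rescale_linear)
  next
    case (base n g)
    have "rescale \<pi> P (X \<rho> n (star g)) = sm (weight \<pi> P n * W) (X \<pi> n g)"
      unfolding \<rho>_def rescale_X using star[of g] base by (simp add: X_sm)
    moreover have "X \<rho> n (star g) \<in> Z'" unfolding Z'_def using base by (intro dspan_base) simp
    moreover have "weight \<pi> P n * W \<notin> M" using M_prime wt W by blast
    ultimately show "\<exists>\<sigma> u. \<sigma> \<notin> M \<and> u \<in> Z' \<and> rescale \<pi> P u = sm \<sigma> (X \<pi> n g)" by metis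
  next
    case (add c a b)
    then obtain \<sigma> u \<tau> w where *: "\<sigma> \<notin> M" "u \<in> Z'" "rescale \<pi> P u = sm \<sigma> a"
      "\<tau> \<notin> M" "w \<in> Z'" "rescale \<pi> P w = sm \<tau> b" by blast
    have "rescale \<pi> P (sm (c * \<tau>) u + sm \<sigma> w) = sm (\<sigma> * \<tau>) (sm c a + b)"
      by (simp add: rescale_linear * V.scale_right_distrib mult_ac)
    moreover have "sm (c * \<tau>) u + sm \<sigma> w \<in> Z'" using * by (intro subm_add[OF s'] subm_sm[OF s'])
    moreover have "\<sigma> * \<tau> \<notin> M" using M_prime * by blast
    ultimately show "\<exists>\<sigma> u. \<sigma> \<notin> M \<and> u \<in> Z' \<and> rescale \<pi> P u = sm \<sigma> (sm c a + b)" by metis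
  qed
  have "torsion_mod M \<rho> Z' (star v)"
    unfolding torsion_mod_def
  proof (intro exI[of _ n0] allI impI)
    fix n assume "n \<ge> n0"
    then obtain \<sigma> u where u: "\<sigma> \<notin> M" "u \<in> Z'" "rescale \<pi> P u = sm \<sigma> (X \<pi> n v)" using up tors by blast
    define y where "y = sm \<sigma> (X \<rho> n (star v)) - sm (weight \<pi> P n * W) u"
    have yF: "y \<in> F r" unfolding y_def using fg_subset[OF Z'] u(2) star_F[of v] by (auto intro!: F_diff F_sm F_X)
    have "rescale \<pi> P (y + sm (weight \<pi> P n * W) u) = sm \<sigma> (sm (weight \<pi> P n) (X \<pi> n (sm W v)))"
      unfolding y_def by (simp add: rescale_linear \<rho>_def rescale_X star)
    then have "rescale \<pi> P y + sm (weight \<pi> P n * W) (sm \<sigma> (X \<pi> n v)) = sm (weight \<pi> P n * W) (sm \<sigma> (X \<pi> n v))"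
      unfolding rescale_linear u(3) by (simp add: X_sm mult_ac)
    then have y0: "rescale \<pi> P y = 0" by simp
    \<comment> \<open>Weights may be zero divisors, so \<open>rescale \<pi> P y = 0\<close> does not
      give y = 0; but the product \<tau> of finitely many weights kills y and lies outside
      M.\<close>
    obtain C where C: "\<And>i n. n \<ge> C \<Longrightarrow> y i n = 0" using F_bound[OF yF] by blast
    define \<tau> where "\<tau> = (\<Prod>m<C. weight \<pi> P m)"
    have "sm \<tau> y = 0"
    proof (intro ext)
      fix i m
      have w0: "weight \<pi> P m * y i m = 0" using fun_cong[OF fun_cong[OF y0, of i], of m] by (simp add: rescale_def zero_fun_apply)
      show "sm \<tau> y i m = 0 i m"
      proof (cases "m < C")
        case True
        then have "\<tau> = weight \<pi> P m * (\<Prod>k\<in>{..<C} - {m}. weight \<pi> P k)"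
          unfolding \<tau>_def by (intro prod.remove) auto
        then have "\<tau> * y i m = (weight \<pi> P m * y i m) * (\<Prod>k\<in>{..<C} - {m}. weight \<pi> P k)" by (simp add: mult_ac)
        then show ?thesis by (simp add: vec_apply w0)
      next
        case False
        then show ?thesis using C[of m i] by (simp add: vec_apply)
      qed
    qed
    then have "sm (\<tau> * \<sigma>) (X \<rho> n (star v)) = sm (\<tau> * (weight \<pi> P n * W)) u"
      unfolding y_def by (simp add: V.scale_right_diff_distrib)
    also have "\<dots> \<in> Z'" by (rule subm_sm[OF s' u(2)])
    finally have "sm (\<tau> * \<sigma>) (X \<rho> n (star v)) \<in> Z'" .
    moreover have "\<tau> * \<sigma> \<notin> M" using M_prime prod_notin_M[of "{..<C}" "weight \<pi> P"] wt u(1) unfolding \<tau>_def by blast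
    ultimately show "\<exists>\<sigma>. \<sigma> \<notin> M \<and> sm \<sigma> (X \<rho> n (star v)) \<in> Z'" by blast
  qed
  moreover have zero: "cr_ideal ({0} :: 'k set)" by (auto simp: cr_ideal_def)
  moreover have "IF {0} r \<subseteq> Z'"
  proof
    fix u :: "'k vec" assume "u \<in> IF {0} r"
    then have "u = 0" by (auto simp: IF_def inI_def fun_eq_iff zero_fun_apply)
    then show "u \<in> Z'" using subm_0[OF s'] by simp
  qed
  ultimately obtain \<sigma> where \<sigma>: "\<sigma> \<notin> M" "sm \<sigma> (star v) \<in> Z'"
    using Coh_and_Tor[OF zero ch] Z' star_F[of v] unfolding Tor_def by blast
  have "sm (\<sigma> * W) v \<in> Z" using down[OF \<sigma>(2)] star[of v] by (simp add: rescale_linear)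
  moreover have "\<sigma> * W \<notin> M" using M_prime \<sigma>(1) W by blast
  ultimately show ?thesis by blast
qed

end

section \<open>Maximal ideals\<close>

lemma ex_maximal_ideal:
  fixes J :: "'k::comm_ring_1 set"
  assumes "cr_ideal J" "1 \<notin> J"
  obtains M where "maximal_ideal M" "J \<subseteq> M"
proof -
  let ?A = "{I. cr_ideal I \<and> J \<subseteq> I \<and> 1 \<notin> I}"
  have "\<exists>M\<in>?A. \<forall>I\<in>?A. M \<subseteq> I \<longrightarrow> I = M"
  proof (rule subset_Zorn)
    fix C assume C: "subset.chain ?A C"
    show "\<exists>U\<in>?A. \<forall>I\<in>C. I \<subseteq> U"
    proof (cases "C = {}")
      case True
      then show ?thesis using assms by blast
    next
      case False
      have "subset.chain {I. cr_ideal I} C" using C by (auto simp: subset.chain_def)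
      then have "cr_ideal (\<Union>C)" using False by (rule ideal_Union_chain)
      moreover have CA: "C \<subseteq> ?A" using C by (simp add: subset.chain_def)
      have "J \<subseteq> \<Union>C" using CA False by blast
      moreover have "1 \<notin> \<Union>C" using CA by blast
      ultimately show ?thesis by blast
    qed
  qed
  then obtain M where M: "M \<in> ?A" "\<forall>I\<in>?A. M \<subseteq> I \<longrightarrow> I = M" by (rule bexE)
  have "maximal_ideal M"
    unfolding maximal_ideal_def
  proof (intro conjI allI impI)
    show "cr_ideal M" "M \<noteq> UNIV" using M(1) by auto
    fix I assume I: "cr_ideal I \<and> M \<subseteq> I"
    show "I = M \<or> I = UNIV"
    proof (cases "1 \<in> I")
      case True
      then have "x \<in> I" for x using ideal_mult[of I 1 x] I by simp
      then show ?thesis by blast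
    next
      case False
      then have "I \<in> ?A" using I M(1) by blast
      then show ?thesis using M(2) I by blast
    qed
  qed
  then show ?thesis using that M(1) by blast
qed

lemma
  assumes "maximal_ideal M"
  shows maximal_ideal_ideal: "cr_ideal M"
    and maximal_ideal_one: "1 \<notin> M"
    and maximal_ideal_unit: "a \<notin> M \<Longrightarrow> \<exists>x\<in>M. \<exists>y. 1 = x + a * y"
    and maximal_ideal_prime: "a * b \<in> M \<Longrightarrow> a \<in> M \<or> b \<in> M"
proof -
  show M: "cr_ideal M" using assms by (simp add: maximal_ideal_def)
  show one: "1 \<notin> M"
  proof
    assume "1 \<in> M"
    then have "x \<in> M" for x using ideal_mult[OF M, of 1 x] by simp
    then show False using assms by (auto simp: maximal_ideal_def)
  qed
  show unit: "\<exists>x\<in>M. \<exists>y. 1 = x + a * y" if "a \<notin> M" for a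
  proof -
    have "add_principal M a \<noteq> M" using add_principal_mem[OF M, of a 1] that by auto
    then have "add_principal M a = UNIV"
      using assms ideal_add_principal[OF M] add_principal_subset[of M a] by (auto simp: maximal_ideal_def)
    then have "1 \<in> add_principal M a" by simp
    then show ?thesis by (auto simp: add_principal_def)
  qed
  show "a \<in> M \<or> b \<in> M" if "a * b \<in> M"
  proof (rule ccontr)
    assume n: "\<not> (a \<in> M \<or> b \<in> M)"
    then obtain x y where xy: "x \<in> M" "1 = x + a * y" using unit by blast
    have "b = b * (x + a * y)" using xy(2) by simp
    also have "\<dots> = b * x + y * (a * b)" by (simp add: algebra_simps)
    also have "\<dots> \<in> M" by (intro ideal_add[OF M] ideal_mult[OF M] xy that)
    finally show False using n by blast
  qed
qed

section \<open>Finitely presented modules\<close>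

definition column :: "nat \<Rightarrow> (nat \<Rightarrow> nat \<Rightarrow> nat \<Rightarrow> 'k::comm_ring_1) \<Rightarrow> nat \<Rightarrow> 'k vec" where
  "column r A j = (\<lambda>i n. if i < r then A i j n else 0)"

text \<open>The matrix formulation ignores rows from r on; cutting them off gives the representative
  in \<open>F r\<close>.\<close>

definition restr :: "nat \<Rightarrow> 'k::comm_ring_1 vec \<Rightarrow> 'k vec" where
  "restr r v = (\<lambda>i n. if i < r then v i n else 0)"

lemma Delem_iff: "Delem f \<longleftrightarrow> (\<exists>B. \<forall>n\<ge>B. f n = 0)"
proof
  assume "Delem f"
  then obtain B where "\<And>n. f n \<noteq> 0 \<Longrightarrow> n < B" by (auto simp: Delem_def finite_nat_set_iff_bounded)
  then have "\<forall>n\<ge>B. f n = 0" using not_le by blast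
  then show "\<exists>B. \<forall>n\<ge>B. f n = 0" ..
next
  assume "\<exists>B. \<forall>n\<ge>B. f n = 0"
  then obtain B where "\<forall>n\<ge>B. f n = 0" ..
  then have "{i. f i \<noteq> 0} \<subseteq> {..<B}" using not_less by auto
  then show "Delem f" by (simp add: Delem_def finite_subset)
qed

lemma restr_in_F: "Dvec r v \<Longrightarrow> restr r v \<in> F r"
proof -
  assume "Dvec r v"
  then have "\<forall>i\<in>{..<r}. \<exists>B. \<forall>n\<ge>B. v i n = 0" by (auto simp: Dvec_def Delem_iff)
  from bchoice[OF this] obtain B where B: "\<forall>i\<in>{..<r}. \<forall>n\<ge>B i. v i n = 0" ..
  have "v i n = 0" if "i < r" "n \<ge> (\<Sum>k<r. B k)" for i n
  proof -
    have "B i \<le> (\<Sum>k<r. B k)" using that(1) by (intro member_le_sum) auto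
    then show ?thesis using B that by auto
  qed
  then show ?thesis by (intro FI[where B = "\<Sum>k<r. B k"]) (auto simp: restr_def)
qed

lemma column_in_F: "Dmatrix r s A \<Longrightarrow> j < s \<Longrightarrow> column r A j \<in> F r"
  using restr_in_F[of r "\<lambda>i. A i j"] by (auto simp: Dmatrix_def Dvec_def restr_def column_def)

lemma F_Delem: "c \<in> F s \<Longrightarrow> Delem (c j)"
  by (auto simp: Delem_iff F_def)

lemma Dmult_xdp: "Dmult \<pi> (xdp N) (v i) = X \<pi> N v i"
proof
  fix t
  have "Dmult \<pi> (xdp N) (v i) t = (\<Sum>m\<le>t. if N \<le> t \<and> m = t - N then Cnm \<pi> t m * v i m else 0)"
    unfolding Dmult_def by (rule sum.cong) (auto simp: xdp_def)
  also have "\<dots> = (if N \<le> t then Cnm \<pi> t (t - N) * v i (t - N) else 0)"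
    by (cases "N \<le> t") simp_all
  also have "\<dots> = X \<pi> N v i t"
    by (simp add: X_apply cc_def)
  finally show "Dmult \<pi> (xdp N) (v i) t = X \<pi> N v i t" .
qed

lemma act_eq_Dmult:
  assumes "i < r"
  shows "act \<pi> f (column r A j) i t = Dmult \<pi> (A i j) f t"
  unfolding act_apply Dmult_def
proof (rule sum.cong)
  fix n assume "n \<in> {..t}"
  then have n: "n \<le> t" by simp
  have "cc \<pi> n (t - n) = Cnm \<pi> t n"
    using n by (subst cc_commute) (simp add: cc_def)
  then show "f n * X \<pi> n (column r A j) i t = Cnm \<pi> t n * A i j (t - n) * f n"
    using n assms by (simp add: X_apply column_def mult_ac)
qed simp

lemma in_image_iff:
  assumes A: "Dmatrix r s A"
  shows "in_image \<pi> r s A v \<longleftrightarrow> restr r v \<in> dspan \<pi> (column r A ` {..<s})"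
proof -
  obtain L where L: "lin \<pi> s r L" "L ` F s = dspan \<pi> (column r A ` {..<s})"
    "L = (\<lambda>c. \<Sum>j<s. act \<pi> (c j) (column r A j))"
    using ex_lin[of s "column r A" r \<pi>] column_in_F[OF A] by blast
  have Lc: "L c i t = (\<Sum>j<s. Dmult \<pi> (A i j) (c j) t)" if "i < r" for c i t
    unfolding L(3) sum_vec_apply by (rule sum.cong) (auto simp: act_eq_Dmult[OF that])
  show ?thesis
  proof
    assume "in_image \<pi> r s A v"
    then obtain c where c: "\<And>j. j < s \<Longrightarrow> Delem (c j)" "\<And>i. i < r \<Longrightarrow> v i = (\<lambda>t. \<Sum>j<s. Dmult \<pi> (A i j) (c j) t)"
      by (auto simp: in_image_def)
    have cF: "restr s c \<in> F s" using c(1) by (intro restr_in_F) (simp add: Dvec_def)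
    have "L (restr s c) = restr r v"
    proof (intro ext)
      fix i t
      show "L (restr s c) i t = restr r v i t"
      proof (cases "i < r")
        case True
        have "L (restr s c) i t = (\<Sum>j<s. Dmult \<pi> (A i j) (c j) t)"
          unfolding Lc[OF True] by (rule sum.cong) (auto simp: restr_def)
        then show ?thesis using True c(2)[OF True] by (simp add: restr_def)
      next
        case False
        then show ?thesis using F_out[OF lin_F[OF L(1) cF]] by (simp add: restr_def)
      qed
    qed
    then show "restr r v \<in> dspan \<pi> (column r A ` {..<s})" using imageI[OF cF, of L] by (simp add: L(2))
  next
    assume "restr r v \<in> dspan \<pi> (column r A ` {..<s})"
    then obtain c where c: "c \<in> F s" "restr r v = L c" unfolding L(2)[symmetric] by (rule imageE)
    have "v i t = (\<Sum>j<s. Dmult \<pi> (A i j) (c j) t)" if "i < r" for i t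
      using fun_cong[OF fun_cong[OF c(2), of i], of t] that by (simp add: Lc restr_def)
    then show "in_image \<pi> r s A v"
      unfolding in_image_def using F_Delem[OF c(1)] by (intro exI[of _ c]) (auto intro!: ext)
  qed
qed

lemma fp_torsion_iff:
  assumes "Dmatrix r s A"
  shows "fp_torsion \<pi> r s A v \<longleftrightarrow> (\<exists>n0. \<forall>n\<ge>n0. X \<pi> n (restr r v) \<in> dspan \<pi> (column r A ` {..<s}))"
proof -
  have "restr r (\<lambda>i. Dmult \<pi> (xdp n) (v i)) = X \<pi> n (restr r v)" for n
    by (auto simp: Dmult_xdp restr_def X_apply fun_eq_iff)
  then show ?thesis by (simp add: fp_torsion_def in_image_iff[OF assms])
qed

text \<open>The scalars that move v into the column module form an ideal. If it were proper, a
  maximal ideal above it would contradict \<open>torsion_free_local\<close>.\<close>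

lemma fp_torsion_free_if:
  fixes \<pi> :: "nat \<Rightarrow> 'k::comm_ring_1"
  assumes noeth: "noetherian TYPE('k)" and adm: "admissible \<pi>"
    and inf: "\<And>M. maximal_ideal M \<Longrightarrow> infinite {n. \<pi> n \<in> M}" and A: "Dmatrix r s A"
  shows "fp_torsion_free \<pi> r s A"
  unfolding fp_torsion_free_def
proof (intro allI impI)
  fix v assume v: "Dvec r v \<and> fp_torsion \<pi> r s A v"
  define Z where "Z = dspan \<pi> (column r A ` {..<s})"
  have Z: "fg \<pi> r Z" unfolding Z_def using column_in_F[OF A] by (intro fg_dspan) auto
  note sub = fg_subm[OF Z]
  have vF: "restr r v \<in> F r" using v restr_in_F by blast
  obtain n0 where n0: "\<And>n. n \<ge> n0 \<Longrightarrow> X \<pi> n (restr r v) \<in> Z"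
    using v unfolding fp_torsion_iff[OF A] Z_def by blast
  define J where "J = {\<sigma>. sm \<sigma> (restr r v) \<in> Z}"
  have J: "cr_ideal J"
    unfolding cr_ideal_def J_def using subm_0[OF sub] subm_add[OF sub] subm_sm[OF sub]
    by (auto simp: V.scale_left_distrib V.scale_scale[symmetric] simp del: V.scale_scale)
  have "1 \<in> J"
  proof (rule ccontr)
    assume "1 \<notin> J"
    then obtain M where M: "maximal_ideal M" "J \<subseteq> M" using ex_maximal_ideal[OF J] by blast
    interpret prime_setup M
      using noeth maximal_ideal_ideal[OF M(1)] maximal_ideal_one[OF M(1)] maximal_ideal_prime[OF M(1)]
      by unfold_locales auto
    have "{n. \<pi> n \<in> M} \<subseteq> {n. 2 \<le> n \<and> \<pi> n \<in> M} \<union> {..<2}" by auto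
    then have inf': "infinite {n. 2 \<le> n \<and> \<pi> n \<in> M}"
      using inf[OF M(1)] by (meson finite_Un finite_lessThan finite_subset)
    have comp: "m dvd n \<or> n dvd m" if "2 \<le> m" "2 \<le> n" "\<pi> m \<in> M" "\<pi> n \<in> M" for m n
    proof -
      have "a * \<pi> m + b * \<pi> n \<in> M" for a b using that by (intro ideal_add[OF M_ideal] ideal_mult[OF M_ideal])
      then have "\<not> (\<exists>a b. a * \<pi> m + b * \<pi> n = 1)" using M_one by metis
      then show ?thesis using adm that unfolding admissible_def by blast
    qed
    obtain \<sigma> where "\<sigma> \<notin> M" "sm \<sigma> (restr r v) \<in> Z"
      using torsion_free_local[OF inf' comp Z vF n0] by blast
    then show False using M(2) by (auto simp: J_def)
  qed
  then have "restr r v \<in> Z" by (simp add: J_def)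
  then show "in_image \<pi> r s A v" by (simp add: in_image_iff[OF A] Z_def)
qed

text \<open>The quotient of D by M and x^[N] has a presentation with one row, generators of M in
  degree 0 and x^[N] in degree N. It is graded, so it refutes both the graded and the ungraded form
  of (a).\<close>

lemma ex_graded_torsion:
  fixes \<pi> :: "nat \<Rightarrow> 'k::comm_ring_1" and M :: "'k set"
  assumes noeth: "noetherian TYPE('k)" and \<pi>1: "\<pi> 1 = 0" and adm: "admissible \<pi>"
    and M: "maximal_ideal M" and fin: "finite {n. \<pi> n \<in> M}"
  obtains r s A and d e :: "nat \<Rightarrow> int" where "Dmatrix r s A"
    "\<forall>i<r. \<forall>j<s. homogeneous (A i j) (e j - d i)" "\<not> fp_torsion_free \<pi> r s A"
proof -
  note Mi = maximal_ideal_ideal[OF M] and M1 = maximal_ideal_one[OF M]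
  interpret prime_setup M
    using noeth Mi M1 maximal_ideal_prime[OF M] by unfold_locales auto
  define N where "N = Max {n. \<pi> n \<in> M \<and> 1 \<le> n}"
  have fin': "finite {n. \<pi> n \<in> M \<and> 1 \<le> n}" by (rule finite_subset[OF _ fin]) auto
  \<comment> \<open>The convention \<pi> 1 = 0 guarantees an index; N = 1 occurs when no parameter
    from index 2 on lies in M.\<close>
  have "1 \<in> {n. \<pi> n \<in> M \<and> 1 \<le> n}" using \<pi>1 ideal_0[OF Mi] by simp
  then have "N \<in> {n. \<pi> n \<in> M \<and> 1 \<le> n}" unfolding N_def using Max_in[OF fin'] by blast
  then have N: "\<pi> N \<in> M" "1 \<le> N" by auto
  have Nmax: "n \<le> N" if "\<pi> n \<in> M" "1 \<le> n" for n unfolding N_def using fin' that by (intro Max_ge) auto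
  have cN: "cc \<pi> N b \<notin> M" for b
    unfolding cc_eq_prod
  proof (rule prod_notin_M)
    fix j assume j: "j \<in> {2..N + b}"
    show "\<pi> j ^ eps j N b \<notin> M"
    proof (cases "\<pi> j \<in> M")
      case False
      then show ?thesis by (rule power_notin_M)
    next
      case True
      have jN: "j \<le> N" using Nmax[OF True] j by simp
      have "a * \<pi> j + b * \<pi> N \<in> M" for a b using True N by (intro ideal_add[OF Mi] ideal_mult[OF Mi])
      then have "\<not> (\<exists>a b. a * \<pi> j + b * \<pi> N = 1)" using M1 by metis
      then have "j dvd N \<or> N dvd j" using adm j jN unfolding admissible_def by auto
      then have "j dvd N" using jN j by (auto dest: dvd_imp_le)
      then have "eps j N b = 0" using j by (simp add: eps_mod)
      then show ?thesis using M1 by simp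
    qed
  qed
  obtain S where S: "finite S" "S \<subseteq> M" "\<And>J. cr_ideal J \<Longrightarrow> S \<subseteq> J \<Longrightarrow> M \<subseteq> J"
    using noeth Mi unfolding noetherian_def by metis
  obtain f and q :: nat where "S = f ` {i. i < q}" using finite_imp_nat_seg_image_inj_on[OF S(1)] by blast
  then have f: "S = f ` {..<q}" by (simp add: lessThan_def)
  define A :: "nat \<Rightarrow> nat \<Rightarrow> nat \<Rightarrow> 'k" where
    "A i j = (if j < q then (\<lambda>n. if n = 0 then f j else 0) else xdp N)" for i j
  have A: "Dmatrix 1 (Suc q) A"
    unfolding Dmatrix_def Delem_iff by (auto simp: A_def xdp_def intro!: exI[of _ "Suc N"])
  have col: "column 1 A j = (if j < q then sm (f j) (ebas 0) else X \<pi> N (ebas 0))" for j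
    by (auto simp: column_def A_def xdp_def fun_eq_iff vec_apply X_ebas) (auto simp: ebas_def)
  define Z where "Z = dspan \<pi> (column 1 A ` {..<Suc q})"
  have Zs: "subm \<pi> Z" unfolding Z_def by (rule subm_dspan)
  have gen: "column 1 A j \<in> Z" if "j \<le> q" for j unfolding Z_def using that by (intro dspan_inc) auto
  have rv: "restr 1 (\<lambda>i. xdp 0) = (ebas 0 :: 'k vec)" by (auto simp: restr_def xdp_def ebas_def fun_eq_iff)
  have "X \<pi> n (ebas 0) \<in> Z" if le: "n \<ge> N" for n
  proof -
    obtain b where n: "n = b + N" using le by (metis le_add_diff_inverse2)
    \<comment> \<open>The structure constant is invertible modulo the maximal ideal M, so x^[n] is a
      combination of x x^[n], with x in M, and x^[b] x^[N].\<close>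
    obtain x y where xy: "x \<in> M" "1 = x + cc \<pi> b N * y"
      using maximal_ideal_unit[OF M cN[of b]] unfolding cc_commute[of \<pi> N b] by blast
    have "cr_ideal {x. sm x (X \<pi> n (ebas 0)) \<in> Z}"
      unfolding cr_ideal_def using subm_0[OF Zs] subm_add[OF Zs] subm_sm[OF Zs]
      by (auto simp: V.scale_left_distrib V.scale_scale[symmetric] simp del: V.scale_scale)
    moreover have "S \<subseteq> {x. sm x (X \<pi> n (ebas 0)) \<in> Z}"
      unfolding f
    proof clarify
      fix j assume "j < q"
      then have "sm (f j) (ebas 0) \<in> Z" using gen[of j] col[of j] by simp
      from subm_X[OF Zs this, of n] show "sm (f j) (X \<pi> n (ebas 0)) \<in> Z" by (simp add: X_sm)
    qed
    ultimately have 1: "sm x (X \<pi> n (ebas 0)) \<in> Z" using S(3) xy(1) by blast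
    have "X \<pi> N (ebas 0) \<in> Z" using gen[of q] col[of q] by simp
    from subm_X[OF Zs this, of b] have "sm (cc \<pi> b N) (X \<pi> n (ebas 0)) \<in> Z" by (simp add: X_X n)
    from subm_sm[OF Zs this, of y] have 2: "sm (cc \<pi> b N * y) (X \<pi> n (ebas 0)) \<in> Z" by (simp add: mult.commute)
    from subm_add[OF Zs 1 2] have "sm (x + cc \<pi> b N * y) (X \<pi> n (ebas 0)) \<in> Z" by (simp add: V.scale_left_distrib)
    then show ?thesis by (simp add: xy(2)[symmetric])
  qed
  then have "fp_torsion \<pi> 1 (Suc q) A (\<lambda>i. xdp 0)"
    unfolding fp_torsion_iff[OF A] rv Z_def[symmetric] by blast
  moreover have "\<not> in_image \<pi> 1 (Suc q) A (\<lambda>i. xdp 0)"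
  proof
    assume "in_image \<pi> 1 (Suc q) A (\<lambda>i. xdp 0)"
    then have "ebas 0 \<in> dspan \<pi> (column 1 A ` {..<Suc q})" unfolding in_image_iff[OF A] rv .
    \<comment> \<open>The coefficient of x^[0] shows that the module is nonzero: on the column
      module it lies in M, because N \<ge> 1.\<close>
    moreover have "z 0 0 \<in> M" if "z \<in> dspan \<pi> (column 1 A ` {..<Suc q})" for z
      using that
    proof (induction rule: dspan_induct)
      case zero
      show "0 0 0 \<in> M" by (simp add: zero_fun_apply ideal_0[OF Mi])
    next
      case (base n g)
      then obtain j where "g = column 1 A j" by blast
      moreover have "f j \<in> M" if "j < q" using f S(2) that by auto
      ultimately have "g 0 0 \<in> M" using N(2)
        by (auto simp: col[unfolded One_nat_def] X_ebas vec_apply ideal_0[OF Mi]) (simp add: ebas_def)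
      then show "X \<pi> n g 0 0 \<in> M" by (auto simp: X_apply ideal_0[OF Mi])
    next
      case (add c a b)
      then show "(sm c a + b) 0 0 \<in> M" by (simp add: vec_apply ideal_add[OF Mi] ideal_mult[OF Mi])
    qed
    ultimately have "(ebas 0 :: 'k vec) 0 0 \<in> M" by blast
    then show False using M1 by (simp add: ebas_def)
  qed
  moreover have "Dvec 1 (\<lambda>i. xdp 0 :: nat \<Rightarrow> 'k)" by (auto simp: Dvec_def Delem_iff xdp_def intro!: exI[of _ 1])
  ultimately have "\<not> fp_torsion_free \<pi> 1 (Suc q) A" unfolding fp_torsion_free_def by blast
  moreover have "\<forall>i<1. \<forall>j<Suc q. homogeneous (A i j) ((if j < q then 0 else int N) - 0)"
    by (auto simp: homogeneous_def A_def xdp_def)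
  ultimately show ?thesis
    using that[of 1 "Suc q" A "\<lambda>j. if j < q then 0 else int N" "\<lambda>_. 0"] A by blast
qed

theorem theorem8p1:
  fixes \<pi> :: "nat \<Rightarrow> 'k::comm_ring_1"
  assumes "noetherian TYPE('k)"
    and "\<pi> 1 = 0"
    and "admissible \<pi>"
  shows "((\<forall>r s A. Dmatrix r s A \<longrightarrow> fp_torsion_free \<pi> r s A)
            \<longleftrightarrow> (\<forall>M::'k set. maximal_ideal M \<longrightarrow> infinite {n. \<pi> n \<in> M}))
       \<and> ((\<forall>r s A (d::nat \<Rightarrow> int) (e::nat \<Rightarrow> int). Dmatrix r s A \<and>
              (\<forall>i<r. \<forall>j<s. homogeneous (A i j) (e j - d i)) \<longrightarrow> fp_torsion_free \<pi> r s A)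
            \<longleftrightarrow> (\<forall>M::'k set. maximal_ideal M \<longrightarrow> infinite {n. \<pi> n \<in> M}))"
proof -
  let ?inf = "\<forall>M::'k set. maximal_ideal M \<longrightarrow> infinite {n. \<pi> n \<in> M}"
  have "fp_torsion_free \<pi> r s A" if ?inf "Dmatrix r s A" for r s A
    using fp_torsion_free_if[OF assms(1,3)] that by blast
  moreover have ?inf
    if "\<forall>r s A (d::nat \<Rightarrow> int) (e::nat \<Rightarrow> int). Dmatrix r s A \<and>
        (\<forall>i<r. \<forall>j<s. homogeneous (A i j) (e j - d i)) \<longrightarrow> fp_torsion_free \<pi> r s A"
    using ex_graded_torsion[OF assms] that by metis
  ultimately show ?thesis by blast
qed

end
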